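(* Let $\mathbf{k}$ be a field of characteristic zero, $B$ an affine $\mathbf{k}$-domain and $\mathbf{k}'$ the algebraic closure of $\mathbf{k}$ in $\operatorname{Frac}(B)$. Then $\mathbf{k}'$ is a finite extension of $\mathbf{k}$ and the following hold, where $n=\dim B$. (a) $\operatorname{ht}\mathcal{A}(B)\le\operatorname{ht}\mathcal{K}(B)\le n$. (b) If $\operatorname{ht}\mathcal{K}(B)=n$ then $\operatorname{FML}(B)=\mathbf{k}'$. (c) If $\operatorname{ht}\mathcal{A}(B)=n$ then $\operatorname{FML}(B)=\mathbf{k}'$, $\operatorname{Frac}(B)=\mathbf{k}'^{(n)}$, and $B\subseteq\mathbf{k}'^{[n]}$ (i.e. there is an injective homomorphism of $\mathbf{k}$-algebras from $B$ to a polynomial ring in $n$ variables over $\mathbf{k}'$).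
   Context: All rings are commutative with unity; "domain" means integral domain. An affine $\mathbf{k}$-domain is a domain that is a finitely generated $\mathbf{k}$-algebra; $\dim$ is Krull dimension. A derivation $D:B\to B$ is locally nilpotent if for each $x\in B$ there is $n\in\mathbb{N}$ with $D^n(x)=0$; $\operatorname{LND}(B)$ is the set of locally nilpotent derivations $B\to B$. For a domain $B$ of characteristic zero and $\Delta\subseteq\operatorname{LND}(B)$, put $A_\Delta=\bigcap_{D\in\Delta}\ker D$ (intersection in $B$, $A_\emptyset=B$) and $K_\Delta=\bigcap_{D\in\Delta}\operatorname{Frac}(\ker D)$ (intersection in $\operatorname{Frac} B$, $K_\emptyset=\operatorname{Frac} B$). Put $\mathcal{A}(B)=\{A_\Delta:\Delta\subseteq\operatorname{LND}(B)\}$ and $\mathcal{K}(B)=\{K_\Delta:\Delta\subseteq\operatorname{LND}(B)\}$, viewed as posets under inclusion. $\operatorname{FML}(B)=\bigcap_{D\in\operatorname{LND}(B)}\operatorname{Frac}(\ker D)$. The height $\operatorname{ht}(X)\in\mathbb{N}\cup\{\infty\}$ of a poset $X$ is the supremum of the $n\in\mathbb{N}$ for which there is a strictly increasing sequence $x_0\prec x_1\prec\cdots\prec x_n$ in $X$. For a field $K$, $K^{[n]}$ denotes a polynomial ring in $n$ variables over $K$, and $L=K^{(n)}$ means that $L$ is a purely transcendental extension of $K$ of transcendence degree $n$. *)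

theory Defs
  imports
    "HOL-Computational_Algebra.Computational_Algebra"
    "HOL-Library.Poly_Mapping"
    "HOL-Library.Extended_Nat"
begin

section \<open>Height of a poset\<close>

definition poset_ht :: "'a::order set \<Rightarrow> enat" where
  "poset_ht X = (SUP n\<in>{n. \<exists>x :: nat \<Rightarrow> 'a. (\<forall>i\<le>n. x i \<in> X) \<and> (\<forall>i<n. x i < x (Suc i))}. enat n)"


section \<open>Krull dimension\<close>

definition is_ideal :: "'b::comm_ring_1 set \<Rightarrow> bool" where
  "is_ideal I \<longleftrightarrow> 0 \<in> I \<and> (\<forall>x\<in>I. \<forall>y\<in>I. x + y \<in> I) \<and> (\<forall>r. \<forall>x\<in>I. r * x \<in> I)"

definition is_prime_ideal :: "'b::comm_ring_1 set \<Rightarrow> bool" where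
  "is_prime_ideal P \<longleftrightarrow> is_ideal P \<and> P \<noteq> UNIV \<and> (\<forall>x y. x * y \<in> P \<longrightarrow> x \<in> P \<or> y \<in> P)"

definition krull_dim :: "'b::comm_ring_1 itself \<Rightarrow> enat" where
  "krull_dim _ = poset_ht {P :: 'b set. is_prime_ideal P}"


section \<open>Algebras over a field\<close>

definition is_ring_hom :: "('a::comm_ring_1 \<Rightarrow> 'b::comm_ring_1) \<Rightarrow> bool" where
  "is_ring_hom f \<longleftrightarrow> f 1 = 1 \<and> (\<forall>x y. f (x + y) = f x + f y) \<and> (\<forall>x y. f (x * y) = f x * f y)"

definition is_subring :: "'b::comm_ring_1 set \<Rightarrow> bool" where
  "is_subring S \<longleftrightarrow> 1 \<in> S \<and> (\<forall>x\<in>S. \<forall>y\<in>S. x - y \<in> S) \<and> (\<forall>x\<in>S. \<forall>y\<in>S. x * y \<in> S)"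

definition is_subfield :: "'a::field set \<Rightarrow> bool" where
  "is_subfield K \<longleftrightarrow> is_subring K \<and> (\<forall>x\<in>K. inverse x \<in> K)"

text \<open>
  A \<open>k\<close>-algebra structure on the ring \<open>'b\<close> is given by its structure homomorphism
  \<open>\<phi> :: 'k \<Rightarrow> 'b\<close>.  The subalgebra generated by \<open>S\<close> is the least subring containing
  \<open>range \<phi> \<union> S\<close>; that \<open>'b\<close> is a domain is expressed by the class \<^class>\<open>idom\<close>.
\<close>

definition affine_domain :: "('k::field \<Rightarrow> 'b::idom) \<Rightarrow> bool" where
  "affine_domain \<phi> \<longleftrightarrow>
     is_ring_hom \<phi> \<and> (\<exists>S. finite S \<and> is_subring hull (range \<phi> \<union> S) = UNIV)"


section \<open>Field extensions\<close>

definition frac_emb :: "'b::idom \<Rightarrow> 'b fract" where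
  "frac_emb b = Fract b 1"

text \<open>The algebraic closure in the field \<open>'a\<close> of the image of \<open>\<iota> :: 'k \<Rightarrow> 'a\<close>:\<close>

definition alg_closure_in :: "('k::field \<Rightarrow> 'a::field) \<Rightarrow> 'a set" where
  "alg_closure_in \<iota> = {x. \<exists>p :: 'k poly. p \<noteq> 0 \<and> poly (map_poly \<iota> p) x = 0}"

definition is_finite_ext :: "('k::field \<Rightarrow> 'a::field) \<Rightarrow> 'a set \<Rightarrow> bool" where
  "is_finite_ext \<iota> K \<longleftrightarrow>
     is_subfield K \<and> range \<iota> \<subseteq> K \<and> (\<exists>S. finite S \<and> K = module.span (\<lambda>c x. \<iota> c * x) S)"

text \<open>
  Polynomials in variables indexed by \<^typ>\<open>nat\<close> are finitely supported functions
  \<open>(nat \<Rightarrow>\<^sub>0 nat) \<Rightarrow>\<^sub>0 'a\<close> from monomials (exponent vectors) to coefficients, with the ring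
  structure (convolution product) of \<open>HOL-Library.Poly_Mapping\<close>.  \<open>mpol_ring K n\<close> is the
  subring of those with coefficients in \<open>K\<close> and in the variables \<open>0, \<dots>, n - 1\<close> only.
\<close>

type_synonym 'a mpol = "(nat \<Rightarrow>\<^sub>0 nat) \<Rightarrow>\<^sub>0 'a"

definition mpol_ring :: "'a::comm_ring_1 set \<Rightarrow> nat \<Rightarrow> 'a mpol set" where
  "mpol_ring K n =
     {p. (\<forall>m. Poly_Mapping.lookup p m \<in> K) \<and> (\<forall>m\<in>Poly_Mapping.keys p. Poly_Mapping.keys m \<subseteq> {..<n})}"

definition mpol_const :: "'a::comm_ring_1 \<Rightarrow> 'a mpol" where
  "mpol_const c = Poly_Mapping.single 0 c"

definition mpol_eval :: "(nat \<Rightarrow> 'a::comm_ring_1) \<Rightarrow> 'a mpol \<Rightarrow> 'a" where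
  "mpol_eval x p =
     (\<Sum>m\<in>Poly_Mapping.keys p. Poly_Mapping.lookup p m *
        (\<Prod>i\<in>Poly_Mapping.keys m. x i ^ Poly_Mapping.lookup m i))"

definition alg_indep :: "'a::field set \<Rightarrow> nat \<Rightarrow> (nat \<Rightarrow> 'a) \<Rightarrow> bool" where
  "alg_indep K n x \<longleftrightarrow> (\<forall>p\<in>mpol_ring K n. mpol_eval x p = 0 \<longrightarrow> p = 0)"

text \<open>\<open>L = K\<^sup>(\<^sup>n\<^sup>)\<close> for subfields \<open>K \<subseteq> L\<close> of the field \<open>'a\<close>:\<close>

definition purely_transcendental :: "'a::field set \<Rightarrow> 'a set \<Rightarrow> nat \<Rightarrow> bool" where
  "purely_transcendental K L n \<longleftrightarrow>
     (\<exists>x. alg_indep K n x \<and> is_subfield hull (K \<union> x ` {..<n}) = L)"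


section \<open>Locally nilpotent derivations\<close>

definition is_derivation :: "('b::comm_ring_1 \<Rightarrow> 'b) \<Rightarrow> bool" where
  "is_derivation D \<longleftrightarrow>
     (\<forall>x y. D (x + y) = D x + D y) \<and> (\<forall>x y. D (x * y) = D x * y + x * D y)"

definition LND :: "('b::comm_ring_1 \<Rightarrow> 'b) set" where
  "LND = {D. is_derivation D \<and> (\<forall>x. \<exists>n. (D ^^ n) x = 0)}"

definition der_ker :: "('b::comm_ring_1 \<Rightarrow> 'b) \<Rightarrow> 'b set" where
  "der_ker D = {x. D x = 0}"

definition frac_of :: "'b::idom set \<Rightarrow> 'b fract set" where
  "frac_of A = {Fract a b | a b. a \<in> A \<and> b \<in> A \<and> b \<noteq> 0}"

definition A_sub :: "('b::idom \<Rightarrow> 'b) set \<Rightarrow> 'b set" where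
  "A_sub \<Delta> = (\<Inter>D\<in>\<Delta>. der_ker D)"

definition K_sub :: "('b::idom \<Rightarrow> 'b) set \<Rightarrow> 'b fract set" where
  "K_sub \<Delta> = (\<Inter>D\<in>\<Delta>. frac_of (der_ker D))"

definition A_poset :: "'b::idom set set" where
  "A_poset = {A_sub \<Delta> | \<Delta>. \<Delta> \<subseteq> LND}"

definition K_poset :: "'b::idom fract set set" where
  "K_poset = {K_sub \<Delta> | \<Delta>. \<Delta> \<subseteq> LND}"

definition FML :: "'b::idom fract set" where
  "FML = (\<Inter>D\<in>LND. frac_of (der_ker D))"

end

theory Submission
  imports "HOL-Algebra.Algebraic_Closure_Type" Defs
begin

text \<open>
  Everything takes place in the field \<open>F = Frac B\<close>. A locally nilpotent derivation \<open>D\<close> extends to \<open>F\<close>, and the fraction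
  field of its kernel is the kernel of the extension. So \<open>K_sub \<Delta>\<close> is the common field of constants of the extensions.
  It is algebraically closed in \<open>F\<close>, it contains the algebraic closure \<open>k'\<close> of the ground field, and it determines \<open>A_sub \<Delta>\<close>
  as its intersection with \<open>B\<close>.

  The field \<open>k'\<close> is a finite extension because \<open>F\<close> is finite over a purely transcendental extension of the ground field
  and elements of \<open>k'\<close> that are dependent over such an extension are dependent over the ground field
  (\<open>finite_alg_closure\<close>).

  Elements chosen in the successive differences of a chain of fields \<open>K_sub \<Delta>\<close> are algebraically independent, and the
  number of independent elements is at most the Krull dimension \<open>n\<close>: specialising them one after the other gives a
  chain of primes (\<open>krull_dim_lower_bound\<close>). This bounds the height of the poset of fields, which in turn bounds the height of
  the poset of rings. A chain of length \<open>n\<close> cannot be refined, so its least member is \<open>k'\<close>, and so is the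
  intersection of all the fields (\<open>FML_maximal_height\<close>).

  Now suppose that a chain of rings has length \<open>n\<close>. The corresponding fields go from \<open>k'\<close> up to \<open>F\<close> in steps of
  transcendence degree one, and each step is generated by one element (\<open>kernel_tower_step\<close>): by means of a local slice
  \<open>t\<close> of a suitable derivation with field of constants \<open>L\<close>, the next field is the fraction field of its intersection with \<open>L[t]\<close>, and
  a form of Lueroth's theorem (\<open>lueroth_polynomial\<close>, \<open>rational\<close>) puts this intersection into a polynomial ring in one
  element \<open>u\<close>. That the
  coefficients are in the smaller field, and not only in \<open>L\<close>, uses that the smaller field consists of the
  constants of a set of derivations: these are extended so as to kill the subalgebra, the extension is shown to be
  polynomial and of degree at most one in the variable, and it is removed by an affine change of the variable. Hence \<open>F\<close> is
  purely transcendental over \<open>k'\<close>.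

  Being contained in a purely transcendental extension, \<open>B\<close> has \<open>k'\<close>-rational points \<open>P\<close> outside any given hypersurface.
  The composition of \<open>P\<close> with the exponentials \<open>exp (u\<^sub>i D\<^sub>i)\<close>, where \<open>D\<^sub>i\<close> belongs to the \<open>i\<close>-th step of the chain, maps \<open>B\<close> to
  a polynomial ring, and it is injective because it is triangular on elements chosen from the steps
  (\<open>exp_point_embedding\<close>).
\<close>

section \<open>Subrings, subfields and polynomials over them\<close>

lemma subring_1: "is_subring S \<Longrightarrow> 1 \<in> S"
  and subring_diff: "is_subring S \<Longrightarrow> x \<in> S \<Longrightarrow> y \<in> S \<Longrightarrow> x - y \<in> S"
  and subring_mult: "is_subring S \<Longrightarrow> x \<in> S \<Longrightarrow> y \<in> S \<Longrightarrow> x * y \<in> S"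
  by (auto simp: is_subring_def)

lemma subring_0: "is_subring S \<Longrightarrow> 0 \<in> S"
  using subring_diff[of S 1 1] subring_1[of S] by simp

lemma subring_uminus: "is_subring S \<Longrightarrow> x \<in> S \<Longrightarrow> - x \<in> S"
  using subring_diff[of S 0 x] subring_0[of S] by simp

lemma subring_add: "is_subring S \<Longrightarrow> x \<in> S \<Longrightarrow> y \<in> S \<Longrightarrow> x + y \<in> S"
  using subring_diff[of S x "- y"] subring_uminus[of S y] by simp

lemma subring_power: "is_subring S \<Longrightarrow> x \<in> S \<Longrightarrow> x ^ n \<in> S"
  by (induction n) (auto intro: subring_1 subring_mult)

lemma subring_sum: "is_subring S \<Longrightarrow> (\<And>i. i \<in> I \<Longrightarrow> f i \<in> S) \<Longrightarrow> sum f I \<in> S"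
  by (induction I rule: infinite_finite_induct) (auto intro: subring_0 subring_add)

lemma subring_prod: "is_subring S \<Longrightarrow> (\<And>i. i \<in> I \<Longrightarrow> f i \<in> S) \<Longrightarrow> prod f I \<in> S"
  by (induction I rule: infinite_finite_induct) (auto intro: subring_1 subring_mult)

lemma subring_of_nat: "is_subring S \<Longrightarrow> of_nat n \<in> S"
  by (induction n) (auto intro: subring_0 subring_1 subring_add)

lemmas subring_ops = subring_0 subring_1 subring_diff subring_mult subring_uminus subring_add
  subring_power subring_sum subring_prod subring_of_nat

lemma subring_hull: "is_subring (is_subring hull S)"
  by (rule hull_in) (auto simp: is_subring_def)

lemma subfield_hull: "is_subfield (is_subfield hull S)"
  by (rule hull_in) (auto simp: is_subring_def is_subfield_def)

lemma subfield_subring: "is_subfield K \<Longrightarrow> is_subring K"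
  by (simp add: is_subfield_def)

lemma subfield_inverse: "is_subfield K \<Longrightarrow> x \<in> K \<Longrightarrow> inverse x \<in> K"
  by (simp add: is_subfield_def)

lemma subfield_divide: "is_subfield K \<Longrightarrow> x \<in> K \<Longrightarrow> y \<in> K \<Longrightarrow> x / y \<in> K"
  by (simp add: is_subfield_def divide_inverse subring_mult)

lemma subfield_UNIV: "is_subfield UNIV"
  by (simp add: is_subfield_def is_subring_def)

definition poly_over :: "'a::comm_ring_1 set \<Rightarrow> 'a poly set" where
  "poly_over K = {p. \<forall>i. coeff p i \<in> K}"

lemma coeff_poly_over: "p \<in> poly_over K \<Longrightarrow> coeff p i \<in> K"
  by (simp add: poly_over_def)

lemma poly_over_UNIV: "poly_over UNIV = UNIV"
  by (simp add: poly_over_def)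

lemma poly_over_mono: "K \<subseteq> L \<Longrightarrow> poly_over K \<subseteq> poly_over L"
  by (auto simp: poly_over_def)

lemma subring_poly_over:
  assumes "is_subring K" shows "is_subring (poly_over K)"
  unfolding is_subring_def poly_over_def
  using assms by (auto simp: coeff_mult intro!: subring_ops)

lemma poly_over_0: "is_subring K \<Longrightarrow> 0 \<in> poly_over K"
  by (simp add: poly_over_def subring_0)

lemma poly_over_const: "is_subring K \<Longrightarrow> c \<in> K \<Longrightarrow> [:c:] \<in> poly_over K"
  by (auto simp: poly_over_def coeff_pCons subring_0 split: nat.splits)

lemma poly_over_monom: "is_subring K \<Longrightarrow> c \<in> K \<Longrightarrow> Polynomial.monom c n \<in> poly_over K"
  by (auto simp: poly_over_def subring_0)

lemma poly_over_smult: "is_subring K \<Longrightarrow> c \<in> K \<Longrightarrow> p \<in> poly_over K \<Longrightarrow> smult c p \<in> poly_over K"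
  by (auto simp: poly_over_def intro: subring_mult)

lemma poly_over_pCons: "c \<in> K \<Longrightarrow> p \<in> poly_over K \<Longrightarrow> pCons c p \<in> poly_over K"
  by (auto simp: poly_over_def coeff_pCons split: nat.splits)

lemma poly_over_pCons_iff: "pCons c p \<in> poly_over K \<longleftrightarrow> c \<in> K \<and> p \<in> poly_over K"
  by (fastforce simp: poly_over_def coeff_pCons split: nat.splits)

lemma poly_over_pderiv: "is_subring K \<Longrightarrow> p \<in> poly_over K \<Longrightarrow> pderiv p \<in> poly_over K"
  by (auto simp: poly_over_def coeff_pderiv simp del: of_nat_Suc intro!: subring_mult subring_of_nat)

lemma poly_poly_over: "is_subring K \<Longrightarrow> p \<in> poly_over K \<Longrightarrow> x \<in> K \<Longrightarrow> poly p x \<in> K"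
  by (auto simp: poly_altdef poly_over_def intro!: subring_ops)

lemma subring_eval_image:
  assumes W: "is_subring W" shows "is_subring ((\<lambda>p. poly p x) ` poly_over W)"
  unfolding is_subring_def
proof (intro conjI ballI)
  note Wp = subring_poly_over[OF W]
  show "1 \<in> (\<lambda>p. poly p x) ` poly_over W"
    by (rule image_eqI[of _ _ 1]) (auto intro: subring_1 Wp)
  fix u v assume "u \<in> (\<lambda>p. poly p x) ` poly_over W" "v \<in> (\<lambda>p. poly p x) ` poly_over W"
  then obtain p q where pq: "p \<in> poly_over W" "q \<in> poly_over W" "u = poly p x" "v = poly q x" by auto
  show "u - v \<in> (\<lambda>p. poly p x) ` poly_over W"
    using pq by (intro image_eqI[of _ _ "p - q"]) (auto intro: subring_diff Wp)
  show "u * v \<in> (\<lambda>p. poly p x) ` poly_over W"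
    using pq by (intro image_eqI[of _ _ "p * q"]) (auto intro: subring_mult Wp)
qed

lemma eval_image_base:
  assumes W: "is_subring W" shows "W \<subseteq> (\<lambda>p. poly p x) ` poly_over W"
proof
  fix c assume "c \<in> W"
  then show "c \<in> (\<lambda>p. poly p x) ` poly_over W"
    using poly_over_const[OF W] by (intro image_eqI[of _ _ "[:c:]"]) auto
qed

lemma poly_over_X: "is_subring W \<Longrightarrow> [:0, 1:] \<in> poly_over W"
  by (intro poly_over_pCons poly_over_0 subring_0 subring_1)

lemma eval_image_gen:
  assumes W: "is_subring W" shows "x \<in> (\<lambda>p. poly p x) ` poly_over W"
  using poly_over_X[OF W] by (intro image_eqI[of _ _ "[:0, 1:]"]) auto

lemma pcompose_poly_over:
  "is_subring K \<Longrightarrow> p \<in> poly_over K \<Longrightarrow> q \<in> poly_over K \<Longrightarrow> pcompose p q \<in> poly_over K"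
proof (induction p)
  case (pCons a p)
  then show ?case
    by (auto simp: pcompose_pCons poly_over_pCons_iff intro!: subring_add subring_mult subring_poly_over poly_over_const)
qed (simp add: poly_over_0)

text \<open>Pseudo-division does not leave the coefficient ring.\<close>

lemma poly_over_pseudo_divide:
  fixes P W :: "'a::idom poly"
  assumes K: "is_subring K" and W: "W \<in> poly_over K" "W \<noteq> 0"
  shows "P \<in> poly_over K \<Longrightarrow> \<exists>k Q R. Q \<in> poly_over K \<and> R \<in> poly_over K \<and>
    smult (lead_coeff W ^ k) P = Q * W + R \<and> (R = 0 \<or> degree R < degree W)"
proof (induction "degree P" arbitrary: P rule: less_induct)
  case less
  show ?case
  proof (cases "P = 0 \<or> degree P < degree W")
    case True
    then show ?thesis using less.prems poly_over_0[OF K]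
      by (intro exI[of _ 0] exI[of _ 0] exI[of _ P]) auto
  next
    case False
    define M where "M = Polynomial.monom (lead_coeff P) (degree P - degree W)"
    define P' where "P' = smult (lead_coeff W) P - M * W"
    have M: "M \<in> poly_over K" unfolding M_def
      by (intro poly_over_monom K coeff_poly_over less.prems)
    have P': "P' \<in> poly_over K" unfolding P'_def
      by (intro subring_diff subring_mult subring_poly_over poly_over_smult coeff_poly_over K M W less.prems)
    have M0: "M \<noteq> 0" and W0: "W \<noteq> 0" using False W by (auto simp: M_def)
    have dM: "degree (M * W) = degree P"
      using False M0 W0 by (simp add: degree_mult_eq M_def degree_monom_eq)
    have lM: "lead_coeff (M * W) = lead_coeff W * lead_coeff P"
      unfolding lead_coeff_mult using W False by (simp add: M_def degree_monom_eq)
    show ?thesis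
    proof (cases "degree P = 0")
      case True
      then have "degree (M * W) = 0" "degree (smult (lead_coeff W) P) = 0"
        "coeff (M * W) 0 = coeff (smult (lead_coeff W) P) 0" using dM lM by simp_all
      then have "smult (lead_coeff W ^ 1) P = M * W" by (metis degree_eq_zeroE coeff_pCons_0 power_one_right)
      then show ?thesis using M poly_over_0[OF K] by (intro exI[of _ 1] exI[of _ M] exI[of _ 0]) auto
    next
      case False
      have "degree P' < degree P"
      proof -
        have "degree P' \<le> degree P" unfolding P'_def using dM by (intro degree_diff_le) auto
        moreover have "coeff P' (degree P) = 0" using lM dM by (simp add: P'_def)
        ultimately show ?thesis using False by (metis degree_0 gr_zeroI le_neq_implies_less leading_coeff_0_iff)
      qed
      then obtain k Q R where QR: "Q \<in> poly_over K" "R \<in> poly_over K"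
          "smult (lead_coeff W ^ k) P' = Q * W + R" "R = 0 \<or> degree R < degree W"
        using less.hyps[OF _ P'] by blast
      define Q' where "Q' = Q + smult (lead_coeff W ^ k) M"
      have "Q' \<in> poly_over K" unfolding Q'_def
        by (intro subring_add subring_poly_over poly_over_smult subring_power coeff_poly_over K QR M W)
      moreover have "smult (lead_coeff W ^ Suc k) P = Q' * W + R"
      proof -
        have "smult (lead_coeff W ^ Suc k) P = smult (lead_coeff W ^ k) P' + smult (lead_coeff W ^ k) M * W"
          by (simp add: P'_def smult_diff_right mult.commute)
        then show ?thesis unfolding QR(3) Q'_def by (simp add: distrib_right)
      qed
      ultimately show ?thesis using QR by blast
    qed
  qed
qed

lemma poly_over_divide_monic:
  fixes P W :: "'a::idom poly"
  assumes K: "is_subring K" and W: "W \<in> poly_over K" "lead_coeff W = 1" and P: "P \<in> poly_over K"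
  shows "\<exists>Q R. Q \<in> poly_over K \<and> R \<in> poly_over K \<and> P = Q * W + R \<and> (R = 0 \<or> degree R < degree W)"
proof -
  have "W \<noteq> 0" using W by auto
  from poly_over_pseudo_divide[OF K W(1) this P] show ?thesis using W by simp
qed

lemma poly_over_divide:
  fixes P W :: "'a::field poly"
  assumes K: "is_subfield K" and P: "P \<in> poly_over K" and W: "W \<in> poly_over K" "W \<noteq> 0"
  shows "\<exists>Q R. Q \<in> poly_over K \<and> R \<in> poly_over K \<and> P = Q * W + R \<and> (R = 0 \<or> degree R < degree W)"
proof -
  note K' = subfield_subring[OF K]
  define c where "c = inverse (lead_coeff W)"
  have c: "c \<in> K" unfolding c_def by (intro subfield_inverse K coeff_poly_over W)
  have c0: "c \<noteq> 0" using W by (simp add: c_def)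
  have "lead_coeff (smult c W) = 1" using W by (simp add: c_def)
  from poly_over_divide_monic[OF K' poly_over_smult[OF K' c W(1)] this P]
  obtain Q R where "Q \<in> poly_over K" "R \<in> poly_over K" "P = Q * smult c W + R"
    "R = 0 \<or> degree R < degree (smult c W)" by blast
  then show ?thesis using c0 poly_over_smult[OF K' c]
    by (intro exI[of _ "smult c Q"] exI[of _ R]) auto
qed

section \<open>Algebraic elements and independence\<close>

definition alg_over :: "'a::field set \<Rightarrow> 'a \<Rightarrow> bool" where
  "alg_over K x \<longleftrightarrow> (\<exists>p\<in>poly_over K. p \<noteq> 0 \<and> poly p x = 0)"

lemma alg_over_mono: "K \<subseteq> L \<Longrightarrow> alg_over K x \<Longrightarrow> alg_over L x"
  unfolding alg_over_def using poly_over_mono by blast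

lemma alg_over_elem: "is_subring K \<Longrightarrow> x \<in> K \<Longrightarrow> alg_over K x"
  unfolding alg_over_def
  by (rule bexI[of _ "[:- x, 1:]"])
    (auto intro!: poly_over_pCons intro: poly_over_0 subring_1 subring_uminus)

lemma alg_over_monic:
  assumes K: "is_subfield K" and x: "alg_over K x"
  obtains d r where "r \<in> poly_over K" "degree r < d" "x ^ d = poly r x"
proof -
  note K' = subfield_subring[OF K]
  obtain p where p: "p \<in> poly_over K" "p \<noteq> 0" "poly p x = 0" using x by (auto simp: alg_over_def)
  define d where "d = degree p"
  have d: "d > 0" unfolding d_def using p by (metis degree_eq_zeroE gr_zeroI poly_const_conv poly_0 pCons_0_0)
  define r where "r = Polynomial.monom 1 d - smult (inverse (lead_coeff p)) p"
  have 1: "r \<in> poly_over K" unfolding r_def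
    by (intro subring_diff subring_poly_over poly_over_monom poly_over_smult K' subfield_inverse K
      coeff_poly_over p subring_1)
  have "lead_coeff p \<noteq> 0" using p by simp
  then have "coeff r i = 0" if "i \<ge> d" for i
    using that by (cases "i = d") (auto simp: r_def d_def coeff_eq_0)
  then have 2: "degree r < d"
    using d by (metis degree_0 leI le_degree leading_coeff_0_iff)
  have 3: "x ^ d = poly r x" using p by (simp add: r_def poly_monom)
  show ?thesis using that[OF 1 2 3] .
qed

text \<open>Gaussian elimination: an equation with a nonzero coefficient expresses one unknown by the others and
  removes one equation.\<close>

lemma homogeneous_system:
  assumes K: "is_subfield K"
  shows "finite I \<Longrightarrow> finite J \<Longrightarrow> card I < card J \<Longrightarrow> (\<And>i j. i \<in> I \<Longrightarrow> j \<in> J \<Longrightarrow> M i j \<in> K) \<Longrightarrow>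
    \<exists>c. (\<forall>j\<in>J. c j \<in> K) \<and> (\<exists>j\<in>J. c j \<noteq> 0) \<and> (\<forall>i\<in>I. (\<Sum>j\<in>J. M i j * c j) = 0)"
proof (induction I arbitrary: J M rule: finite_induct)
  case empty
  then show ?case using subring_1[OF subfield_subring[OF K]]
    by (intro exI[of _ "\<lambda>_. 1"]) (auto simp: card_gt_0_iff)
next
  case (insert i I)
  note K' = subfield_subring[OF K]
  show ?case
  proof (cases "\<forall>j\<in>J. M i j = 0")
    case True
    obtain c where c: "\<forall>j\<in>J. c j \<in> K" "\<exists>j\<in>J. c j \<noteq> 0" "\<forall>i\<in>I. (\<Sum>j\<in>J. M i j * c j) = 0"
    proof -
      have "card I < card J" using insert by simp
      then show ?thesis using insert.IH[of J M] insert.prems that by blast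
    qed
    then show ?thesis using True by (intro exI[of _ c]) auto
  next
    case False
    then obtain q where q: "q \<in> J" "M i q \<noteq> 0" by auto
    define N where "N k j = M k j - M k q * (M i j / M i q)" for k j
    have "\<exists>c. (\<forall>j\<in>J-{q}. c j \<in> K) \<and> (\<exists>j\<in>J-{q}. c j \<noteq> 0) \<and> (\<forall>k\<in>I. (\<Sum>j\<in>J-{q}. N k j * c j) = 0)"
    proof (rule insert.IH)
      show "card I < card (J - {q})" using insert q by simp
      show "N k j \<in> K" if "k \<in> I" "j \<in> J - {q}" for k j
        unfolding N_def using that q insert.prems(3)
        by (intro subring_diff[OF K'] subring_mult[OF K'] subfield_divide[OF K]) auto
    qed (use insert in auto)
    then obtain c where c: "\<forall>j\<in>J-{q}. c j \<in> K" "\<exists>j\<in>J-{q}. c j \<noteq> 0"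
      "\<forall>k\<in>I. (\<Sum>j\<in>J-{q}. N k j * c j) = 0" by blast
    define e where "e = (\<Sum>j\<in>J-{q}. M i j / M i q * c j)"
    have e: "e \<in> K" unfolding e_def using c q insert.prems(3)
      by (intro subring_sum[OF K'] subring_mult[OF K'] subfield_divide[OF K]) auto
    define c' where "c' = c(q := - e)"
    have S: "(\<Sum>j\<in>J. M k j * c' j) = (\<Sum>j\<in>J-{q}. M k j * c j) - M k q * e" for k
    proof -
      have "(\<Sum>j\<in>J. M k j * c' j) = M k q * c' q + (\<Sum>j\<in>J-{q}. M k j * c' j)"
        using q insert.prems by (simp add: sum.remove)
      also have "(\<Sum>j\<in>J-{q}. M k j * c' j) = (\<Sum>j\<in>J-{q}. M k j * c j)"
        by (intro sum.cong) (auto simp: c'_def)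
      finally show ?thesis by (simp add: c'_def)
    qed
    have "(\<Sum>j\<in>J. M k j * c' j) = 0" if "k \<in> insert i I" for k
    proof (cases "k = i")
      case True
      have "M i q * e = (\<Sum>j\<in>J-{q}. M i j * c j)"
        unfolding e_def sum_distrib_left using q by (intro sum.cong) auto
      then show ?thesis using S[of i] True by simp
    next
      case False
      then have "0 = (\<Sum>j\<in>J-{q}. N k j * c j)" using that c by auto
      also have "\<dots> = (\<Sum>j\<in>J-{q}. M k j * c j) - M k q * e"
        unfolding N_def e_def sum_distrib_left sum_subtractf[symmetric]
        by (intro sum.cong) (auto simp: algebra_simps)
      finally show ?thesis using S[of k] by simp
    qed
    then show ?thesis using c e subring_uminus[OF K' e]
      by (intro exI[of _ c']) (auto simp: c'_def)
  qed
qed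

definition fspan :: "'a::field set \<Rightarrow> 'a set \<Rightarrow> 'a set" where
  "fspan K S = {\<Sum>s\<in>S. c s * s | c. \<forall>s\<in>S. c s \<in> K}"

lemma fspan_dependent:
  assumes K: "is_subfield K" and S: "finite S" and J: "finite J" "card S < card J"
    and v: "\<And>j. j \<in> J \<Longrightarrow> v j \<in> fspan K S"
  shows "\<exists>c. (\<forall>j\<in>J. c j \<in> K) \<and> (\<exists>j\<in>J. c j \<noteq> 0) \<and> (\<Sum>j\<in>J. c j * v j) = 0"
proof -
  have "\<forall>j. \<exists>c. j \<in> J \<longrightarrow> (v j = (\<Sum>s\<in>S. c s * s) \<and> (\<forall>s\<in>S. c s \<in> K))"
    using v by (fastforce simp: fspan_def)
  then obtain m where m: "j \<in> J \<Longrightarrow> v j = (\<Sum>s\<in>S. m j s * s)" "j \<in> J \<Longrightarrow> s \<in> S \<Longrightarrow> m j s \<in> K" for j s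
    by metis
  obtain c where c: "\<forall>j\<in>J. c j \<in> K" "\<exists>j\<in>J. c j \<noteq> 0" "\<forall>s\<in>S. (\<Sum>j\<in>J. m j s * c j) = 0"
    using homogeneous_system[OF K S J, of "\<lambda>s j. m j s"] m(2) by blast
  have "(\<Sum>j\<in>J. c j * v j) = (\<Sum>j\<in>J. \<Sum>s\<in>S. m j s * c j * s)"
    by (intro sum.cong) (auto simp: m(1) sum_distrib_left algebra_simps)
  also have "\<dots> = (\<Sum>s\<in>S. (\<Sum>j\<in>J. m j s * c j) * s)"
    by (subst sum.swap) (simp add: sum_distrib_right)
  also have "\<dots> = 0" using c by simp
  finally show ?thesis using c by blast
qed

lemma fspan_0: "is_subring K \<Longrightarrow> 0 \<in> fspan K S"
  unfolding fspan_def by (auto intro!: exI[of _ "\<lambda>_. 0"] subring_0)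

lemma fspan_add: "is_subring K \<Longrightarrow> x \<in> fspan K S \<Longrightarrow> y \<in> fspan K S \<Longrightarrow> x + y \<in> fspan K S"
  unfolding fspan_def
proof clarify
  fix c c' assume "is_subring K" "\<forall>s\<in>S. c s \<in> K" "\<forall>s\<in>S. c' s \<in> K"
  then show "\<exists>ca. (\<Sum>s\<in>S. c s * s) + (\<Sum>s\<in>S. c' s * s) = (\<Sum>s\<in>S. ca s * s) \<and> (\<forall>s\<in>S. ca s \<in> K)"
    by (intro exI[of _ "\<lambda>s. c s + c' s"]) (auto simp: sum.distrib algebra_simps intro: subring_add)
qed

lemma fspan_scale: "is_subring K \<Longrightarrow> a \<in> K \<Longrightarrow> x \<in> fspan K S \<Longrightarrow> a * x \<in> fspan K S"
  unfolding fspan_def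
proof clarify
  fix c assume "is_subring K" "a \<in> K" "\<forall>s\<in>S. c s \<in> K"
  then show "\<exists>ca. a * (\<Sum>s\<in>S. c s * s) = (\<Sum>s\<in>S. ca s * s) \<and> (\<forall>s\<in>S. ca s \<in> K)"
    by (intro exI[of _ "\<lambda>s. a * c s"]) (auto simp: sum_distrib_left algebra_simps intro: subring_mult)
qed

lemma fspan_sum: "is_subring K \<Longrightarrow> (\<And>i. i \<in> I \<Longrightarrow> f i \<in> fspan K S) \<Longrightarrow> sum f I \<in> fspan K S"
  by (induction I rule: infinite_finite_induct) (auto intro: fspan_0 fspan_add)

lemma fspan_elem: "is_subring K \<Longrightarrow> finite S \<Longrightarrow> s \<in> S \<Longrightarrow> s \<in> fspan K S"
  unfolding fspan_def
  by (rule CollectI, rule exI[of _ "\<lambda>t. if t = s then 1 else 0"])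
    (auto simp: subring_0 subring_1 if_distrib[of "\<lambda>c. c * _"] cong: if_cong)

text \<open>Rings that are finite-dimensional over \<open>K\<close> are the tool for all closure properties of
  algebraic elements: all their elements are algebraic, and a root of a monic polynomial can be
  adjoined to them.\<close>

definition fin_alg :: "'a::field set \<Rightarrow> 'a set \<Rightarrow> bool" where
  "fin_alg K W \<longleftrightarrow> is_subring W \<and> K \<subseteq> W \<and> (\<exists>S. finite S \<and> W \<subseteq> fspan K S)"

text \<open>More powers of \<open>x\<close> than there are generators are linearly dependent over \<open>K\<close>.\<close>

lemma fin_alg_alg_over:
  assumes K: "is_subfield K" and W: "fin_alg K W" and x: "x \<in> W"
  shows "alg_over K x"
proof -
  obtain S where S: "finite S" "W \<subseteq> fspan K S" using W by (auto simp: fin_alg_def)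
  have xi: "x ^ i \<in> fspan K S" for i using W S x by (auto simp: fin_alg_def dest: subring_power)
  obtain c where c: "\<forall>j\<in>{..card S}. c j \<in> K" "\<exists>j\<in>{..card S}. c j \<noteq> 0" "(\<Sum>j\<in>{..card S}. c j * x ^ j) = 0"
    using fspan_dependent[OF K S(1), of "{..card S}" "\<lambda>i. x ^ i"] xi by auto
  define p where "p = (\<Sum>j\<in>{..card S}. Polynomial.monom (c j) j)"
  have co: "coeff p i = (if i \<le> card S then c i else 0)" for i
    by (simp add: p_def coeff_sum)
  have "p \<in> poly_over K" using c by (auto simp: poly_over_def co subring_0[OF subfield_subring[OF K]])
  moreover have "p \<noteq> 0" using c co by (metis atMost_iff coeff_0)
  moreover have "poly p x = 0" using c by (simp add: p_def poly_sum poly_monom)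
  ultimately show ?thesis by (auto simp: alg_over_def)
qed

lemma fin_alg_adjoin:
  assumes K: "is_subfield K" and W: "fin_alg K W"
    and r: "r \<in> poly_over W" "degree r < d" "x ^ d = poly r x"
  shows "\<exists>W'. fin_alg K W' \<and> W \<subseteq> W' \<and> x \<in> W'"
proof -
  note K' = subfield_subring[OF K]
  obtain S where S: "finite S" "W \<subseteq> fspan K S" and Ws: "is_subring W" and KW: "K \<subseteq> W"
    using W by (auto simp: fin_alg_def)
  define f where "f = Polynomial.monom 1 d - r"
  have f: "f \<in> poly_over W" unfolding f_def
    by (intro subring_diff subring_poly_over poly_over_monom Ws subring_1 r)
  have df: "degree f = d" unfolding f_def using r(2)
    by (simp add: degree_monom_eq degree_add_eq_left[of "- r", simplified])
  have lf: "lead_coeff f = 1" unfolding df using r(2) by (simp add: f_def coeff_eq_0)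
  have fx: "poly f x = 0" by (simp add: f_def r(3) poly_monom)
  define W' where "W' = (\<lambda>p. poly p x) ` poly_over W"
  define S' where "S' = (\<lambda>(s,i). s * x ^ i) ` (S \<times> {..<d})"
  have S': "finite S'" using S by (simp add: S'_def)
  have sx: "c * x ^ i \<in> fspan K S'" if "c \<in> fspan K S" "i < d" for c i
  proof -
    obtain e where e: "c = (\<Sum>s\<in>S. e s * s)" "\<forall>s\<in>S. e s \<in> K" using \<open>c \<in> fspan K S\<close> by (auto simp: fspan_def)
    have "c * x ^ i = (\<Sum>s\<in>S. e s * (s * x ^ i))" by (simp add: e sum_distrib_right mult.assoc)
    also have "\<dots> \<in> fspan K S'" using e that(2)
      by (intro fspan_sum fspan_scale fspan_elem K' S') (auto simp: S'_def)
    finally show ?thesis .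
  qed
  have "is_subring W'" unfolding W'_def by (rule subring_eval_image[OF Ws])
  moreover have "W \<subseteq> W'" "x \<in> W'" unfolding W'_def by (rule eval_image_base[OF Ws], rule eval_image_gen[OF Ws])
  moreover have "W' \<subseteq> fspan K S'"
  proof
    fix y assume "y \<in> W'"
    then obtain p where p: "p \<in> poly_over W" "y = poly p x" by (auto simp: W'_def)
    obtain Q R where QR: "R \<in> poly_over W" "p = Q * f + R" "R = 0 \<or> degree R < d"
      using poly_over_divide_monic[OF Ws f lf p(1)] df by auto
    have "y = poly R x" using p QR fx by simp
    also have "\<dots> = (\<Sum>i<d. coeff R i * x ^ i)"
    proof -
      have "d > 0" using r by simp
      have "poly R x = (\<Sum>i\<le>degree R. coeff R i * x ^ i)" by (simp add: poly_altdef)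
      also have "\<dots> = (\<Sum>i<d. coeff R i * x ^ i)"
        using QR(3) \<open>d > 0\<close> by (intro sum.mono_neutral_left) (auto simp: coeff_eq_0)
      finally show ?thesis .
    qed
    also have "\<dots> \<in> fspan K S'"
      using S(2) coeff_poly_over[OF QR(1)] by (intro fspan_sum K' sx) auto
    finally show "y \<in> fspan K S'" .
  qed
  ultimately show ?thesis using KW S' by (intro exI[of _ W']) (auto simp: fin_alg_def)
qed

lemma fin_alg_self: "is_subfield K \<Longrightarrow> fin_alg K K"
  unfolding fin_alg_def fspan_def
  by (auto intro!: exI[of _ "{1}"] dest: subfield_subring)

lemma fin_alg_finite:
  assumes K: "is_subfield K"
  shows "finite T \<Longrightarrow> (\<And>t. t \<in> T \<Longrightarrow> alg_over K t) \<Longrightarrow> \<exists>W. fin_alg K W \<and> T \<subseteq> W"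
proof (induction T rule: finite_induct)
  case empty
  then show ?case using fin_alg_self[OF K] by blast
next
  case (insert t T)
  then obtain W where W: "fin_alg K W" "T \<subseteq> W" by auto
  obtain d r where r: "r \<in> poly_over K" "degree r < d" "t ^ d = poly r t"
    using alg_over_monic[OF K, of t] insert.prems by blast
  have "r \<in> poly_over W" using r W poly_over_mono by (auto simp: fin_alg_def)
  then show ?case using fin_alg_adjoin[OF K W(1) _ r(2,3)] W by blast
qed

lemma alg_closure_subfield:
  assumes K: "is_subfield K"
  shows "is_subfield {x. alg_over K x}"
proof -
  have 2: "alg_over K (x - y) \<and> alg_over K (x * y)" if xy: "alg_over K x" "alg_over K y" for x y
  proof -
    obtain W where W: "fin_alg K W" "{x, y} \<subseteq> W" using fin_alg_finite[OF K, of "{x,y}"] xy by blast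
    then have "is_subring W" by (simp add: fin_alg_def)
    then show ?thesis using W fin_alg_alg_over[OF K W(1)] by (auto intro: subring_diff subring_mult)
  qed
  have "alg_over K (inverse x)" if alg: "alg_over K x" for x
  proof (cases "x = 0")
    case True
    then show ?thesis using alg by simp
  next
    case False
    obtain p where p: "p \<in> poly_over K" "p \<noteq> 0" "poly p x = 0" using alg by (auto simp: alg_over_def)
    have "reflect_poly p \<in> poly_over K"
      using p(1) by (auto simp: poly_over_def coeff_reflect_poly subring_0[OF subfield_subring[OF K]])
    moreover have "poly (reflect_poly p) (inverse x) = 0"
      using False p by (simp add: poly_reflect_poly_nz)
    ultimately show ?thesis using p by (auto simp: alg_over_def intro!: bexI[of _ "reflect_poly p"])
  qed
  then show ?thesis using 2 alg_over_elem[OF subfield_subring[OF K]] subring_1[OF subfield_subring[OF K]]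
    by (auto simp: is_subfield_def is_subring_def)
qed

text \<open>The finitely many coefficients of an equation lie in a finite-dimensional ring, to which \<open>x\<close> can be
  adjoined.\<close>

lemma alg_over_trans:
  assumes K: "is_subfield K" and x: "alg_over {y. alg_over K y} x"
  shows "alg_over K x"
proof -
  obtain d r where r: "r \<in> poly_over {y. alg_over K y}" "degree r < d" "x ^ d = poly r x"
    using alg_over_monic[OF alg_closure_subfield[OF K] x] by blast
  obtain W where W: "fin_alg K W" "coeff r ` {..degree r} \<subseteq> W"
    using fin_alg_finite[OF K, of "coeff r ` {..degree r}"] r(1) by (auto simp: poly_over_def)
  have Ws: "is_subring W" using W by (simp add: fin_alg_def)
  have "coeff r i \<in> W" for i
    using W(2) subring_0[OF Ws] by (cases "i \<le> degree r") (auto simp: coeff_eq_0)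
  then have "r \<in> poly_over W" by (simp add: poly_over_def)
  from fin_alg_adjoin[OF K W(1) this r(2,3)] show ?thesis
    using fin_alg_alg_over[OF K] by blast
qed

definition adjoin :: "'a::field set \<Rightarrow> 'a set \<Rightarrow> 'a set" where
  "adjoin K S = is_subfield hull (K \<union> S)"

lemma adjoin_subfield: "is_subfield (adjoin K S)"
  by (simp add: adjoin_def subfield_hull)

lemma adjoin_base: "K \<subseteq> adjoin K S"
  and adjoin_gen: "S \<subseteq> adjoin K S"
  using hull_subset[of "K \<union> S" is_subfield] by (auto simp: adjoin_def)

lemma adjoin_least: "K \<subseteq> L \<Longrightarrow> S \<subseteq> L \<Longrightarrow> is_subfield L \<Longrightarrow> adjoin K S \<subseteq> L"
  unfolding adjoin_def by (rule hull_minimal) auto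

lemma adjoin_mono: "K \<subseteq> K' \<Longrightarrow> S \<subseteq> S' \<Longrightarrow> adjoin K S \<subseteq> adjoin K' S'"
  unfolding adjoin_def by (rule hull_mono) auto

lemma adjoin_adjoin: "adjoin (adjoin K S) T = adjoin K (S \<union> T)"
  unfolding adjoin_def by (subst hull_Un_left[symmetric]) (simp add: Un_assoc)

lemma adjoin_empty: "is_subfield K \<Longrightarrow> adjoin K {} = K"
  by (simp add: adjoin_def hull_same)

lemma adjoin_single:
  assumes K: "is_subfield K"
  shows "adjoin K {x} = {poly p x / poly q x | p q. p \<in> poly_over K \<and> q \<in> poly_over K \<and> poly q x \<noteq> 0}"
    (is "_ = ?R")
proof
  note K' = subfield_subring[OF K]
  note Kp = subring_poly_over[OF K']
  have R: "u \<in> ?R" if "u * poly q x = poly p x" "p \<in> poly_over K" "q \<in> poly_over K" "poly q x \<noteq> 0" for u p q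
  proof -
    have "u = poly p x / poly q x" using that by (simp add: field_simps)
    then show ?thesis using that by blast
  qed
  show "adjoin K {x} \<subseteq> ?R"
  proof (rule adjoin_least)
    show "K \<subseteq> ?R"
    proof
      fix c assume "c \<in> K"
      then show "c \<in> ?R" using poly_over_const[OF K'] subring_1[OF K'] by (intro R[of c 1 "[:c:]"]) (auto simp: one_pCons)
    qed
    show "{x} \<subseteq> ?R" using subring_1[OF Kp] R[of x 1 "[:0,1:]"] poly_over_X[OF K'] by auto
    show "is_subfield ?R"
      unfolding is_subfield_def is_subring_def
    proof (intro conjI ballI)
      show "1 \<in> ?R" using subring_1[OF Kp] by (intro R[of 1 1 1]) auto
    next
      fix u v assume "u \<in> ?R" "v \<in> ?R"
      then obtain p q p' q' where *: "u = poly p x / poly q x" "v = poly p' x / poly q' x"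
        "p \<in> poly_over K" "q \<in> poly_over K" "poly q x \<noteq> 0" "p' \<in> poly_over K" "q' \<in> poly_over K" "poly q' x \<noteq> 0" by blast
      have "(u - v) * poly (q * q') x = poly (p * q' - p' * q) x" using * by (simp add: left_diff_distrib)
      then show "u - v \<in> ?R" by (rule R) (use * in \<open>auto intro: subring_diff subring_mult Kp\<close>)
      have "(u * v) * poly (q * q') x = poly (p * p') x" using * by simp
      then show "u * v \<in> ?R" by (rule R) (use * in \<open>auto intro: subring_mult Kp\<close>)
    next
      fix u assume "u \<in> ?R"
      then obtain p q where *: "u = poly p x / poly q x" "p \<in> poly_over K" "q \<in> poly_over K" "poly q x \<noteq> 0" by blast
      show "inverse u \<in> ?R"
      proof (cases "poly p x = 0")
        case True
        then show ?thesis using * subring_1[OF Kp] subring_0[OF Kp] by (intro R[of _ 1 0]) auto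
      next
        case False
        then have "inverse u * poly p x = poly q x" using *(4) unfolding *(1) by simp
        then show ?thesis by (rule R) (use * False in auto)
      qed
    qed
  qed
  show "?R \<subseteq> adjoin K {x}"
  proof
    fix u assume "u \<in> ?R"
    then obtain p q where *: "u = poly p x / poly q x" "p \<in> poly_over K" "q \<in> poly_over K" by blast
    have "p \<in> poly_over (adjoin K {x})" "q \<in> poly_over (adjoin K {x})" "x \<in> adjoin K {x}"
      using poly_over_mono[OF adjoin_base[of K "{x}"]] * adjoin_gen[of "{x}" K] by auto
    then show "u \<in> adjoin K {x}" unfolding *
      by (intro subfield_divide adjoin_subfield poly_poly_over subfield_subring)
  qed
qed

lemma adjoin_common_denominator:
  assumes K: "is_subfield K"
  shows "finite T \<Longrightarrow> T \<subseteq> adjoin K {x} \<Longrightarrow>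
    \<exists>q\<in>poly_over K. poly q x \<noteq> 0 \<and> (\<forall>t\<in>T. \<exists>p\<in>poly_over K. poly q x * t = poly p x)"
proof (induction T rule: finite_induct)
  case empty
  then show ?case using subring_1[OF subring_poly_over[OF subfield_subring[OF K]]] by (intro bexI[of _ 1]) auto
next
  case (insert t T)
  note Kp = subring_poly_over[OF subfield_subring[OF K]]
  obtain q where q: "q \<in> poly_over K" "poly q x \<noteq> 0" "\<forall>t\<in>T. \<exists>p\<in>poly_over K. poly q x * t = poly p x"
    using insert by auto
  obtain p' q' where pq: "t = poly p' x / poly q' x" "p' \<in> poly_over K" "q' \<in> poly_over K" "poly q' x \<noteq> 0"
    using insert.prems adjoin_single[OF K, of x] by blast
  have "\<exists>p\<in>poly_over K. poly (q * q') x * s = poly p x" if s: "s \<in> insert t T" for s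
  proof (cases "s = t")
    case True
    then show ?thesis using pq q by (intro bexI[of _ "q * p'"]) (auto intro: subring_mult Kp)
  next
    case False
    then obtain p where "p \<in> poly_over K" "poly q x * s = poly p x" using q s by auto
    then show ?thesis using pq by (intro bexI[of _ "p * q'"]) (auto intro: subring_mult Kp)
  qed
  then show ?case using q pq by (intro bexI[of _ "q * q'"]) (auto intro: subring_mult Kp)
qed

text \<open>The exchange property of algebraic dependence: after clearing denominators, an equation for \<open>y\<close> over
  \<open>K(x)\<close> is an equation for \<open>x\<close> with coefficients in \<open>K(y)\<close>. It is not trivial because \<open>y\<close> is
  transcendental over \<open>K\<close>.\<close>

lemma alg_over_exchange_single:
  assumes K: "is_subfield K" and y: "alg_over (adjoin K {x}) y" "\<not> alg_over K y"
  shows "alg_over (adjoin K {y}) x"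
proof -
  note K' = subfield_subring[OF K]
  obtain p where p: "p \<in> poly_over (adjoin K {x})" "p \<noteq> 0" "poly p y = 0" using y by (auto simp: alg_over_def)
  obtain d where d: "d \<in> poly_over K" "poly d x \<noteq> 0" "\<forall>t\<in>coeff p ` {..degree p}. \<exists>p\<in>poly_over K. poly d x * t = poly p x"
    using adjoin_common_denominator[OF K, of "coeff p ` {..degree p}" x] p(1) by (auto simp: poly_over_def)
  then obtain q where q: "\<And>i. i \<le> degree p \<Longrightarrow> q i \<in> poly_over K \<and> poly d x * coeff p i = poly (q i) x"
  proof -
    have "\<forall>i. \<exists>q. i \<le> degree p \<longrightarrow> q \<in> poly_over K \<and> poly d x * coeff p i = poly q x" using d(3) by blast
    then show ?thesis using that by metis
  qed
  define P where "P = (\<Sum>i\<le>degree p. smult (y ^ i) (q i))"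
  have yA: "y \<in> adjoin K {y}" using adjoin_gen[of "{y}" K] by auto
  have "P \<in> poly_over (adjoin K {y})" unfolding P_def
    using q poly_over_mono[OF adjoin_base[of K "{y}"]]
    by (intro subring_sum subring_poly_over poly_over_smult subring_power yA subfield_subring adjoin_subfield) auto
  moreover have "poly P x = 0"
  proof -
    have "poly P x = (\<Sum>i\<le>degree p. y ^ i * (poly d x * coeff p i))" using q by (simp add: P_def poly_sum)
    also have "\<dots> = poly d x * poly p y" by (simp add: poly_altdef sum_distrib_left algebra_simps)
    finally show ?thesis using p by simp
  qed
  moreover have "P \<noteq> 0"
  proof
    assume "P = 0"
    have "poly (q (degree p)) x \<noteq> 0" using q[of "degree p"] d p by (metis le_refl leading_coeff_0_iff mult_eq_0_iff)
    then obtain k where k: "coeff (q (degree p)) k \<noteq> 0" by (metis leading_coeff_0_iff poly_0)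
    define g where "g = (\<Sum>i\<le>degree p. Polynomial.monom (coeff (q i) k) i)"
    have "g \<in> poly_over K" unfolding g_def
      using q by (intro subring_sum subring_poly_over poly_over_monom K' coeff_poly_over) auto
    moreover have "coeff g (degree p) \<noteq> 0" using k by (simp add: g_def coeff_sum)
    moreover have "poly g y = coeff P k"
      by (simp add: g_def P_def poly_sum coeff_sum poly_monom algebra_simps)
    ultimately show False using y(2) \<open>P = 0\<close> by (metis alg_over_def coeff_0)
  qed
  ultimately show ?thesis by (auto simp: alg_over_def)
qed

definition alg_cl :: "'a::field set \<Rightarrow> 'a set \<Rightarrow> 'a set" where
  "alg_cl K S = {x. alg_over (adjoin K S) x}"

lemma alg_cl_subfield: "is_subfield (alg_cl K S)"
  unfolding alg_cl_def by (intro alg_closure_subfield adjoin_subfield)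

lemma alg_cl_adjoin: "adjoin K S \<subseteq> alg_cl K S"
  unfolding alg_cl_def using alg_over_elem[OF subfield_subring[OF adjoin_subfield]] by auto

lemma alg_cl_mono: "S \<subseteq> T \<Longrightarrow> alg_cl K S \<subseteq> alg_cl K T"
  unfolding alg_cl_def using alg_over_mono[OF adjoin_mono] by blast

lemma alg_cl_least: "T \<subseteq> alg_cl K S \<Longrightarrow> alg_cl K T \<subseteq> alg_cl K S"
proof
  fix x assume T: "T \<subseteq> alg_cl K S" and x: "x \<in> alg_cl K T"
  have "adjoin K T \<subseteq> alg_cl K S"
    using T adjoin_base[of K S] alg_cl_adjoin[of K S] by (intro adjoin_least alg_cl_subfield) auto
  with x have "alg_over (alg_cl K S) x" unfolding alg_cl_def using alg_over_mono by blast
  then show "x \<in> alg_cl K S" unfolding alg_cl_def using alg_over_trans[OF adjoin_subfield] by blast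
qed

lemma alg_cl_exchange:
  assumes "y \<in> alg_cl K (insert x S)" "y \<notin> alg_cl K S"
  shows "x \<in> alg_cl K (insert y S)"
  using assms alg_over_exchange_single[OF adjoin_subfield[of K S], of x y]
  by (simp add: alg_cl_def adjoin_adjoin)

definition alg_indep_list :: "'a::field set \<Rightarrow> 'a list \<Rightarrow> bool" where
  "alg_indep_list K zs \<longleftrightarrow> (\<forall>i<length zs. zs ! i \<notin> alg_cl K (set (take i zs)))"

text \<open>Exchange one element of \<open>T\<close> for the head of the list, which then joins the fixed part \<open>S\<close>.\<close>

lemma steinitz_aux:
  assumes "finite T" "set zs \<subseteq> alg_cl K (S \<union> T)"
    "\<forall>i<length zs. zs ! i \<notin> alg_cl K (S \<union> set (take i zs))"
  shows "length zs \<le> card T"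
  using assms
proof (induction "card T" arbitrary: T S zs)
  case 0
  then have "T = {}" by simp
  show ?case
  proof (cases zs)
    case (Cons z zs')
    then have "z \<notin> alg_cl K S" using 0(4) by force
    then show ?thesis using 0(3) \<open>T = {}\<close> Cons by auto
  qed auto
next
  case (Suc n)
  show ?case
  proof (cases zs)
    case (Cons z zs')
    have z: "z \<in> alg_cl K (S \<union> T)" "z \<notin> alg_cl K S" using Suc.prems Cons by force+
    have E: "\<exists>x U. x \<in> T \<and> U \<subseteq> T - {x} \<and> z \<in> alg_cl K (insert x (S \<union> U)) \<and> z \<notin> alg_cl K (S \<union> U)"
      if "finite U0" "U0 \<subseteq> T" "z \<in> alg_cl K (S \<union> U0)" for U0
      using that
    proof (induction U0 rule: finite_induct)
      case empty
      then show ?case using z by simp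
    next
      case (insert x U)
      then show ?case by (cases "z \<in> alg_cl K (S \<union> U)") (auto intro!: exI[of _ x] exI[of _ U])
    qed
    then obtain x U where x: "x \<in> T" "U \<subseteq> T - {x}" "z \<in> alg_cl K (insert x (S \<union> U))" "z \<notin> alg_cl K (S \<union> U)"
      using E[OF Suc.prems(1) subset_refl z(1)] by blast
    have "x \<in> alg_cl K (insert z (S \<union> U))" using alg_cl_exchange x by blast
    also have "\<dots> \<subseteq> alg_cl K (insert z S \<union> (T - {x}))" using x by (intro alg_cl_mono) auto
    finally have x': "x \<in> alg_cl K (insert z S \<union> (T - {x}))" .
    have "S \<union> T \<subseteq> alg_cl K (insert z S \<union> (T - {x}))"
      using x' alg_cl_adjoin[of K "insert z S \<union> (T - {x})"] adjoin_gen[of "insert z S \<union> (T - {x})" K] by auto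
    then have "alg_cl K (S \<union> T) \<subseteq> alg_cl K (insert z S \<union> (T - {x}))" by (rule alg_cl_least)
    then have "set zs' \<subseteq> alg_cl K (insert z S \<union> (T - {x}))" using Suc.prems Cons by auto
    moreover have "\<forall>i<length zs'. zs' ! i \<notin> alg_cl K (insert z S \<union> set (take i zs'))"
    proof (intro allI impI)
      fix i assume "i < length zs'"
      then have "zs ! Suc i \<notin> alg_cl K (S \<union> set (take (Suc i) zs))" using Suc.prems Cons by auto
      then show "zs' ! i \<notin> alg_cl K (insert z S \<union> set (take i zs'))" using Cons by (simp add: insert_commute)
    qed
    ultimately have "length zs' \<le> card (T - {x})"
      using Suc.hyps(2) x Suc.prems(1) by (intro Suc.hyps(1)[of _ zs' "insert z S"]) auto
    then show ?thesis using Cons x Suc.prems Suc.hyps by (simp add: card_Diff_singleton)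
  qed auto
qed

lemma steinitz:
  assumes "finite T" "alg_cl K T = UNIV" "alg_indep_list K zs"
  shows "length zs \<le> card T"
  using steinitz_aux[of T zs K "{}"] assms by (simp add: alg_indep_list_def)

lemma transcendence_basis:
  assumes "finite G"
  shows "\<exists>ys. alg_indep_list K ys \<and> G \<subseteq> alg_cl K (set ys)"
  using assms
proof (induction G rule: finite_induct)
  case empty
  show ?case by (intro exI[of _ "[]"]) (auto simp: alg_indep_list_def)
next
  case (insert x G)
  then obtain ys where ys: "alg_indep_list K ys" "G \<subseteq> alg_cl K (set ys)" by blast
  show ?case
  proof (cases "x \<in> alg_cl K (set ys)")
    case True
    then show ?thesis using ys by blast
  next
    case False
    have "alg_indep_list K (ys @ [x])"
      using ys(1) False by (auto simp: alg_indep_list_def nth_append less_Suc_eq)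
    moreover have "G \<subseteq> alg_cl K (set (ys @ [x]))" using ys(2) alg_cl_mono[of "set ys" "set (ys @ [x])" K] by auto
    moreover have "x \<in> alg_cl K (set (ys @ [x]))" using alg_cl_adjoin adjoin_gen by fastforce
    ultimately show ?thesis by blast
  qed
qed

section \<open>The algebraic closure of the ground field is finite\<close>

lemma alg_overI: "p \<in> poly_over K \<Longrightarrow> p \<noteq> 0 \<Longrightarrow> poly p x = 0 \<Longrightarrow> alg_over K x"
  by (auto simp: alg_over_def)

lemma alg_over_nonzero_const:
  fixes b :: "'a::field"
  assumes "alg_over K b" "b \<noteq> 0"
  obtains p where "p \<in> poly_over K" "poly p b = 0" "coeff p 0 \<noteq> 0"
proof -
  have "\<exists>q\<in>poly_over K. poly q b = 0 \<and> coeff q 0 \<noteq> 0"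
    if "p \<in> poly_over K" "p \<noteq> 0" "poly p b = 0" for p
    using that
  proof (induction p)
    case (pCons a p)
    then show ?case using assms(2)
      by (cases "a = 0") (auto simp: poly_over_pCons_iff intro!: bexI[of _ "pCons a p"])
  qed auto
  then show ?thesis using assms that by (auto simp: alg_over_def)
qed

lemma fin_alg_subfield:
  assumes K: "is_subfield K" and W: "fin_alg K W"
  shows "is_subfield W"
proof -
  have Ws: "is_subring W" and KW: "K \<subseteq> W" using W by (auto simp: fin_alg_def)
  have "inverse w \<in> W" if w: "w \<in> W" for w
  proof (cases "w = 0")
    case False
    obtain p where p: "p \<in> poly_over K" "poly p w = 0" "coeff p 0 \<noteq> 0"
      using alg_over_nonzero_const[OF fin_alg_alg_over[OF K W w] False] by blast
    obtain a h where ah: "p = pCons a h" by (cases p)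
    have a: "a \<in> K" "a \<noteq> 0" and h: "h \<in> poly_over W"
      using p ah poly_over_mono[OF KW] by (auto simp: poly_over_pCons_iff)
    have "w * poly h w = - a" using p(2) ah by (simp add: eq_neg_iff_add_eq_0 add.commute)
    then have "inverse w = - (poly h w * inverse a)" using False a by (simp add: field_simps)
    also have "\<dots> \<in> W"
      using a KW by (intro subring_uminus subring_mult Ws poly_poly_over h w)
        (auto intro: subfield_inverse[OF K])
    finally show ?thesis .
  qed (use w in simp)
  then show ?thesis using Ws by (auto simp: is_subfield_def)
qed

lemma adjoin_algebraic_findim:
  assumes K: "is_subfield K" and G: "finite G" "\<And>x. x \<in> G \<Longrightarrow> alg_over K x"
  obtains S where "finite S" "adjoin K G \<subseteq> fspan K S"
proof -
  obtain W where W: "fin_alg K W" "G \<subseteq> W" using fin_alg_finite[OF K G] by blast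
  then have "adjoin K G \<subseteq> W"
    by (intro adjoin_least fin_alg_subfield[OF K]) (auto simp: fin_alg_def)
  then show ?thesis using W that by (auto simp: fin_alg_def)
qed

text \<open>A linear relation between algebraic elements over \<open>E(y)\<close>, with \<open>y\<close> transcendental, is after
  clearing denominators a polynomial in \<open>y\<close> with algebraic coefficients; these must vanish, and
  each of them is a relation over \<open>E\<close>.\<close>

lemma dependent_descend_single:
  assumes E: "is_subfield E" and y: "\<not> alg_over E y" and J: "finite J"
    and v: "\<And>j. j \<in> J \<Longrightarrow> alg_over E (v j)"
    and c: "\<forall>j\<in>J. c j \<in> adjoin E {y}" "\<exists>j\<in>J. c j \<noteq> 0" "(\<Sum>j\<in>J. c j * v j) = 0"
  shows "\<exists>c'. (\<forall>j\<in>J. c' j \<in> E) \<and> (\<exists>j\<in>J. c' j \<noteq> 0) \<and> (\<Sum>j\<in>J. c' j * v j) = 0"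
proof -
  let ?E' = "{x. alg_over E x}"
  have E': "is_subfield ?E'" by (rule alg_closure_subfield[OF E])
  have EE': "E \<subseteq> ?E'" using alg_over_elem[OF subfield_subring[OF E]] by auto
  obtain d where d: "d \<in> poly_over E" "poly d y \<noteq> 0" "\<forall>t\<in>c ` J. \<exists>p\<in>poly_over E. poly d y * t = poly p y"
    using adjoin_common_denominator[OF E, of "c ` J" y] c J by blast
  have "\<forall>j. \<exists>p. j \<in> J \<longrightarrow> p \<in> poly_over E \<and> poly d y * c j = poly p y" using d(3) by blast
  then obtain p where p: "\<And>j. j \<in> J \<Longrightarrow> p j \<in> poly_over E \<and> poly d y * c j = poly (p j) y" by metis
  define P where "P = (\<Sum>j\<in>J. smult (v j) (p j))"
  have "P \<in> poly_over ?E'" unfolding P_def using p v poly_over_mono[OF EE']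
    by (intro subring_sum subring_poly_over poly_over_smult subfield_subring[OF E']) auto
  moreover have "poly P y = 0"
  proof -
    have "poly (smult (v j) (p j)) y = poly d y * (c j * v j)" if "j \<in> J" for j
      using p[OF that] by (metis mult.assoc mult.commute poly_smult)
    then have "poly P y = (\<Sum>j\<in>J. poly d y * (c j * v j))" unfolding P_def poly_sum
      by (intro sum.cong refl)
    also have "\<dots> = 0" using c(3) by (simp add: sum_distrib_left[symmetric])
    finally show ?thesis .
  qed
  ultimately have P0: "P = 0" using y alg_over_trans[OF E] alg_overI by blast
  obtain j where j: "j \<in> J" "c j \<noteq> 0" using c by blast
  then have "poly (p j) y \<noteq> 0" using p[OF j(1)] d by (metis mult_eq_0_iff)
  then obtain k where k: "coeff (p j) k \<noteq> 0" by (metis leading_coeff_0_iff poly_0)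
  have "(\<Sum>j\<in>J. coeff (p j) k * v j) = coeff P k" by (simp add: P_def coeff_sum mult.commute)
  then show ?thesis using P0 k j p by (intro exI[of _ "\<lambda>j. coeff (p j) k"]) (auto intro: coeff_poly_over)
qed

lemma dependent_descend:
  assumes K: "is_subfield K" and ys: "alg_indep_list K ys" and J: "finite J"
    and v: "\<And>j. j \<in> J \<Longrightarrow> alg_over K (v j)"
  shows "m \<le> length ys \<Longrightarrow> \<forall>j\<in>J. c j \<in> adjoin K (set (take m ys)) \<Longrightarrow> \<exists>j\<in>J. c j \<noteq> 0 \<Longrightarrow>
    (\<Sum>j\<in>J. c j * v j) = 0 \<Longrightarrow> \<exists>c'. (\<forall>j\<in>J. c' j \<in> K) \<and> (\<exists>j\<in>J. c' j \<noteq> 0) \<and> (\<Sum>j\<in>J. c' j * v j) = 0"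
proof (induction m arbitrary: c)
  case 0
  then show ?case using adjoin_empty[OF K] by auto
next
  case (Suc m)
  let ?E = "adjoin K (set (take m ys))"
  have "set (take (Suc m) ys) = set (take m ys) \<union> {ys ! m}" using Suc.prems by (simp add: take_Suc_conv_app_nth)
  then have 1: "adjoin K (set (take (Suc m) ys)) = adjoin ?E {ys ! m}" by (simp add: adjoin_adjoin)
  have 2: "\<not> alg_over ?E (ys ! m)" using ys Suc.prems by (auto simp: alg_indep_list_def alg_cl_def)
  have 3: "\<And>j. j \<in> J \<Longrightarrow> alg_over ?E (v j)" using alg_over_mono[OF adjoin_base] v by blast
  obtain c' where "\<forall>j\<in>J. c' j \<in> ?E" "\<exists>j\<in>J. c' j \<noteq> 0" "(\<Sum>j\<in>J. c' j * v j) = 0"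
    using dependent_descend_single[OF adjoin_subfield 2 J, of v c] 3 Suc.prems 1 by auto
  then show ?case using Suc by auto
qed

text \<open>The field is finite-dimensional over \<open>K(ys)\<close>, where \<open>ys\<close> is a transcendence basis among the generators.
  Too many elements are therefore dependent over \<open>K(ys)\<close>, and for elements that are algebraic over \<open>K\<close> such a
  dependence descends to \<open>K\<close>.\<close>

lemma algebraic_elements_bounded:
  fixes K :: "'a::field set"
  assumes K: "is_subfield K" and G: "finite G" "adjoin K G = UNIV"
  obtains N where "\<And>J v. finite J \<Longrightarrow> N < card J \<Longrightarrow> (\<And>j. j \<in> J \<Longrightarrow> alg_over K (v j)) \<Longrightarrow>
     \<exists>c. (\<forall>j\<in>J. c j \<in> K) \<and> (\<exists>j\<in>J. c j \<noteq> 0) \<and> (\<Sum>j\<in>J. c j * v (j::'a)) = 0"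
proof -
  obtain ys where ys: "alg_indep_list K ys" "G \<subseteq> alg_cl K (set ys)"
    using transcendence_basis[OF G(1)] by blast
  let ?E = "adjoin K (set ys)"
  obtain S where S: "finite S" "adjoin ?E G \<subseteq> fspan ?E S"
    using adjoin_algebraic_findim[OF adjoin_subfield G(1), of K "set ys"] ys by (auto simp: alg_cl_def)
  have "adjoin K G \<subseteq> adjoin ?E G" by (rule adjoin_mono[OF adjoin_base]) simp
  then have SU: "x \<in> fspan ?E S" for x using S G by blast
  have "\<exists>c. (\<forall>j\<in>J. c j \<in> K) \<and> (\<exists>j\<in>J. c j \<noteq> 0) \<and> (\<Sum>j\<in>J. c j * v j) = 0"
    if J: "finite J" "card S < card J" "\<And>j. j \<in> J \<Longrightarrow> alg_over K (v j)" for J :: "'a set" and v :: "'a \<Rightarrow> 'a"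
  proof -
    obtain c where "\<forall>j\<in>J. c j \<in> ?E" "\<exists>j\<in>J. c j \<noteq> 0" "(\<Sum>j\<in>J. c j * v j) = 0"
      using fspan_dependent[OF adjoin_subfield S(1) J(1,2) SU] by blast
    then show ?thesis using dependent_descend[where m = "length ys" and c = c and v = v, OF K ys(1) J(1) J(3)] by simp
  qed
  then show ?thesis using that by blast
qed

lemma ring_hom_subfield:
  fixes \<iota> :: "'k::field \<Rightarrow> 'a::field"
  assumes "is_ring_hom \<iota>"
  shows ring_hom_0: "\<iota> 0 = 0" and ring_hom_diff: "\<iota> (x - y) = \<iota> x - \<iota> y"
    and ring_hom_inverse: "\<iota> (inverse x) = inverse (\<iota> x)"
    and ring_hom_eq_0: "\<iota> x = 0 \<longleftrightarrow> x = 0"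
    and ring_hom_range_subfield: "is_subfield (range \<iota>)"
proof -
  have h: "\<iota> 1 = 1" "\<iota> (x + y) = \<iota> x + \<iota> y" "\<iota> (x * y) = \<iota> x * \<iota> y" for x y
    using assms by (auto simp: is_ring_hom_def)
  show h0: "\<iota> 0 = 0" using h(2)[of 0 0] by (metis add.right_neutral add_cancel_right_right)
  show hd: "\<iota> (x - y) = \<iota> x - \<iota> y" for x y using h(2)[of "x - y" y] by simp
  show hz: "\<iota> x = 0 \<longleftrightarrow> x = 0" for x
  proof
    assume "\<iota> x = 0"
    then show "x = 0" using h(3)[of x "inverse x"] h(1) by (cases "x = 0") auto
  qed (simp add: h0)
  show hi: "\<iota> (inverse x) = inverse (\<iota> x)" for x
  proof (cases "x = 0")
    case False
    then show ?thesis using h(3)[of "inverse x" x] h(1) hz[of x] by (simp add: field_simps)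
  qed (simp add: h0)
  have "1 \<in> range \<iota>" using h(1) by (metis rangeI)
  then show "is_subfield (range \<iota>)"
    by (auto simp: is_subfield_def is_subring_def hi[symmetric] hd[symmetric] h(3)[symmetric])
qed

lemma ring_hom_inj: "is_ring_hom (\<iota> :: 'k::field \<Rightarrow> 'a::field) \<Longrightarrow> inj \<iota>"
  by (rule injI) (metis ring_hom_diff ring_hom_eq_0 right_minus_eq)

lemma alg_closure_in_eq:
  fixes \<iota> :: "'k::field \<Rightarrow> 'a::field"
  assumes h: "is_ring_hom \<iota>"
  shows "alg_closure_in \<iota> = {x. alg_over (range \<iota>) x}"
proof (intro Set.set_eqI iffI)
  fix x assume "x \<in> alg_closure_in \<iota>"
  then obtain p where p: "p \<noteq> 0" "poly (map_poly \<iota> p) x = 0" by (auto simp: alg_closure_in_def)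
  have "map_poly \<iota> p \<in> poly_over (range \<iota>)" by (auto simp: poly_over_def coeff_map_poly ring_hom_0[OF h])
  moreover have "map_poly \<iota> p \<noteq> 0" using p(1) ring_hom_eq_0[OF h] by (simp add: map_poly_eq_0_iff ring_hom_0[OF h])
  ultimately show "x \<in> {x. alg_over (range \<iota>) x}" using p alg_overI by blast
next
  fix x assume "x \<in> {x. alg_over (range \<iota>) x}"
  then obtain p where p: "p \<in> poly_over (range \<iota>)" "p \<noteq> 0" "poly p x = 0" by (auto simp: alg_over_def)
  define g where "g = inv_into UNIV \<iota>"
  have g: "\<iota> (g c) = c" if "c \<in> range \<iota>" for c using that by (simp add: g_def f_inv_into_f)
  have g0: "g 0 = 0" using inv_f_f[OF ring_hom_inj[OF h], of 0] ring_hom_0[OF h] by (simp add: g_def)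
  have "map_poly \<iota> (map_poly g p) = p"
    using p(1) g by (intro poly_eqI) (auto simp: coeff_map_poly g0 ring_hom_0[OF h] poly_over_def)
  then show "x \<in> alg_closure_in \<iota>" using p unfolding alg_closure_in_def
    by (auto intro!: exI[of _ "map_poly g p"])
qed

theorem finite_alg_closure:
  fixes \<iota> :: "'k::field \<Rightarrow> 'a::field"
  assumes h: "is_ring_hom \<iota>" and G: "finite G" "adjoin (range \<iota>) G = UNIV"
  shows "is_finite_ext \<iota> (alg_closure_in \<iota>)"
proof -
  let ?K = "range \<iota>" and ?A = "alg_closure_in \<iota>"
  note hK = ring_hom_range_subfield[OF h]
  have hh: "\<iota> 1 = 1" "\<iota> (x + y) = \<iota> x + \<iota> y" "\<iota> (x * y) = \<iota> x * \<iota> y" for x y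
    using h by (auto simp: is_ring_hom_def)
  have A: "?A = {x. alg_over ?K x}" by (rule alg_closure_in_eq[OF h])
  have sA: "is_subfield ?A" unfolding A by (rule alg_closure_subfield[OF hK])
  have KA: "?K \<subseteq> ?A" unfolding A using alg_over_elem[OF subfield_subring[OF hK]] by auto
  obtain N where N: "\<And>J v. finite J \<Longrightarrow> N < card J \<Longrightarrow> (\<And>j. j \<in> J \<Longrightarrow> alg_over ?K (v j)) \<Longrightarrow>
     \<exists>c. (\<forall>j\<in>J. c j \<in> ?K) \<and> (\<exists>j\<in>J. c j \<noteq> 0) \<and> (\<Sum>j\<in>J. c j * v (j::'a)) = 0"
    using algebraic_elements_bounded[OF hK G] by blast
  interpret V: vector_space "\<lambda>c x. \<iota> c * x"
    by unfold_locales (simp_all only: hh distrib_left distrib_right mult.assoc mult_1_left)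
  obtain B where B: "B \<subseteq> ?A" "V.independent B" "?A \<subseteq> V.span B" by (rule V.basis_exists[of ?A])
  have "finite B"
  proof (rule ccontr)
    assume "infinite B"
    then obtain J where J: "J \<subseteq> B" "finite J" "card J = Suc N" using infinite_arbitrarily_large by blast
    obtain c where c: "\<forall>j\<in>J. c j \<in> ?K" "\<exists>j\<in>J. c j \<noteq> 0" "(\<Sum>j\<in>J. c j * j) = 0"
      using N[of J "\<lambda>j. j"] J B by (auto simp: A)
    define u where "u = (\<lambda>j. inv_into UNIV \<iota> (c j))"
    have u: "c j = \<iota> (u j)" if "j \<in> J" for j
      using c(1) that f_inv_into_f[of "c j" \<iota> UNIV] by (simp add: u_def)
    have "(\<Sum>j\<in>J. \<iota> (u j) * j) = 0" using c(3) u by simp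
    then have "\<forall>j\<in>J. u j = 0"
      using V.independentD[OF B(2) J(2,1)] by blast
    then show False using c(2) u ring_hom_0[OF h] by auto
  qed
  moreover have "V.span B \<subseteq> ?A"
  proof (rule V.span_minimal[OF B(1)])
    show "V.subspace ?A" unfolding V.subspace_def
      using KA subfield_subring[OF sA] by (auto intro: subring_0 subring_add subring_mult)
  qed
  ultimately have "finite B \<and> ?A = V.span B" using B(3) by blast
  then show ?thesis using sA KA unfolding is_finite_ext_def by blast
qed

section \<open>Extension of homomorphisms and the Krull dimension\<close>

definition hom_on :: "'a::comm_ring_1 set \<Rightarrow> ('a \<Rightarrow> 'c::comm_ring_1) \<Rightarrow> bool" where
  "hom_on S \<theta> \<longleftrightarrow> \<theta> 1 = 1 \<and>
     (\<forall>x\<in>S. \<forall>y\<in>S. \<theta> (x + y) = \<theta> x + \<theta> y \<and> \<theta> (x * y) = \<theta> x * \<theta> y)"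

lemma hom_on_add: "hom_on S \<theta> \<Longrightarrow> x \<in> S \<Longrightarrow> y \<in> S \<Longrightarrow> \<theta> (x + y) = \<theta> x + \<theta> y"
  and hom_on_mult: "hom_on S \<theta> \<Longrightarrow> x \<in> S \<Longrightarrow> y \<in> S \<Longrightarrow> \<theta> (x * y) = \<theta> x * \<theta> y"
  and hom_on_1: "hom_on S \<theta> \<Longrightarrow> \<theta> 1 = 1"
  by (auto simp: hom_on_def)

lemma hom_on_0: "is_subring S \<Longrightarrow> hom_on S \<theta> \<Longrightarrow> \<theta> 0 = 0"
  using hom_on_add[of S \<theta> 0 0] subring_0[of S] by simp

lemma hom_on_diff: "is_subring S \<Longrightarrow> hom_on S \<theta> \<Longrightarrow> x \<in> S \<Longrightarrow> y \<in> S \<Longrightarrow> \<theta> (x - y) = \<theta> x - \<theta> y"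
  using hom_on_add[of S \<theta> "x - y" y] subring_diff[of S x y] by simp

lemma hom_on_power: "is_subring S \<Longrightarrow> hom_on S \<theta> \<Longrightarrow> x \<in> S \<Longrightarrow> \<theta> (x ^ n) = \<theta> x ^ n"
  by (induction n) (auto simp: hom_on_1 hom_on_mult subring_power)

lemma hom_on_sum:
  assumes "is_subring S" "hom_on S \<theta>"
  shows "(\<And>i. i \<in> I \<Longrightarrow> f i \<in> S) \<Longrightarrow> \<theta> (sum f I) = (\<Sum>i\<in>I. \<theta> (f i))"
proof (induction I rule: infinite_finite_induct)
  case (insert i I)
  have "\<theta> (f i + sum f I) = \<theta> (f i) + \<theta> (sum f I)"
    using insert assms by (intro hom_on_add[of S] subring_sum) auto
  then show ?case using insert by simp
qed (simp_all add: hom_on_0[OF assms])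

lemma hom_on_mono: "S \<subseteq> T \<Longrightarrow> hom_on T \<theta> \<Longrightarrow> hom_on S \<theta>"
  by (auto simp: hom_on_def)

lemma hom_on_image_subring:
  assumes "is_subring S" "hom_on S \<theta>" shows "is_subring (\<theta> ` S)"
  unfolding is_subring_def
proof (intro conjI ballI)
  show "1 \<in> \<theta> ` S" using subring_1[OF assms(1)] hom_on_1[OF assms(2)] by (metis imageI)
  fix u v assume "u \<in> \<theta> ` S" "v \<in> \<theta> ` S"
  then obtain x y where xy: "x \<in> S" "y \<in> S" "u = \<theta> x" "v = \<theta> y" by auto
  show "u - v \<in> \<theta> ` S" "u * v \<in> \<theta> ` S"
    using xy subring_diff[OF assms(1) xy(1,2)] subring_mult[OF assms(1) xy(1,2)]
    by (auto simp: hom_on_diff[OF assms xy(1,2), symmetric] hom_on_mult[OF assms(2) xy(1,2), symmetric])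
qed

lemma coeff_map_poly_hom:
  "is_subring S \<Longrightarrow> hom_on S \<theta> \<Longrightarrow> coeff (map_poly \<theta> p) i = \<theta> (coeff p i)"
  by (simp add: coeff_map_poly hom_on_0)

lemma map_poly_hom:
  assumes S: "is_subring S" and h: "hom_on S \<theta>" and pq: "p \<in> poly_over S" "q \<in> poly_over S"
  shows map_poly_hom_add: "map_poly \<theta> (p + q) = map_poly \<theta> p + map_poly \<theta> q"
    and map_poly_hom_mult: "map_poly \<theta> (p * q) = map_poly \<theta> p * map_poly \<theta> q"
    and map_poly_hom_diff: "map_poly \<theta> (p - q) = map_poly \<theta> p - map_poly \<theta> q"
proof -
  note c = coeff_poly_over[OF pq(1)] coeff_poly_over[OF pq(2)]
  show "map_poly \<theta> (p + q) = map_poly \<theta> p + map_poly \<theta> q"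
    by (rule poly_eqI) (simp add: coeff_map_poly_hom[OF S h] hom_on_add[OF h] c)
  show "map_poly \<theta> (p - q) = map_poly \<theta> p - map_poly \<theta> q"
    by (rule poly_eqI) (simp add: coeff_map_poly_hom[OF S h] hom_on_diff[OF S h] c)
  show "map_poly \<theta> (p * q) = map_poly \<theta> p * map_poly \<theta> q"
  proof (rule poly_eqI)
    fix n
    have "\<theta> (\<Sum>i\<le>n. coeff p i * coeff q (n - i)) = (\<Sum>i\<le>n. \<theta> (coeff p i) * \<theta> (coeff q (n - i)))"
      by (subst hom_on_sum[OF S h]) (auto simp: hom_on_mult[OF h] c intro: subring_mult[OF S])
    then show "coeff (map_poly \<theta> (p * q)) n = coeff (map_poly \<theta> p * map_poly \<theta> q) n"
      by (simp add: coeff_map_poly_hom[OF S h] coeff_mult)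
  qed
qed

lemma map_poly_hom_const: "is_subring S \<Longrightarrow> hom_on S \<theta> \<Longrightarrow> map_poly \<theta> [:c:] = [:\<theta> c:]"
  by (rule poly_eqI) (simp add: coeff_map_poly_hom coeff_pCons hom_on_0 split: nat.split)

text \<open>A homomorphism extends to \<open>S[x]\<close> by \<open>x \<mapsto> \<xi>\<close> as soon as \<open>\<xi>\<close> satisfies the images of all relations of \<open>x\<close>.\<close>

lemma hom_extend_by_root:
  fixes \<theta> :: "'a::comm_ring_1 \<Rightarrow> 'c::comm_ring_1"
  assumes S: "is_subring S" and h: "hom_on S \<theta>"
    and root: "\<And>p. p \<in> poly_over S \<Longrightarrow> poly p x = 0 \<Longrightarrow> poly (map_poly \<theta> p) \<xi> = 0"
  obtains \<theta>' where "hom_on ((\<lambda>p. poly p x) ` poly_over S) \<theta>'" "\<And>y. y \<in> S \<Longrightarrow> \<theta>' y = \<theta> y"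
    "\<And>p. p \<in> poly_over S \<Longrightarrow> \<theta>' (poly p x) = poly (map_poly \<theta> p) \<xi>"
proof -
  define \<theta>' where "\<theta>' = (\<lambda>u. poly (map_poly \<theta> (SOME p. p \<in> poly_over S \<and> poly p x = u)) \<xi>)"
  note Sp = subring_poly_over[OF S]
  have ev: "\<theta>' (poly p x) = poly (map_poly \<theta> p) \<xi>" if p: "p \<in> poly_over S" for p
  proof -
    define q where "q = (SOME q. q \<in> poly_over S \<and> poly q x = poly p x)"
    have q: "q \<in> poly_over S \<and> poly q x = poly p x"
      unfolding q_def by (rule someI[of _ p]) (use p in simp)
    then have "poly (map_poly \<theta> (q - p)) \<xi> = 0"
      using p by (intro root subring_diff[OF Sp]) auto
    then show ?thesis using q p by (simp add: \<theta>'_def q_def[symmetric] map_poly_hom_diff[OF S h])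
  qed
  have c: "\<theta>' y = \<theta> y" if "y \<in> S" for y
    using ev[OF poly_over_const[OF S that]] by (simp add: map_poly_hom_const[OF S h])
  have "hom_on ((\<lambda>p. poly p x) ` poly_over S) \<theta>'"
    unfolding hom_on_def
  proof (intro conjI ballI)
    show "\<theta>' 1 = 1" using c[OF subring_1[OF S]] hom_on_1[OF h] by simp
    fix u v assume "u \<in> (\<lambda>p. poly p x) ` poly_over S" "v \<in> (\<lambda>p. poly p x) ` poly_over S"
    then obtain p q where pq: "p \<in> poly_over S" "q \<in> poly_over S" "u = poly p x" "v = poly q x" by auto
    show "\<theta>' (u + v) = \<theta>' u + \<theta>' v"
      using ev[OF pq(1)] ev[OF pq(2)] ev[OF subring_add[OF Sp pq(1,2)]] pq
      by (simp add: map_poly_hom_add[OF S h])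
    show "\<theta>' (u * v) = \<theta>' u * \<theta>' v"
      using ev[OF pq(1)] ev[OF pq(2)] ev[OF subring_mult[OF Sp pq(1,2)]] pq
      by (simp add: map_poly_hom_mult[OF S h])
  qed
  then show ?thesis using that c ev by blast
qed

lemma subring_hull_insert:
  assumes S: "is_subring S"
  shows "is_subring hull (insert x S) = (\<lambda>p. poly p x) ` poly_over S"
proof (rule hull_unique)
  show "insert x S \<subseteq> (\<lambda>p. poly p x) ` poly_over S"
    using eval_image_base[OF S] eval_image_gen[OF S] by blast
  show "is_subring ((\<lambda>p. poly p x) ` poly_over S)" by (rule subring_eval_image[OF S])
  fix T assume T: "insert x S \<subseteq> T" "is_subring T"
  then have "poly_over S \<subseteq> poly_over T" by (intro poly_over_mono) auto
  then show "(\<lambda>p. poly p x) ` poly_over S \<subseteq> T" using T poly_poly_over[OF T(2)] by blast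
qed

lemma subfield_hull_fractions:
  assumes C: "is_subring (C :: 'a::field set)" and u: "u \<in> is_subfield hull C"
  obtains a b where "a \<in> C" "b \<in> C" "b \<noteq> 0" "u = a / b"
proof -
  have "\<exists>a b. a \<in> C \<and> b \<in> C \<and> b \<noteq> 0 \<and> u = a / b"
    using u
  proof (rule hull_induct)
    fix x assume "x \<in> C"
    then show "\<exists>a b. a \<in> C \<and> b \<in> C \<and> b \<noteq> 0 \<and> x = a / b"
      using subring_1[OF C] by (intro exI[of _ x] exI[of _ 1]) auto
  next
    let ?R = "{x. \<exists>a b. a \<in> C \<and> b \<in> C \<and> b \<noteq> 0 \<and> x = a / b}"
    have R: "x \<in> ?R" if "a \<in> C" "b \<in> C" "b \<noteq> 0" "x = a / b" for x a b using that by blast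
    show "is_subfield ?R" unfolding is_subfield_def is_subring_def
    proof (intro conjI ballI)
      show "1 \<in> ?R" by (rule R[of 1 1]) (use subring_1[OF C] in auto)
      fix x y assume "x \<in> ?R" "y \<in> ?R"
      then obtain a b c d where *: "a \<in> C" "b \<in> C" "b \<noteq> 0" "x = a / b" "c \<in> C" "d \<in> C" "d \<noteq> 0" "y = c / d" by blast
      show "x - y \<in> ?R"
        by (rule R[of "a * d - c * b" "b * d"]) (use * in \<open>auto simp: diff_frac_eq intro: subring_diff subring_mult C\<close>)
      show "x * y \<in> ?R"
        by (rule R[of "a * c" "b * d"]) (use * in \<open>auto intro: subring_mult C\<close>)
    next
      fix x assume "x \<in> ?R"
      then obtain a b where *: "a \<in> C" "b \<in> C" "b \<noteq> 0" "x = a / b" by blast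
      show "inverse x \<in> ?R"
      proof (cases "a = 0")
        case True
        then show ?thesis using * by (intro R[of a b]) auto
      next
        case False
        then show ?thesis using * by (intro R[of b a]) auto
      qed
    qed
  qed
  then show ?thesis using that by blast
qed

lemma common_denominator:
  assumes C: "is_subring (C :: 'a::field set)"
  shows "finite T \<Longrightarrow> T \<subseteq> is_subfield hull C \<Longrightarrow> \<exists>d\<in>C. d \<noteq> 0 \<and> (\<forall>t\<in>T. d * t \<in> C)"
proof (induction T rule: finite_induct)
  case empty
  then show ?case using subring_1[OF C] by (intro bexI[of _ 1]) auto
next
  case (insert t T)
  then obtain d where d: "d \<in> C" "d \<noteq> 0" "\<forall>t\<in>T. d * t \<in> C" by auto
  obtain a b where ab: "a \<in> C" "b \<in> C" "b \<noteq> 0" "t = a / b"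
    using subfield_hull_fractions[OF C, of t] insert.prems by auto
  have "d * b * s \<in> C" if "s \<in> insert t T" for s
  proof (cases "s = t")
    case True
    then have "d * b * s = d * a" using ab by simp
    then show ?thesis using subring_mult[OF C d(1) ab(1)] by metis
  next
    case False
    then have "d * s \<in> C" using that d by blast
    then have "b * (d * s) \<in> C" by (rule subring_mult[OF C ab(2)])
    then show ?thesis by (simp add: mult.assoc mult.left_commute)
  qed
  then show ?case using d ab subring_mult[OF C] by (intro bexI[of _ "d * b"]) auto
qed

text \<open>Clear the denominators of an equation over the fraction field.\<close>

lemma alg_over_hull:
  assumes C: "is_subring (C :: 'a::field set)" and x: "alg_over (is_subfield hull C) x"
  shows "alg_over C x"
proof -
  obtain p where p: "p \<in> poly_over (is_subfield hull C)" "p \<noteq> 0" "poly p x = 0"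
    using x by (auto simp: alg_over_def)
  obtain d where d: "d \<in> C" "d \<noteq> 0" "\<forall>t\<in>coeff p ` {..degree p}. d * t \<in> C"
    using common_denominator[OF C, of "coeff p ` {..degree p}"] p(1) by (auto simp: poly_over_def)
  have "coeff (smult d p) i \<in> C" for i
    using d subring_0[OF C] by (cases "i \<le> degree p") (auto simp: coeff_eq_0)
  then have "smult d p \<in> poly_over C" by (simp add: poly_over_def)
  then show ?thesis using p d by (intro alg_overI[of "smult d p"]) auto
qed

lemma infinite_alg_closed: "infinite (UNIV :: 'c::alg_closed_field set)"
proof
  assume fin: "finite (UNIV :: 'c set)"
  define p :: "'c poly" where "p = (\<Prod>a\<in>UNIV. [:- a, 1:]) + 1"
  have "degree (\<Prod>a\<in>(UNIV::'c set). [:- a, 1:]) = card (UNIV :: 'c set)"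
    by (subst degree_prod_eq_sum_degree) auto
  moreover have "card (UNIV :: 'c set) > 0" using fin by (simp add: card_gt_0_iff)
  ultimately have "degree p > 0" unfolding p_def by (subst degree_add_eq_left) auto
  then obtain x where "poly p x = 0" using alg_closed_imp_poly_has_root by blast
  moreover have "poly (\<Prod>a\<in>UNIV. [:- a, 1:]) x = 0"
    by (simp add: poly_prod prod_zero_iff fin) 
  ultimately show False by (simp add: p_def)
qed

text \<open>The element \<open>c\<close> collects what has to be inverted: a leading coefficient in the
  transcendental case; in the algebraic case the leading coefficient of an equation for \<open>x\<close>
  and the constant term of an equation for \<open>b\<close>.\<close>

lemma hom_extend_single:
  fixes C :: "'a::field set"
  assumes C: "is_subring C" and b: "b \<in> (\<lambda>p. poly p x) ` poly_over C" "b \<noteq> 0"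
  shows "\<exists>c\<in>C. c \<noteq> 0 \<and> (\<forall>\<theta> :: 'a \<Rightarrow> 'c::alg_closed_field. hom_on C \<theta> \<longrightarrow> \<theta> c \<noteq> 0 \<longrightarrow>
     (\<exists>\<theta>'. hom_on ((\<lambda>p. poly p x) ` poly_over C) \<theta>' \<and> (\<forall>y\<in>C. \<theta>' y = \<theta> y) \<and> \<theta>' b \<noteq> 0))"
proof -
  obtain g where g: "g \<in> poly_over C" "b = poly g x" using b by auto
  have g0: "g \<noteq> 0" using b g by auto
  note Cp = subring_poly_over[OF C]
  show ?thesis
  proof (cases "alg_over C x")
    case False
    show ?thesis
    proof (intro bexI[of _ "lead_coeff g"] conjI allI impI)
      fix \<theta> :: "'a \<Rightarrow> 'c" assume h: "hom_on C \<theta>" and l: "\<theta> (lead_coeff g) \<noteq> 0"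
      have "map_poly \<theta> g \<noteq> 0" using l coeff_map_poly_hom[OF C h, of g "degree g"] by auto
      then have "finite {\<xi>. poly (map_poly \<theta> g) \<xi> = 0}" by (rule poly_roots_finite)
      then obtain \<xi> where \<xi>: "poly (map_poly \<theta> g) \<xi> \<noteq> 0"
        using infinite_alg_closed[where 'c = 'c] by (metis (mono_tags, lifting) UNIV_eq_I mem_Collect_eq)
      have *: "poly (map_poly \<theta> p) \<xi> = 0" if "p \<in> poly_over C" "poly p x = 0" for p
      proof -
        have "p = 0" using False that alg_overI by blast
        then show ?thesis by simp
      qed
      obtain \<theta>' where "hom_on ((\<lambda>p. poly p x) ` poly_over C) \<theta>'" "\<And>y. y \<in> C \<Longrightarrow> \<theta>' y = \<theta> y"
        "\<And>p. p \<in> poly_over C \<Longrightarrow> \<theta>' (poly p x) = poly (map_poly \<theta> p) \<xi>"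
        using hom_extend_by_root[OF C h *] by blast
      then show "\<exists>\<theta>'. hom_on ((\<lambda>p. poly p x) ` poly_over C) \<theta>' \<and> (\<forall>y\<in>C. \<theta>' y = \<theta> y) \<and> \<theta>' b \<noteq> 0"
        using \<xi> g by auto
    qed (use g g0 in \<open>auto intro: coeff_poly_over\<close>)
  next
    case True
    define n where "n = (LEAST n. \<exists>f\<in>poly_over C. f \<noteq> 0 \<and> poly f x = 0 \<and> degree f = n)"
    have "\<exists>n. \<exists>f\<in>poly_over C. f \<noteq> 0 \<and> poly f x = 0 \<and> degree f = n"
      using True by (auto simp: alg_over_def)
    then have "\<exists>f\<in>poly_over C. f \<noteq> 0 \<and> poly f x = 0 \<and> degree f = n"
      unfolding n_def by (rule LeastI_ex)
    then obtain f where f: "f \<in> poly_over C" "f \<noteq> 0" "poly f x = 0" "degree f = n" by blast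
    have min: "r = 0" if "r \<in> poly_over C" "poly r x = 0" "degree r < n" for r
      using that not_less_Least[of "degree r" "\<lambda>n. \<exists>f\<in>poly_over C. f \<noteq> 0 \<and> poly f x = 0 \<and> degree f = n"]
      unfolding n_def[symmetric] by blast
    have df: "degree f > 0" using f by (metis degree_eq_zeroE gr_zeroI poly_const_conv pCons_0_0 poly_0)
    let ?Q = "is_subfield hull C"
    have Q: "is_subfield ?Q" by (rule subfield_hull)
    have CQ: "C \<subseteq> ?Q" by (rule hull_subset)
    have aQ: "is_subfield {y. alg_over ?Q y}" by (rule alg_closure_subfield[OF Q])
    have "g \<in> poly_over {y. alg_over ?Q y}"
      using g CQ alg_over_elem[OF subfield_subring[OF Q]] by (auto simp: poly_over_def)
    then have "b \<in> {y. alg_over ?Q y}" unfolding g(2)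
      using alg_over_mono[OF CQ True] by (intro poly_poly_over subfield_subring[OF aQ]) auto
    then have "alg_over C b" using alg_over_hull[OF C] by simp
    then obtain p where p: "p \<in> poly_over C" "poly p b = 0" "coeff p 0 \<noteq> 0"
      using alg_over_nonzero_const[OF _ b(2)] by blast
    obtain a p' where ap: "p = pCons a p'" by (cases p)
    have a: "a \<in> C" "a \<noteq> 0" and p': "p' \<in> poly_over C" using p ap by (auto simp: poly_over_pCons_iff)
    have lf: "lead_coeff f \<in> C" "lead_coeff f \<noteq> 0" using f by (auto intro: coeff_poly_over)
    show ?thesis
    proof (intro bexI[of _ "lead_coeff f * a"] conjI allI impI)
      fix \<theta> :: "'a \<Rightarrow> 'c" assume h: "hom_on C \<theta>" and l: "\<theta> (lead_coeff f * a) \<noteq> 0"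
      have l1: "\<theta> (lead_coeff f) \<noteq> 0" and l2: "\<theta> a \<noteq> 0" using l hom_on_mult[OF h lf(1) a(1)] by auto
      have "degree (map_poly \<theta> f) > 0"
        using df l1 coeff_map_poly_hom[OF C h, of f "degree f"] le_degree[of "map_poly \<theta> f" "degree f"] by simp
      then obtain \<xi> where \<xi>: "poly (map_poly \<theta> f) \<xi> = 0" using alg_closed_imp_poly_has_root by blast
      have *: "poly (map_poly \<theta> q) \<xi> = 0" if q: "q \<in> poly_over C" "poly q x = 0" for q
      proof -
        obtain k A R where AR: "A \<in> poly_over C" "R \<in> poly_over C"
          "smult (lead_coeff f ^ k) q = A * f + R" "R = 0 \<or> degree R < degree f"
          using poly_over_pseudo_divide[OF C f(1,2) q(1)] by blast
        have "poly (smult (lead_coeff f ^ k) q) x = poly (A * f + R) x" using AR by simp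
        then have "poly R x = 0" using q f by simp
        then have "R = 0" using min[of R] AR f by auto
        then have e: "[:lead_coeff f ^ k:] * q = A * f" using AR by simp
        have lk: "lead_coeff f ^ k \<in> C" by (intro subring_power C lf)
        have "map_poly \<theta> ([:lead_coeff f ^ k:] * q) = [:\<theta> (lead_coeff f) ^ k:] * map_poly \<theta> q"
          using map_poly_hom_mult[OF C h poly_over_const[OF C lk] q(1)] map_poly_hom_const[OF C h]
            hom_on_power[OF C h lf(1)] by simp
        moreover have "map_poly \<theta> (A * f) = map_poly \<theta> A * map_poly \<theta> f"
          by (rule map_poly_hom_mult[OF C h AR(1) f(1)])
        ultimately have "[:\<theta> (lead_coeff f) ^ k:] * map_poly \<theta> q = map_poly \<theta> A * map_poly \<theta> f" using e by metis
        then have "poly ([:\<theta> (lead_coeff f) ^ k:] * map_poly \<theta> q) \<xi> = 0" using \<xi> by (metis poly_mult mult_zero_right)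
        then show ?thesis using l1 by simp
      qed
      obtain \<theta>' where \<theta>': "hom_on ((\<lambda>p. poly p x) ` poly_over C) \<theta>'" "\<And>y. y \<in> C \<Longrightarrow> \<theta>' y = \<theta> y"
        using hom_extend_by_root[OF C h *] by blast
      let ?Cx = "(\<lambda>p. poly p x) ` poly_over C"
      have Cx: "is_subring ?Cx" by (rule subring_eval_image[OF C])
      have CCx: "C \<subseteq> ?Cx" by (rule eval_image_base[OF C])
      have "p' \<in> poly_over ?Cx" using p' poly_over_mono[OF CCx] by blast
      then have pb: "poly p' b \<in> ?Cx" by (intro poly_poly_over Cx b(1))
      have "\<theta>' b \<noteq> 0"
      proof
        assume z: "\<theta>' b = 0"
        have "0 = \<theta>' (a + b * poly p' b)" using p(2) ap hom_on_0[OF Cx \<theta>'(1)] by simp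
        also have "\<dots> = \<theta>' a + \<theta>' b * \<theta>' (poly p' b)"
          using a CCx b(1) pb
          by (subst hom_on_add[OF \<theta>'(1)]) (auto simp: hom_on_mult[OF \<theta>'(1)] intro: subring_mult[OF Cx])
        finally show False using z l2 \<theta>'(2)[OF a(1)] by simp
      qed
      then show "\<exists>\<theta>'. hom_on ?Cx \<theta>' \<and> (\<forall>y\<in>C. \<theta>' y = \<theta> y) \<and> \<theta>' b \<noteq> 0" using \<theta>' by blast
    qed (use lf a in \<open>auto intro: subring_mult[OF C]\<close>)
  qed
qed

lemma hom_extend:
  fixes C :: "'a::field set"
  assumes "is_subring C"
  shows "finite G \<Longrightarrow> b \<in> is_subring hull (C \<union> G) \<Longrightarrow> b \<noteq> 0 \<Longrightarrow>
    \<exists>c\<in>C. c \<noteq> 0 \<and> (\<forall>\<theta> :: 'a \<Rightarrow> 'c::alg_closed_field. hom_on C \<theta> \<longrightarrow> \<theta> c \<noteq> 0 \<longrightarrow>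
     (\<exists>\<theta>'. hom_on (is_subring hull (C \<union> G)) \<theta>' \<and> (\<forall>y\<in>C. \<theta>' y = \<theta> y) \<and> \<theta>' b \<noteq> 0))"
proof (induction G arbitrary: b rule: finite_induct)
  case empty
  then show ?case using assms by (auto simp: hull_same intro!: bexI[of _ b])
next
  case (insert x G)
  let ?D = "is_subring hull (C \<union> G)"
  have D: "is_subring ?D" by (rule subring_hull)
  have CD: "C \<subseteq> ?D" using hull_subset[of "C \<union> G" is_subring] by simp
  have "is_subring hull (C \<union> insert x G) = is_subring hull (insert x ?D)"
    using hull_Un_right[of is_subring "{x}" "C \<union> G"] by simp
  then have e: "is_subring hull (C \<union> insert x G) = (\<lambda>p. poly p x) ` poly_over ?D"
    using subring_hull_insert[OF D] by simp
  obtain d where d: "d \<in> ?D" "d \<noteq> 0" "\<And>\<theta> :: 'a \<Rightarrow> 'c. hom_on ?D \<theta> \<Longrightarrow> \<theta> d \<noteq> 0 \<Longrightarrow>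
     (\<exists>\<theta>'. hom_on ((\<lambda>p. poly p x) ` poly_over ?D) \<theta>' \<and> (\<forall>y\<in>?D. \<theta>' y = \<theta> y) \<and> \<theta>' b \<noteq> 0)"
    using hom_extend_single[OF D, of b x] insert.prems unfolding e by blast
  obtain c where c: "c \<in> C" "c \<noteq> 0" "\<And>\<theta> :: 'a \<Rightarrow> 'c. hom_on C \<theta> \<Longrightarrow> \<theta> c \<noteq> 0 \<Longrightarrow>
     (\<exists>\<theta>'. hom_on ?D \<theta>' \<and> (\<forall>y\<in>C. \<theta>' y = \<theta> y) \<and> \<theta>' d \<noteq> 0)"
    using insert.IH[OF d(1,2)] by blast
  show ?case unfolding e
  proof (intro bexI[of _ c] conjI allI impI)
    fix \<theta> :: "'a \<Rightarrow> 'c" assume "hom_on C \<theta>" "\<theta> c \<noteq> 0"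
    then obtain \<theta>1 where 1: "hom_on ?D \<theta>1" "\<forall>y\<in>C. \<theta>1 y = \<theta> y" "\<theta>1 d \<noteq> 0" using c(3) by blast
    obtain \<theta>2 where 2: "hom_on ((\<lambda>p. poly p x) ` poly_over ?D) \<theta>2" "\<forall>y\<in>?D. \<theta>2 y = \<theta>1 y" "\<theta>2 b \<noteq> 0"
      using d(3)[OF 1(1,3)] by blast
    have "\<forall>y\<in>C. \<theta>2 y = \<theta> y" using 1 2 CD by auto
    then show "\<exists>\<theta>'. hom_on ((\<lambda>p. poly p x) ` poly_over ?D) \<theta>' \<and> (\<forall>y\<in>C. \<theta>' y = \<theta> y) \<and> \<theta>' b \<noteq> 0"
      using 2 by blast
  qed (use c in auto)
qed

text \<open>One step of the chain of primes: the last independent element \<open>y\<close> is specialised to a scalar \<open>\<eta>\<close>, so that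
  \<open>y - \<eta>\<close> becomes zero. Only finitely many \<open>\<eta>\<close> are excluded by the condition for extending the
  specialisation to the other generators of \<open>R\<close>.\<close>

lemma specialise_last:
  fixes k0 :: "'c::alg_closed_field set"
  assumes k0: "is_subfield k0" "infinite k0" and G: "finite G"
    and R: "R = is_subring hull (k0 \<union> G)" and ys: "set ys \<subseteq> R" "y \<in> R"
    and ind: "y \<notin> alg_cl k0 (set ys)"
  obtains \<sigma> where "hom_on R \<sigma>" "\<And>c. c \<in> k0 \<Longrightarrow> \<sigma> c = c" "\<And>z. z \<in> set ys \<Longrightarrow> \<sigma> z = z"
    "\<exists>z\<in>R. z \<noteq> 0 \<and> \<sigma> z = 0"
proof -
  define D where "D = is_subring hull (k0 \<union> set ys)"
  have D: "is_subring D" unfolding D_def by (rule subring_hull)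
  have kD: "k0 \<union> set ys \<subseteq> D" unfolding D_def by (rule hull_subset)
  define C where "C = (\<lambda>p. poly p y) ` poly_over D"
  have C: "is_subring C" unfolding C_def by (rule subring_eval_image[OF D])
  have DC: "D \<subseteq> C" unfolding C_def by (rule eval_image_base[OF D])
  have yC: "y \<in> C" unfolding C_def by (rule eval_image_gen[OF D])
  have Rs: "is_subring R" unfolding R by (rule subring_hull)
  have kR: "k0 \<union> G \<subseteq> R" unfolding R by (rule hull_subset)
  have DR: "D \<subseteq> R" unfolding D_def using ys kR Rs by (intro hull_minimal) auto
  have CR: "C \<subseteq> R"
    unfolding C_def subring_hull_insert[OF D, symmetric] using DR ys Rs by (intro hull_minimal) auto
  have RC: "is_subring hull (C \<union> G) = R"
  proof
    show "is_subring hull (C \<union> G) \<subseteq> R" using CR kR Rs by (intro hull_minimal) auto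
    show "R \<subseteq> is_subring hull (C \<union> G)" unfolding R using kD DC by (intro hull_mono) auto
  qed
  have "D \<subseteq> adjoin k0 (set ys)" unfolding D_def
    using adjoin_base[of k0] adjoin_gen[of "set ys" k0] by (intro hull_minimal subfield_subring[OF adjoin_subfield]) auto
  then have ntr: "\<not> alg_over D y" using ind alg_over_mono by (auto simp: alg_cl_def)
  have one: "1 \<in> is_subring hull (C \<union> G)" unfolding RC by (rule subring_1[OF Rs])
  obtain c where c: "c \<in> C" "c \<noteq> 0" "\<And>\<theta> :: 'c \<Rightarrow> 'c. hom_on C \<theta> \<Longrightarrow> \<theta> c \<noteq> 0 \<Longrightarrow>
     (\<exists>\<theta>'. hom_on R \<theta>' \<and> (\<forall>y\<in>C. \<theta>' y = \<theta> y) \<and> \<theta>' 1 \<noteq> 0)"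
    using hom_extend[OF C G one] unfolding RC by auto
  obtain g where g: "g \<in> poly_over D" "c = poly g y" using c(1) by (auto simp: C_def)
  have "g \<noteq> 0" using g c by auto
  then have "finite {\<eta>. poly g \<eta> = 0}" by (rule poly_roots_finite)
  then obtain \<eta> where \<eta>: "\<eta> \<in> k0" "poly g \<eta> \<noteq> 0"
    using k0(2) by (metis (mono_tags, lifting) finite_subset mem_Collect_eq subsetI)
  have hid: "hom_on D id" by (simp add: hom_on_def)
  have idm: "map_poly id p = p" for p :: "'c poly" by (rule poly_eqI) (simp add: coeff_map_poly)
  have *: "poly (map_poly id p) \<eta> = 0" if "p \<in> poly_over D" "poly p y = 0" for p
  proof -
    have "p = 0" using ntr that alg_overI by blast
    then show ?thesis by simp
  qed
  obtain \<theta> where \<theta>: "hom_on C \<theta>" "\<And>z. z \<in> D \<Longrightarrow> \<theta> z = z"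
    "\<And>p. p \<in> poly_over D \<Longrightarrow> \<theta> (poly p y) = poly p \<eta>"
    using hom_extend_by_root[OF D hid *] unfolding C_def idm id_apply by blast
  have "\<theta> c \<noteq> 0" using \<theta>(3)[OF g(1)] g \<eta> by simp
  then obtain \<sigma> where \<sigma>: "hom_on R \<sigma>" "\<forall>z\<in>C. \<sigma> z = \<theta> z" using c(3)[OF \<theta>(1)] by blast
  have sD: "\<sigma> z = z" if "z \<in> D" for z using \<sigma> \<theta> DC that by auto
  have \<eta>D: "\<eta> \<in> D" using \<eta> kD by auto
  have y\<eta>: "y - \<eta> \<in> C" using yC \<eta>D DC by (intro subring_diff[OF C]) auto
  have "poly [:- \<eta>, 1:] y = y - \<eta>" by simp
  moreover have "[:- \<eta>, 1:] \<in> poly_over D"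
    using poly_over_X[OF D] poly_over_const[OF D \<eta>D] subring_diff[OF subring_poly_over[OF D], of "[:0,1:]" "[:\<eta>:]"] by simp
  ultimately have "\<theta> (y - \<eta>) = 0" using \<theta>(3)[of "[:- \<eta>, 1:]"] by simp
  then have s0: "\<sigma> (y - \<eta>) = 0" using \<sigma>(2) y\<eta> by simp
  have "y - \<eta> \<noteq> 0" using ntr alg_over_elem[OF D] \<eta>D by auto
  then show ?thesis using that[OF \<sigma>(1)] sD kD s0 y\<eta> CR by blast
qed

lemma hom_image_hull:
  assumes R: "R = is_subring hull (k0 \<union> G)" and h: "hom_on R \<sigma>" and k: "\<And>c. c \<in> k0 \<Longrightarrow> \<sigma> c = c"
  shows "\<sigma> ` R = is_subring hull (k0 \<union> \<sigma> ` G)"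
proof
  have Rs: "is_subring R" unfolding R by (rule subring_hull)
  have kR: "k0 \<union> G \<subseteq> R" unfolding R by (rule hull_subset)
  have "k0 \<subseteq> \<sigma> ` R" using k kR by (metis Un_subset_iff image_eqI subset_iff)
  then show "is_subring hull (k0 \<union> \<sigma> ` G) \<subseteq> \<sigma> ` R"
    using kR by (intro hull_minimal hom_on_image_subring[OF Rs h]) auto
  let ?H = "is_subring hull (k0 \<union> \<sigma> ` G)"
  have H: "is_subring ?H" by (rule subring_hull)
  have kH: "k0 \<union> \<sigma> ` G \<subseteq> ?H" by (rule hull_subset)
  have "R \<subseteq> {z\<in>R. \<sigma> z \<in> ?H}"
    unfolding R
  proof (rule hull_minimal)
    show "k0 \<union> G \<subseteq> {z \<in> is_subring hull (k0 \<union> G). \<sigma> z \<in> ?H}"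
      using kR kH k unfolding R by auto
    show "is_subring {z \<in> is_subring hull (k0 \<union> G). \<sigma> z \<in> ?H}"
      unfolding R[symmetric] is_subring_def[of "{z \<in> R. \<sigma> z \<in> ?H}"]
      using subring_1[OF Rs] subring_diff[OF Rs] subring_mult[OF Rs] subring_1[OF H] subring_diff[OF H]
        subring_mult[OF H] hom_on_1[OF h] hom_on_diff[OF Rs h] hom_on_mult[OF h] by auto
  qed
  then show "\<sigma> ` R \<subseteq> ?H" by auto
qed

lemma chain_of_specialisations:
  fixes k0 :: "'c::alg_closed_field set"
  assumes k0: "is_subfield k0" "infinite k0"
  shows "finite G \<Longrightarrow> R = is_subring hull (k0 \<union> G) \<Longrightarrow> set ys \<subseteq> R \<Longrightarrow> alg_indep_list k0 ys \<Longrightarrow>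
    \<exists>\<theta> :: nat \<Rightarrow> 'c \<Rightarrow> 'c. (\<forall>i. hom_on R (\<theta> i)) \<and> (\<forall>i. \<forall>z\<in>R. \<theta> i z = 0 \<longrightarrow> \<theta> (Suc i) z = 0) \<and>
     (\<forall>i<length ys. \<exists>z\<in>R. \<theta> i z \<noteq> 0 \<and> \<theta> (Suc i) z = 0)"
proof (induction ys arbitrary: G R rule: rev_induct)
  case Nil
  show ?case by (rule exI[of _ "\<lambda>_ z. z"]) (auto simp: hom_on_def)
next
  case (snoc y ys)
  have Rs: "is_subring R" unfolding snoc.prems(2) by (rule subring_hull)
  have ind: "y \<notin> alg_cl k0 (set ys)" "alg_indep_list k0 ys"
    using snoc.prems(4) by (auto simp: alg_indep_list_def nth_append dest: spec[of _ "length ys"])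
      (metis (no_types, lifting) less_Suc_eq not_less_iff_gr_or_eq take_append append_Nil2 diff_is_0_eq' less_or_eq_imp_le take_0)
  obtain \<sigma> where \<sigma>: "hom_on R \<sigma>" "\<And>c. c \<in> k0 \<Longrightarrow> \<sigma> c = c" "\<And>z. z \<in> set ys \<Longrightarrow> \<sigma> z = z"
    "\<exists>z\<in>R. z \<noteq> 0 \<and> \<sigma> z = 0"
    using specialise_last[OF k0 snoc.prems(1,2) _ _ ind(1)] snoc.prems(3) by (metis Un_subset_iff insert_subset list.simps(15) set_append)
  have R': "\<sigma> ` R = is_subring hull (k0 \<union> \<sigma> ` G)" by (rule hom_image_hull[OF snoc.prems(2) \<sigma>(1,2)])
  have ys': "set ys \<subseteq> \<sigma> ` R"
  proof
    fix z assume "z \<in> set ys"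
    then show "z \<in> \<sigma> ` R" using \<sigma>(3)[of z] snoc.prems(3) by (intro image_eqI[of _ _ z]) auto
  qed
  obtain \<theta> :: "nat \<Rightarrow> 'c \<Rightarrow> 'c" where \<theta>: "\<forall>i. hom_on (\<sigma> ` R) (\<theta> i)" "\<forall>i. \<forall>z\<in>\<sigma> ` R. \<theta> i z = 0 \<longrightarrow> \<theta> (Suc i) z = 0"
     "\<forall>i<length ys. \<exists>z\<in>\<sigma> ` R. \<theta> i z \<noteq> 0 \<and> \<theta> (Suc i) z = 0"
    using snoc.IH[OF finite_imageI[OF snoc.prems(1)] R' ys' ind(2)] by blast
  have hc: "hom_on R (\<theta> i \<circ> \<sigma>)" for i
    using \<theta>(1) \<sigma>(1) unfolding hom_on_def by auto
  define \<theta>' where "\<theta>' i = (case i of 0 \<Rightarrow> (\<lambda>z. z) | Suc j \<Rightarrow> \<theta> j \<circ> \<sigma>)" for i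
  have R'0: "is_subring (\<sigma> ` R)" unfolding R' by (rule subring_hull)
  have z0: "\<theta> j 0 = 0" for j using hom_on_0[OF R'0] \<theta>(1) by blast
  have "hom_on R (\<theta>' i)" for i using hc by (cases i) (auto simp: \<theta>'_def hom_on_def)
  moreover have "\<theta>' (Suc i) z = 0" if "z \<in> R" "\<theta>' i z = 0" for i z
    using that \<theta>(2) z0 hom_on_0[OF Rs \<sigma>(1)] by (cases i) (auto simp: \<theta>'_def)
  moreover have "\<exists>z\<in>R. \<theta>' i z \<noteq> 0 \<and> \<theta>' (Suc i) z = 0" if "i < length (ys @ [y])" for i
    using that \<theta>(3) \<sigma>(4) z0 by (cases i) (auto simp: \<theta>'_def)
  ultimately show ?case by blast
qed

lemma alg_over_hom_reflect:
  fixes h :: "'a::field \<Rightarrow> 'c::field"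
  assumes h: "is_ring_hom h" and x: "alg_over (h ` L) (h x)"
  shows "alg_over L x"
proof -
  obtain p where p: "p \<in> poly_over (h ` L)" "p \<noteq> 0" "poly p (h x) = 0" using x by (auto simp: alg_over_def)
  define g where "g = inv_into UNIV h"
  have gh: "g (h c) = c" for c by (simp add: g_def inv_f_f[OF ring_hom_inj[OF h]])
  have g0: "g 0 = 0" using gh[of 0] ring_hom_0[OF h] by simp
  have q: "map_poly g p \<in> poly_over L" using p(1) gh by (auto simp: poly_over_def coeff_map_poly g0 image_iff) (metis)
  have hg: "h (coeff (map_poly g p) i) = coeff p i" for i
    using p(1) gh by (auto simp: poly_over_def coeff_map_poly g0 image_iff) (metis)
  have hp: "h (u + v) = h u + h v" "h (u * v) = h u * h v" for u v using h by (auto simp: is_ring_hom_def)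
  have hpoly: "h (poly q x) = poly (map_poly h q) (h x)" for q
    by (induction q) (simp_all add: hp ring_hom_0[OF h] map_poly_pCons)
  have "coeff (map_poly h (map_poly g p)) i = coeff p i" for i
    unfolding hg[symmetric] by (rule coeff_map_poly[of h, OF ring_hom_0[OF h]])
  then have "map_poly h (map_poly g p) = p" by (rule poly_eqI)
  then have "poly (map_poly g p) x = 0" "map_poly g p \<noteq> 0" using hpoly[of "map_poly g p"] p ring_hom_eq_0[OF h] by auto
  then show ?thesis using q alg_overI by blast
qed

lemma alg_indep_list_hom:
  fixes h :: "'a::field \<Rightarrow> 'c::field"
  assumes h: "is_ring_hom h" and zs: "alg_indep_list K zs"
  shows "alg_indep_list (h ` K) (map h zs)"
  unfolding alg_indep_list_def
proof (intro allI impI notI)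
  fix i assume i: "i < length (map h zs)"
  let ?S = "set (take i zs)"
  assume "map h zs ! i \<in> alg_cl (h ` K) (set (take i (map h zs)))"
  then have "alg_over (adjoin (h ` K) (h ` ?S)) (h (zs ! i))" using i by (simp add: alg_cl_def take_map)
  moreover have "adjoin (h ` K) (h ` ?S) \<subseteq> h ` adjoin K ?S"
  proof (rule adjoin_least)
    have A: "is_subfield (adjoin K ?S)" by (rule adjoin_subfield)
    have hA: "hom_on (adjoin K ?S) h" using h by (simp add: hom_on_def is_ring_hom_def)
    show "is_subfield (h ` adjoin K ?S)"
      using hom_on_image_subring[OF subfield_subring[OF A] hA] subfield_inverse[OF A]
      by (auto simp: is_subfield_def ring_hom_inverse[OF h, symmetric])
  qed (use adjoin_base[of K ?S] adjoin_gen[of ?S K] in auto)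
  ultimately have "alg_over (h ` adjoin K ?S) (h (zs ! i))" using alg_over_mono by blast
  then show False using alg_over_hom_reflect[OF h] zs i by (auto simp: alg_indep_list_def alg_cl_def)
qed

lemma frac_emb_simps [simp]:
  fixes x y :: "'a::idom"
  shows
  "frac_emb 0 = 0" "frac_emb 1 = 1" "frac_emb (x + y) = frac_emb x + frac_emb y"
  "frac_emb (x - y) = frac_emb x - frac_emb y" "frac_emb (x * y) = frac_emb x * frac_emb y"
  "frac_emb (- x) = - frac_emb x" "frac_emb x = frac_emb y \<longleftrightarrow> x = y" "frac_emb (x ^ n) = frac_emb x ^ n"
proof -
  have m: "frac_emb (x * y) = frac_emb x * frac_emb y" for x y :: 'a by (simp add: frac_emb_def)
  show "frac_emb (x ^ n) = frac_emb x ^ n"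
    by (induction n) (simp_all add: m, simp add: frac_emb_def One_fract_def)
qed (simp_all add: frac_emb_def One_fract_def Zero_fract_def eq_fract)

lemma frac_emb_eq_0 [simp]: "frac_emb x = 0 \<longleftrightarrow> x = 0"
  using frac_emb_simps(7)[of x 0] by (simp del: frac_emb_simps(7))

lemma Fract_frac_emb: "b \<noteq> 0 \<Longrightarrow> Fract a b = frac_emb a / frac_emb b"
  by (simp add: frac_emb_def)

lemma fract_cases:
  obtains a b where "b \<noteq> 0" "z = frac_emb a / frac_emb b"
  by (cases z rule: Fract_cases_nonzero) (auto simp: Fract_frac_emb intro: that[of 1 0])

lemma fract_common_denominator:
  "finite Z \<Longrightarrow> \<exists>q\<noteq>0. \<forall>z\<in>Z. \<exists>a. frac_emb q * z = frac_emb a"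
proof (induction Z rule: finite_induct)
  case empty
  show ?case by (rule exI[of _ 1]) auto
next
  case (insert z Z)
  then obtain q where q: "q \<noteq> 0" "\<forall>z\<in>Z. \<exists>a. frac_emb q * z = frac_emb a" by blast
  obtain a b where ab: "b \<noteq> 0" "z = frac_emb a / frac_emb b" by (rule fract_cases)
  have "\<exists>a. frac_emb (q * b) * s = frac_emb a" if s: "s \<in> insert z Z" for s
  proof (cases "s = z")
    case True
    then have "frac_emb (q * b) * s = frac_emb (q * a)" using ab by simp
    then show ?thesis by blast
  next
    case False
    then obtain c where "frac_emb q * s = frac_emb c" using s q by auto
    then have "frac_emb (q * b) * s = frac_emb (c * b)" by (simp add: mult.commute mult.left_commute)
    then show ?thesis by blast
  qed
  then show ?case using q(1) ab(1) by (intro exI[of _ "q * b"]) auto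
qed

lemma poset_ht_ge:
  assumes "\<And>i. i \<le> n \<Longrightarrow> x i \<in> S" "\<And>i. i < n \<Longrightarrow> x i < x (Suc i)"
  shows "enat n \<le> poset_ht S"
  unfolding poset_ht_def using assms by (intro SUP_upper) blast

text \<open>Transcendence degree is a lower bound for the Krull dimension: inverting a common
  denominator \<open>q\<close> of the independent elements, the kernels of the successive specialisations
  are a chain of primes, and it stays strict when contracted along the localisation.\<close>

theorem krull_dim_lower_bound:
  fixes \<phi> :: "'k::field \<Rightarrow> 'b::idom"
  assumes B: "affine_domain \<phi>" and inf: "infinite (range \<phi>)"
    and zs: "alg_indep_list (range (\<lambda>c. frac_emb (\<phi> c))) zs"
  shows "enat (length zs) \<le> krull_dim TYPE('b)"
proof -
  obtain S where S: "finite S" "is_subring hull (range \<phi> \<union> S) = UNIV" and \<phi>: "is_ring_hom \<phi>"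
    using B by (auto simp: affine_domain_def)
  define j :: "'b \<Rightarrow> 'b fract alg_closure" where "j = (\<lambda>b. to_ac (frac_emb b))"
  have j: "j 1 = 1" "j (x + y) = j x + j y" "j (x * y) = j x * j y" "j (x - y) = j x - j y"
    "j 0 = 0" "j x = 0 \<longleftrightarrow> x = 0" "j (x ^ n) = j x ^ n" for x y n by (simp_all add: j_def)
  have ac: "is_ring_hom (to_ac :: 'b fract \<Rightarrow> _)" by (simp add: is_ring_hom_def)
  define k0 where "k0 = range (\<lambda>c. j (\<phi> c))"
  have "is_ring_hom (\<lambda>c. j (\<phi> c))" using \<phi> by (simp add: is_ring_hom_def j)
  then have k0: "is_subfield k0" unfolding k0_def by (rule ring_hom_range_subfield)
  have "inj j" by (rule injI) (metis j(4,6) right_minus_eq)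
  then have "infinite k0" unfolding k0_def
    using inf by (metis finite_imageD image_image inj_on_subset subset_UNIV)
  have zs': "alg_indep_list k0 (map to_ac zs)"
    using alg_indep_list_hom[OF ac zs] by (simp add: image_image k0_def j_def)
  obtain q where q: "q \<noteq> 0" "\<forall>z\<in>set zs. \<exists>a. frac_emb q * z = frac_emb a"
    using fract_common_denominator[of "set zs"] by auto
  define G where "G = j ` S \<union> {inverse (j q)}"
  define R where "R = is_subring hull (k0 \<union> G)"
  have Rs: "is_subring R" unfolding R_def by (rule subring_hull)
  have kR: "k0 \<union> G \<subseteq> R" unfolding R_def by (rule hull_subset)
  have jR: "j b \<in> R" for b
  proof -
    have "is_subring hull (range \<phi> \<union> S) \<subseteq> {b. j b \<in> R}"
      using kR subring_1[OF Rs] subring_diff[OF Rs] subring_mult[OF Rs]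
      by (intro hull_minimal) (auto simp: k0_def G_def is_subring_def[of "{b. j b \<in> R}"] j)
    then show ?thesis using S(2) by auto
  qed
  have zR: "set (map to_ac zs) \<subseteq> R"
  proof
    fix w assume "w \<in> set (map to_ac zs)"
    then obtain z where z: "z \<in> set zs" "w = to_ac z" by auto
    then obtain a where "frac_emb q * z = frac_emb a" using q by blast
    then have "z = frac_emb a * inverse (frac_emb q)" using q(1) by (simp add: field_simps)
    then have "w = j a * inverse (j q)" using z by (simp add: j_def)
    moreover have "inverse (j q) \<in> R" using kR by (auto simp: G_def)
    ultimately show "w \<in> R" using subring_mult[OF Rs jR] by simp
  qed
  have loc: "\<exists>N b. j q ^ N * w = j b" if "w \<in> R" for w
    using that unfolding R_def
  proof (rule hull_induct)
    fix w assume "w \<in> k0 \<union> G"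
    then consider b where "w = j b" | "w = inverse (j q)" by (auto simp: k0_def G_def)
    then show "\<exists>N b. j q ^ N * w = j b"
    proof cases
      case 1
      then show ?thesis by (intro exI[of _ 0] exI[of _ b]) simp
    next
      case 2
      then show ?thesis using q(1) by (intro exI[of _ 1] exI[of _ 1]) (simp add: j)
    qed
  next
    show "is_subring {w. \<exists>N b. j q ^ N * w = j b}"
      unfolding is_subring_def
    proof (intro conjI ballI)
      have "j q ^ 0 * 1 = j 1" using j(1) by simp
      then show "1 \<in> {w. \<exists>N b. j q ^ N * w = j b}" by blast
      fix u v assume "u \<in> {w. \<exists>N b. j q ^ N * w = j b}" "v \<in> {w. \<exists>N b. j q ^ N * w = j b}"
      then obtain N b M c where *: "j q ^ N * u = j b" "j q ^ M * v = j c" by auto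
      have "j q ^ (N + M) * (u - v) = j q ^ M * (j q ^ N * u) - j q ^ N * (j q ^ M * v)"
        by (simp add: power_add algebra_simps)
      also have "\<dots> = j (q ^ M * b - q ^ N * c)" by (simp add: * j)
      finally show "u - v \<in> {w. \<exists>N b. j q ^ N * w = j b}" by blast
      have "j q ^ (N + M) * (u * v) = (j q ^ N * u) * (j q ^ M * v)"
        by (simp add: power_add algebra_simps)
      also have "\<dots> = j (b * c)" by (simp add: * j)
      finally show "u * v \<in> {w. \<exists>N b. j q ^ N * w = j b}" by blast
    qed
  qed
  have fX: "finite G" using S by (simp add: G_def)
  obtain \<theta> :: "nat \<Rightarrow> 'b fract alg_closure \<Rightarrow> 'b fract alg_closure" where \<theta>: "\<forall>i. hom_on R (\<theta> i)"
     "\<forall>i. \<forall>z\<in>R. \<theta> i z = 0 \<longrightarrow> \<theta> (Suc i) z = 0"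
     "\<forall>i<length (map to_ac zs). \<exists>z\<in>R. \<theta> i z \<noteq> 0 \<and> \<theta> (Suc i) z = 0"
    using chain_of_specialisations[OF k0 \<open>infinite k0\<close> fX R_def zR zs'] by blast
  have h: "hom_on R (\<theta> i)" for i using \<theta>(1) by blast
  define P where "P i = {b. \<theta> i (j b) = 0}" for i
  have prime: "is_prime_ideal (P i)" for i
    unfolding is_prime_ideal_def is_ideal_def P_def
    using hom_on_0[OF Rs h] hom_on_1[OF h] j jR hom_on_add[OF h] hom_on_mult[OF h]
    by (auto simp: set_eq_iff j(5) intro!: exI[of _ 1])
  have strict: "P i < P (Suc i)" if i: "i < length zs" for i
  proof
    show "P i \<subseteq> P (Suc i)" using \<theta>(2) jR by (auto simp: P_def)
    obtain z where z: "z \<in> R" "\<theta> i z \<noteq> 0" "\<theta> (Suc i) z = 0" using \<theta>(3) i by auto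
    obtain N b where b: "j q ^ N * z = j b" using loc[OF z(1)] by blast
    have *: "\<theta> l (j b) = \<theta> l (j q) ^ N * \<theta> l z" for l
      unfolding b[symmetric] using hom_on_mult[OF h subring_power[OF Rs jR] z(1)] hom_on_power[OF Rs h jR] by simp
    have "inverse (j q) \<in> R" using kR by (auto simp: G_def)
    then have "\<theta> i (j q) * \<theta> i (inverse (j q)) = 1"
      using hom_on_mult[OF h jR, of "inverse (j q)" i q] hom_on_1[OF h] q(1) by (simp add: j)
    then have "\<theta> i (j q) \<noteq> 0" by auto
    then have "b \<in> P (Suc i) - P i" using * z by (simp add: P_def)
    then show "P i \<noteq> P (Suc i)" by blast
  qed
  have "enat (length zs) \<le> poset_ht {P :: 'b set. is_prime_ideal P}"
    by (rule poset_ht_ge[of _ P]) (use prime strict in auto)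
  then show "enat (length zs) \<le> krull_dim TYPE('b)" by (simp add: krull_dim_def)
qed

section \<open>Derivations and their extension to the fraction field\<close>

lemma derivation_add: "is_derivation D \<Longrightarrow> D (x + y) = D x + D y"
  and derivation_mult: "is_derivation D \<Longrightarrow> D (x * y) = D x * y + x * D y"
  by (auto simp: is_derivation_def)

lemma derivation_0: "is_derivation D \<Longrightarrow> D 0 = 0"
  using derivation_add[of D 0 0] by simp

lemma derivation_diff: "is_derivation D \<Longrightarrow> D (x - y) = D x - D y"
  using derivation_add[of D "x - y" y] by simp

lemma derivation_1: "is_derivation D \<Longrightarrow> D 1 = 0"
  using derivation_mult[of D 1 1] by simp

lemma derivation_sum: "is_derivation D \<Longrightarrow> D (sum f I) = (\<Sum>i\<in>I. D (f i))"
  by (induction I rule: infinite_finite_induct) (auto simp: derivation_0 derivation_add)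

lemma derivation_of_nat: "is_derivation D \<Longrightarrow> D (of_nat n) = 0"
  by (induction n) (auto simp: derivation_0 derivation_1 derivation_add)

lemma derivation_power:
  assumes "is_derivation D"
  shows "D (x ^ Suc n) = of_nat (Suc n) * x ^ n * D x"
proof (induction n)
  case (Suc n)
  have "D (x ^ Suc (Suc n)) = D x * x ^ Suc n + x * D (x ^ Suc n)"
    using derivation_mult[OF assms, of x "x ^ Suc n"] by simp
  then show ?case unfolding Suc by (simp add: algebra_simps)
qed simp

lemma derivation_inverse:
  fixes \<delta> :: "'a::field \<Rightarrow> 'a"
  assumes "is_derivation \<delta>" "\<delta> x = 0"
  shows "\<delta> (inverse x) = 0"
proof (cases "x = 0")
  case False
  have "\<delta> (x * inverse x) = \<delta> x * inverse x + x * \<delta> (inverse x)" by (rule derivation_mult[OF assms(1)])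
  then show ?thesis using False assms derivation_1[OF assms(1)] by simp
qed (use assms in auto)

lemma subfield_constants:
  fixes \<Delta> :: "('a::field \<Rightarrow> 'a) set"
  assumes "\<And>\<delta>. \<delta> \<in> \<Delta> \<Longrightarrow> is_derivation \<delta>"
  shows "is_subfield {x. \<forall>\<delta>\<in>\<Delta>. \<delta> x = 0}"
  using assms by (auto simp: is_subfield_def is_subring_def derivation_1 derivation_diff derivation_mult
      derivation_inverse)

lemma derivation_poly:
  fixes \<delta> :: "'a::idom \<Rightarrow> 'a"
  assumes "is_derivation \<delta>"
  shows "\<delta> (poly p x) = poly (map_poly \<delta> p) x + poly (pderiv p) x * \<delta> x"
proof (induction p)
  case 0
  then show ?case by (simp add: derivation_0[OF assms])
next
  case (pCons a p)
  then show ?case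
    by (simp add: derivation_add[OF assms] derivation_mult[OF assms] map_poly_pCons derivation_0[OF assms]
        pderiv_pCons algebra_simps)
qed

lemma degree_pderiv_less: "degree p \<noteq> 0 \<Longrightarrow> degree (pderiv p) < degree p"
proof -
  assume "degree p \<noteq> 0"
  then obtain k where k: "degree p = Suc k" by (cases "degree p") auto
  have "degree (pderiv p) \<le> k" by (rule degree_le) (simp add: coeff_pderiv coeff_eq_0 k)
  then show ?thesis using k by simp
qed

text \<open>In characteristic zero a derivation that kills a field kills what is algebraic over it:
  differentiate an equation of least degree.\<close>

lemma derivation_algebraic:
  fixes \<delta> :: "'a::field \<Rightarrow> 'a"
  assumes \<delta>: "is_derivation \<delta>" and char: "\<And>n. of_nat (Suc n) \<noteq> (0::'a)"
    and K: "is_subring K" "\<And>c. c \<in> K \<Longrightarrow> \<delta> c = 0" and x: "alg_over K x"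
  shows "\<delta> x = 0"
proof (rule ccontr)
  assume dx: "\<delta> x \<noteq> 0"
  have "p = 0" if "p \<in> poly_over K" "poly p x = 0" for p
    using that
  proof (induction "degree p" arbitrary: p rule: less_induct)
    case less
    have "map_poly \<delta> p = 0"
      using less.prems(1) K(2) by (intro poly_eqI) (simp add: coeff_map_poly derivation_0[OF \<delta>] coeff_poly_over)
    then have "poly (pderiv p) x = 0"
      using derivation_poly[OF \<delta>, of p x] less.prems(2) dx derivation_0[OF \<delta>] by simp
    moreover have "pderiv p \<in> poly_over K" by (rule poly_over_pderiv[OF K(1) less.prems(1)])
    moreover have False if "degree p > 0" "pderiv p = 0"
    proof -
      obtain k where k: "degree p = Suc k" using \<open>degree p > 0\<close> by (cases "degree p") auto
      have "coeff (pderiv p) k = of_nat (Suc k) * lead_coeff p" unfolding k by (rule coeff_pderiv)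
      moreover have "lead_coeff p \<noteq> 0" using k by (metis degree_0 leading_coeff_0_iff nat.distinct(1))
      ultimately show False using \<open>pderiv p = 0\<close> char[of k] by (auto simp del: of_nat_Suc)
    qed
    ultimately have d: "degree p = 0"
      using less.hyps[of "pderiv p"] degree_pderiv_less[of p] by blast
    then obtain c where "p = [:c:]" by (metis degree_eq_zeroE)
    then show ?case using less.prems by simp
  qed
  then show False using x by (auto simp: alg_over_def)
qed

text \<open>The extension of \<open>D\<close> to the fraction field by the quotient rule, in the implicit form \<open>b y + D b x = D a\<close>
  for all representations \<open>x = a / b\<close>, so that no representation has to be chosen.\<close>

definition fder :: "('b::idom \<Rightarrow> 'b) \<Rightarrow> 'b fract \<Rightarrow> 'b fract" where
  "fder D x = (THE y. \<forall>a b. frac_emb b * x = frac_emb a \<longrightarrow>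
     frac_emb b * y + frac_emb (D b) * x = frac_emb (D a))"

lemma fder_eq:
  fixes D :: "'b::idom \<Rightarrow> 'b"
  assumes D: "is_derivation D"
  shows "frac_emb b * x = frac_emb a \<Longrightarrow> frac_emb b * fder D x + frac_emb (D b) * x = frac_emb (D a)"
proof -
  obtain a0 b0 where 0: "b0 \<noteq> 0" "x = frac_emb a0 / frac_emb b0" by (rule fract_cases)
  then have x0: "frac_emb b0 * x = frac_emb a0" by simp
  define y where "y = (frac_emb (D a0) - frac_emb (D b0) * x) / frac_emb b0"
  have y0: "frac_emb b0 * y = frac_emb (D a0) - frac_emb (D b0) * x" using 0 by (simp add: y_def)
  have y: "frac_emb b * y + frac_emb (D b) * x = frac_emb (D a)" if ab: "frac_emb b * x = frac_emb a" for a b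
  proof -
    have "frac_emb (a * b0) = frac_emb (a0 * b)"
      by (simp add: ab[symmetric] x0[symmetric] algebra_simps)
    then have "a * b0 = a0 * b" by (simp only: frac_emb_simps(7))
    then have "frac_emb (D (a * b0)) = frac_emb (D (a0 * b))" by simp
    then have *: "frac_emb (D a) * frac_emb b0 + frac_emb a * frac_emb (D b0)
      = frac_emb (D a0) * frac_emb b + frac_emb a0 * frac_emb (D b)"
      by (simp only: derivation_mult[OF D] frac_emb_simps)
    have "frac_emb b0 * (frac_emb b * y + frac_emb (D b) * x)
        = frac_emb b * (frac_emb b0 * y) + frac_emb (D b) * (frac_emb b0 * x)" by (simp add: algebra_simps)
    also have "\<dots> = frac_emb (D a0) * frac_emb b + frac_emb a0 * frac_emb (D b) - frac_emb (D b0) * (frac_emb b * x)"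
      unfolding y0 x0 by (simp add: algebra_simps)
    also have "\<dots> = frac_emb b0 * frac_emb (D a)" unfolding ab *[symmetric] by (simp add: algebra_simps)
    finally show ?thesis using 0 by simp
  qed
  have "fder D x = y" unfolding fder_def
  proof (rule the_equality)
    fix z assume "\<forall>a b. frac_emb b * x = frac_emb a \<longrightarrow> frac_emb b * z + frac_emb (D b) * x = frac_emb (D a)"
    then have "frac_emb b0 * z + frac_emb (D b0) * x = frac_emb b0 * y + frac_emb (D b0) * x"
      using x0 y[OF x0] by simp
    then show "z = y" using 0 by simp
  qed (use y in blast)
  then show "frac_emb b * x = frac_emb a \<Longrightarrow> frac_emb b * fder D x + frac_emb (D b) * x = frac_emb (D a)"
    using y by simp
qed

lemma fder_unique:
  assumes D: "is_derivation D" and ab: "frac_emb b * x = frac_emb a" "b \<noteq> 0"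
    and y: "frac_emb b * y + frac_emb (D b) * x = frac_emb (D a)"
  shows "fder D x = y"
proof -
  have "frac_emb b * fder D x = frac_emb b * y" using fder_eq[OF D ab(1)] y by (metis add_right_cancel)
  then show ?thesis using ab by simp
qed

lemma fder_emb: "is_derivation D \<Longrightarrow> fder D (frac_emb x) = frac_emb (D x)"
  by (rule fder_unique[of _ 1 _ x]) (simp_all add: derivation_1)

lemma fder_derivation:
  fixes D :: "'b::idom \<Rightarrow> 'b"
  assumes D: "is_derivation D" shows "is_derivation (fder D)"
  unfolding is_derivation_def
proof (intro conjI allI)
  fix x y :: "'b fract"
  obtain a b where ab: "b \<noteq> 0" "x = frac_emb a / frac_emb b" by (rule fract_cases)
  obtain c d where cd: "d \<noteq> 0" "y = frac_emb c / frac_emb d" by (rule fract_cases)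
  have x: "frac_emb b * x = frac_emb a" and y: "frac_emb d * y = frac_emb c" using ab cd by auto
  note dx = fder_eq[OF D x] and dy = fder_eq[OF D y]
  let ?e = frac_emb
  show "fder D (x + y) = fder D x + fder D y"
  proof (rule fder_unique[OF D])
    show "?e (b * d) * (x + y) = ?e (a * d + c * b)"
      unfolding frac_emb_simps x[symmetric] y[symmetric] by (simp add: algebra_simps)
    show "?e (b * d) * (fder D x + fder D y) + ?e (D (b * d)) * (x + y) = ?e (D (a * d + c * b))"
      unfolding derivation_mult[OF D] derivation_add[OF D] frac_emb_simps dx[symmetric] dy[symmetric]
        x[symmetric] y[symmetric] by (simp add: algebra_simps)
  qed (use ab cd in auto)
  show "fder D (x * y) = fder D x * y + x * fder D y"
  proof (rule fder_unique[OF D])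
    show "?e (b * d) * (x * y) = ?e (a * c)"
      unfolding frac_emb_simps x[symmetric] y[symmetric] by (simp add: algebra_simps)
    show "?e (b * d) * (fder D x * y + x * fder D y) + ?e (D (b * d)) * (x * y) = ?e (D (a * c))"
      unfolding derivation_mult[OF D] derivation_add[OF D] frac_emb_simps dx[symmetric] dy[symmetric]
        x[symmetric] y[symmetric] by (simp add: algebra_simps)
  qed (use ab cd in auto)
qed

section \<open>Locally nilpotent derivations\<close>

lemma LND_derivation: "D \<in> LND \<Longrightarrow> is_derivation D"
  and LND_nilpotent: "D \<in> LND \<Longrightarrow> \<exists>n. (D ^^ n) x = 0"
  by (auto simp: LND_def)

lemma derivation_funpow_0: "is_derivation D \<Longrightarrow> (D ^^ n) 0 = 0"
  by (induction n) (auto simp: derivation_0)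

lemma derivation_funpow_add: "is_derivation D \<Longrightarrow> (D ^^ n) (x + y) = (D ^^ n) x + (D ^^ n) y"
  by (induction n) (auto simp: derivation_add)

lemma derivation_funpow_diff: "is_derivation D \<Longrightarrow> (D ^^ n) (x - y) = (D ^^ n) x - (D ^^ n) y"
  by (induction n) (auto simp: derivation_diff)

lemma derivation_funpow_const: "is_derivation D \<Longrightarrow> D c = 0 \<Longrightarrow> (D ^^ n) (c * x) = c * (D ^^ n) x"
  by (induction n) (auto simp: derivation_mult)

lemma derivation_funpow_ge: "is_derivation D \<Longrightarrow> (D ^^ n) x = 0 \<Longrightarrow> n \<le> m \<Longrightarrow> (D ^^ m) x = 0"
  by (metis derivation_funpow_0 funpow_add le_add_diff_inverse2 o_apply)

lemma LND_last:
  assumes D: "D \<in> LND" and x: "x \<noteq> 0"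
  obtains m where "(D ^^ m) x \<noteq> 0" "(D ^^ Suc m) x = 0"
proof -
  define n where "n = (LEAST n. (D ^^ n) x = 0)"
  have n: "(D ^^ n) x = 0" unfolding n_def using LND_nilpotent[OF D] by (rule LeastI_ex)
  have "n \<noteq> 0" using n x by (cases n) auto
  then obtain m where m: "n = Suc m" by (cases n) auto
  have "(D ^^ m) x \<noteq> 0" using not_less_Least[of m "\<lambda>n. (D ^^ n) x = 0"] m unfolding n_def[symmetric] by simp
  then show ?thesis using that n m by blast
qed

lemma leibniz:
  fixes D :: "'a::comm_ring_1 \<Rightarrow> 'a"
  assumes D: "is_derivation D"
  shows "(D ^^ n) (x * y) = (\<Sum>i\<le>n. of_nat (n choose i) * ((D ^^ i) x * (D ^^ (n - i)) y))"
proof (induction n)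
  case (Suc n)
  let ?f = "\<lambda>i j. (D ^^ i) x * (D ^^ j) y"
  have "(D ^^ Suc n) (x * y) = (\<Sum>i\<le>n. D (of_nat (n choose i) * ?f i (n - i)))"
    by (simp add: Suc derivation_sum[OF D])
  also have "\<dots> = (\<Sum>i\<le>n. of_nat (n choose i) * ?f (Suc i) (n - i) + of_nat (n choose i) * ?f i (Suc n - i))"
    by (intro sum.cong refl) (simp add: derivation_mult[OF D] derivation_of_nat[OF D] Suc_diff_le algebra_simps)
  also have "\<dots> = (\<Sum>i\<le>n. of_nat (n choose i) * ?f (Suc i) (n - i)) + (\<Sum>i\<le>n. of_nat (n choose i) * ?f i (Suc n - i))"
    by (rule sum.distrib)
  also have "(\<Sum>i\<le>n. of_nat (n choose i) * ?f i (Suc n - i)) = (\<Sum>i\<le>Suc n. of_nat (n choose i) * ?f i (Suc n - i))"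
    by (simp add: binomial_eq_0)
  also have "\<dots> = ?f 0 (Suc n) + (\<Sum>i\<le>n. of_nat (n choose Suc i) * ?f (Suc i) (n - i))"
    by (subst sum.atMost_Suc_shift) simp
  also have "(\<Sum>i\<le>n. of_nat (n choose i) * ?f (Suc i) (n - i)) + (?f 0 (Suc n) + (\<Sum>i\<le>n. of_nat (n choose Suc i) * ?f (Suc i) (n - i)))
      = ?f 0 (Suc n) + (\<Sum>i\<le>n. of_nat (Suc n choose Suc i) * ?f (Suc i) (n - i))"
    by (simp add: sum.distrib[symmetric] algebra_simps)
  also have "\<dots> = (\<Sum>i\<le>Suc n. of_nat (Suc n choose i) * ?f i (Suc n - i))"
    by (subst sum.atMost_Suc_shift) simp
  finally show ?case .
qed simp

text \<open>The kernel of a locally nilpotent derivation is factorially closed, because the number of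
  applications needed to kill an element is additive like a degree; so it contains all units.\<close>

lemma LND_kernel_factorially_closed:
  fixes D :: "'b::idom \<Rightarrow> 'b"
  assumes D: "D \<in> LND" and char: "\<And>n. of_nat (Suc n) \<noteq> (0::'b)"
    and xy: "D (x * y) = 0" "x * y \<noteq> 0"
  shows "D x = 0"
proof -
  note d = LND_derivation[OF D]
  obtain m where m: "(D ^^ m) x \<noteq> 0" "(D ^^ Suc m) x = 0" using LND_last[OF D] xy by (metis mult_zero_left)
  obtain n where n: "(D ^^ n) y \<noteq> 0" "(D ^^ Suc n) y = 0" using LND_last[OF D] xy by (metis mult_zero_right)
  have "(D ^^ (m + n)) (x * y) = (\<Sum>i\<le>m + n. of_nat ((m + n) choose i) * ((D ^^ i) x * (D ^^ (m + n - i)) y))"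
    by (rule leibniz[OF d])
  also have "\<dots> = (\<Sum>i\<in>{m}. of_nat ((m + n) choose i) * ((D ^^ i) x * (D ^^ (m + n - i)) y))"
  proof (rule sum.mono_neutral_right)
    show "\<forall>i\<in>{..m + n} - {m}. of_nat ((m + n) choose i) * ((D ^^ i) x * (D ^^ (m + n - i)) y) = 0"
    proof
      fix i assume "i \<in> {..m + n} - {m}"
      then consider "Suc m \<le> i" | "Suc n \<le> m + n - i" by fastforce
      then show "of_nat ((m + n) choose i) * ((D ^^ i) x * (D ^^ (m + n - i)) y) = 0"
        using derivation_funpow_ge[OF d m(2)] derivation_funpow_ge[OF d n(2)] by cases auto
    qed
  qed auto
  also have "\<dots> = of_nat ((m + n) choose m) * ((D ^^ m) x * (D ^^ n) y)" by simp
  also have "\<dots> \<noteq> 0"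
  proof -
    have "(m + n) choose m \<noteq> 0" by simp
    then obtain k where "(m + n) choose m = Suc k" by (metis not0_implies_Suc)
    then show ?thesis using m n char[of k] by simp
  qed
  finally have "(D ^^ (m + n)) (x * y) \<noteq> 0" .
  then have "\<not> Suc 0 \<le> m + n" using derivation_funpow_ge[OF d, of "Suc 0" "x * y" "m + n"] xy by auto
  then have "m = 0" by simp
  then show ?thesis using m by simp
qed

lemma LND_unit:
  fixes D :: "'b::idom \<Rightarrow> 'b"
  assumes "D \<in> LND" "\<And>n. of_nat (Suc n) \<noteq> (0::'b)" "x * y = 1"
  shows "D x = 0"
  using LND_kernel_factorially_closed[OF assms(1,2), of x y] assms(3) derivation_1[OF LND_derivation[OF assms(1)]] by simp

text \<open>If \<open>x = a / b\<close> is a constant, then so are all the equations \<open>D\<^sup>m b x = D\<^sup>m a\<close>; for the last \<open>m\<close> with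
  \<open>D\<^sup>m b \<noteq> 0\<close> both sides are in the kernel.\<close>

lemma frac_of_der_ker:
  assumes D: "D \<in> LND"
  shows "frac_of (der_ker D) = {x. fder D x = 0}"
proof (intro Set.set_eqI iffI)
  note d = LND_derivation[OF D]
  fix x assume "x \<in> frac_of (der_ker D)"
  then obtain a b where ab: "x = Fract a b" "D a = 0" "D b = 0" "b \<noteq> 0" by (auto simp: frac_of_def der_ker_def)
  then have "frac_emb b * x = frac_emb a" by (simp add: Fract_frac_emb)
  then have "fder D x = 0" by (rule fder_unique[OF d _ ab(4)]) (simp add: ab)
  then show "x \<in> {x. fder D x = 0}" by simp
next
  note d = LND_derivation[OF D]
  fix x assume x: "x \<in> {x. fder D x = 0}"
  obtain a b where ab: "b \<noteq> 0" "x = frac_emb a / frac_emb b" by (rule fract_cases)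
  have k: "frac_emb ((D ^^ m) b) * x = frac_emb ((D ^^ m) a)" for m
  proof (induction m)
    case (Suc m)
    from fder_eq[OF d Suc] show ?case using x by simp
  qed (use ab in simp)
  obtain m where m: "(D ^^ m) b \<noteq> 0" "(D ^^ Suc m) b = 0" using LND_last[OF D ab(1)] by blast
  have "(D ^^ Suc m) a = 0" using k[of "Suc m"] m(2) by (simp del: funpow.simps)
  moreover have "x = Fract ((D ^^ m) a) ((D ^^ m) b)"
    using k[of m] m(1) by (simp add: Fract_frac_emb field_simps)
  ultimately show "x \<in> frac_of (der_ker D)" using m by (auto simp: frac_of_def der_ker_def)
qed

lemma K_sub_eq: "\<Delta> \<subseteq> LND \<Longrightarrow> K_sub \<Delta> = {x. \<forall>D\<in>\<Delta>. fder D x = 0}"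
  unfolding K_sub_def using frac_of_der_ker by blast

lemma K_sub_subfield: "\<Delta> \<subseteq> LND \<Longrightarrow> is_subfield (K_sub \<Delta>)"
  using subfield_constants[of "fder ` \<Delta>"] fder_derivation LND_derivation
  unfolding K_sub_eq by (fastforce simp: K_sub_eq)

lemma K_sub_alg_closed:
  fixes \<Delta> :: "('b::idom \<Rightarrow> 'b) set"
  assumes \<Delta>: "\<Delta> \<subseteq> LND" and char: "\<And>n. of_nat (Suc n) \<noteq> (0::'b fract)" and x: "alg_over (K_sub \<Delta>) x"
  shows "x \<in> K_sub \<Delta>"
proof -
  have "fder D x = 0" if "D \<in> \<Delta>" for D
  proof (rule derivation_algebraic[OF _ char subfield_subring[OF K_sub_subfield[OF \<Delta>]] _ x])
    show "is_derivation (fder D)" using fder_derivation LND_derivation \<Delta> that by blast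
    show "fder D c = 0" if "c \<in> K_sub \<Delta>" for c using that \<open>D \<in> \<Delta>\<close> K_sub_eq[OF \<Delta>] by blast
  qed
  then show ?thesis using K_sub_eq[OF \<Delta>] by blast
qed

lemma A_sub_eq: "\<Delta> \<subseteq> LND \<Longrightarrow> x \<in> A_sub \<Delta> \<longleftrightarrow> frac_emb x \<in> K_sub \<Delta>"
proof -
  assume \<Delta>: "\<Delta> \<subseteq> LND"
  have "fder D (frac_emb x) = 0 \<longleftrightarrow> D x = 0" if "D \<in> \<Delta>" for D
    using fder_emb[OF LND_derivation, of D x] \<Delta> that by auto
  then show ?thesis unfolding K_sub_eq[OF \<Delta>] A_sub_def der_ker_def by blast
qed

text \<open>A local slice \<open>r\<close> makes \<open>B\<close> a subring of \<open>L[r]\<close>, where \<open>L\<close> is the fraction field of the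
  kernel: subtracting a multiple of \<open>r\<^sup>n\<close> lowers the nilpotency index.\<close>

lemma LND_local_slice:
  assumes D: "D \<in> LND" and a: "D a \<noteq> 0"
  obtains r where "D r \<noteq> 0" "D (D r) = 0"
proof -
  obtain m where m: "(D ^^ m) (D a) \<noteq> 0" "(D ^^ Suc m) (D a) = 0" using LND_last[OF D a] by blast
  have "D ((D ^^ m) a) = (D ^^ m) (D a)" by (simp add: funpow_swap1)
  then show ?thesis using m by (intro that[of "(D ^^ m) a"]) auto
qed

lemma derivation_funpow_slice:
  assumes D: "is_derivation D" and r: "D (D r) = 0"
  shows "(D ^^ n) (r ^ n) = of_nat (fact n) * D r ^ n"
proof (induction n)
  case (Suc n)
  have Dc: "D (of_nat (Suc n) * D r) = 0" using r by (simp add: derivation_mult[OF D] derivation_of_nat[OF D] del: of_nat_Suc)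
  have "(D ^^ Suc n) (r ^ Suc n) = (D ^^ n) (of_nat (Suc n) * D r * r ^ n)"
    unfolding funpow_Suc_right o_apply derivation_power[OF D] by (simp add: algebra_simps)
  also have "\<dots> = of_nat (Suc n) * D r * (D ^^ n) (r ^ n)" by (rule derivation_funpow_const[OF D Dc])
  finally show ?case by (simp add: Suc algebra_simps)
qed simp

lemma slice_polynomial:
  fixes D :: "'b::idom \<Rightarrow> 'b"
  assumes D: "D \<in> LND" and char: "\<And>n. of_nat (Suc n) \<noteq> (0::'b)" and r: "D r \<noteq> 0" "D (D r) = 0"
  shows "\<exists>p\<in>poly_over {z. fder D z = 0}. frac_emb x = poly p (frac_emb r)"
proof -
  note d = LND_derivation[OF D]
  let ?L = "{z. fder D z = 0}"
  have L: "is_subfield ?L" using subfield_constants[of "{fder D}"] fder_derivation[OF d] by simp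
  note Lp = subring_poly_over[OF subfield_subring[OF L]]
  have "\<exists>p\<in>poly_over ?L. frac_emb x = poly p (frac_emb r)" if "(D ^^ n) x = 0" for n x
    using that
  proof (induction n arbitrary: x)
    case 0
    then show ?case using subring_0[OF Lp] by (intro bexI[of _ 0]) auto
  next
    case (Suc n)
    define y where "y = (D ^^ n) x"
    define e where "e = of_nat (fact n) * D r ^ n"
    have Dy: "D y = 0" using Suc.prems by (simp add: y_def)
    have "D (D r ^ n) = 0" using r by (cases n) (simp_all add: derivation_1[OF d] derivation_power[OF d] del: power_Suc)
    then have De: "D e = 0" by (simp add: e_def derivation_mult[OF d] derivation_of_nat[OF d])
    have "of_nat (fact n) \<noteq> (0::'b)" using char[of "fact n - 1"] by (simp del: of_nat_fact of_nat_Suc)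
    then have e0: "e \<noteq> 0" using r by (simp add: e_def)
    have "(D ^^ n) (e * x - y * r ^ n) = 0"
      unfolding derivation_funpow_diff[OF d] derivation_funpow_const[OF d De] derivation_funpow_const[OF d Dy]
        derivation_funpow_slice[OF d r(2)] by (simp add: e_def y_def)
    then obtain p where p: "p \<in> poly_over ?L" "frac_emb (e * x - y * r ^ n) = poly p (frac_emb r)"
      using Suc.IH by blast
    have eL: "inverse (frac_emb e) \<in> ?L" and yL: "frac_emb y \<in> ?L"
      using subfield_inverse[OF L, of "frac_emb e"] by (simp_all add: fder_emb[OF d] De Dy)
    let ?q = "smult (inverse (frac_emb e)) (p + Polynomial.monom (frac_emb y) n)"
    have "?q \<in> poly_over ?L"
      by (intro poly_over_smult subfield_subring[OF L] eL subring_add[OF Lp] p(1) poly_over_monom yL)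
    moreover have "frac_emb x = poly ?q (frac_emb r)"
      using e0 by (simp add: poly_monom p(2)[symmetric])
    ultimately show ?case by blast
  qed
  then show ?thesis using LND_nilpotent[OF D] by blast
qed

lemma slice_transcendental:
  fixes D :: "'b::idom \<Rightarrow> 'b"
  assumes D: "is_derivation D" and char: "\<And>n. of_nat (Suc n) \<noteq> (0::'b fract)" and r: "D r \<noteq> 0"
  shows "\<not> alg_over {z. fder D z = 0} (frac_emb r)"
proof
  have L: "is_subfield {z. fder D z = 0}" using subfield_constants[of "{fder D}"] fder_derivation[OF D] by simp
  assume "alg_over {z. fder D z = 0} (frac_emb r)"
  then have "fder D (frac_emb r) = 0"
    using derivation_algebraic[OF fder_derivation[OF D] char subfield_subring[OF L]] by blast
  then show False using r by (simp add: fder_emb[OF D])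
qed

section \<open>Subrings of a polynomial ring in one variable\<close>

lemma exists_irreducible_factor:
  fixes w :: "'l::field poly"
  assumes "degree w > 0"
  obtains \<pi> where "irreducible \<pi>" "\<pi> dvd w"
proof -
  define n where "n = (LEAST n. \<exists>p. p dvd w \<and> degree p > 0 \<and> degree p = n)"
  have "\<exists>n p. p dvd w \<and> degree p > 0 \<and> degree p = n"
    using assms by (intro exI[of _ "degree w"] exI[of _ w]) auto
  then have "\<exists>p. p dvd w \<and> degree p > 0 \<and> degree p = n" unfolding n_def by (rule LeastI_ex)
  then obtain \<pi> where \<pi>: "\<pi> dvd w" "degree \<pi> > 0" "degree \<pi> = n" by blast
  have min: "n \<le> degree p" if "p dvd w" "degree p > 0" for p
    unfolding n_def using that by (intro Least_le) blast
  have "irreducible \<pi>"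
  proof (rule irreducibleI)
    show "\<pi> \<noteq> 0" using \<pi> by auto
    have "\<pi> \<noteq> 0" using \<pi> by auto
    then show "\<not> \<pi> dvd 1" using \<pi> is_unit_iff_degree[of \<pi>] by simp
    fix a b assume ab: "\<pi> = a * b"
    then have nz: "a \<noteq> 0" "b \<noteq> 0" using \<pi> by auto
    have "degree a = 0 \<or> degree b = 0"
    proof (rule ccontr)
      assume *: "\<not> (degree a = 0 \<or> degree b = 0)"
      moreover have "a dvd w" using \<pi>(1) ab by (metis dvd_mult_left)
      ultimately have "n \<le> degree a" using min by simp
      then show False using * \<pi>(3) ab nz by (simp add: degree_mult_eq)
    qed
    then show "a dvd 1 \<or> b dvd 1" using nz by (auto simp: is_unit_iff_degree)
  qed
  then show ?thesis using that \<pi> by blast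
qed

lemma subring_UNIV: "is_subring UNIV"
  by (simp add: is_subring_def)

lemma hom_frac_emb: "hom_on UNIV frac_emb"
  by (simp add: hom_on_def)

lemma map_poly_frac_emb [simp]:
  fixes p q :: "'b::idom poly"
  shows "map_poly frac_emb (p + q) = map_poly frac_emb p + map_poly frac_emb q"
    "map_poly frac_emb (p * q) = map_poly frac_emb p * map_poly frac_emb q"
    "map_poly frac_emb (p - q) = map_poly frac_emb p - map_poly frac_emb q"
    "map_poly frac_emb [:c:] = [:frac_emb c:]"
    "map_poly frac_emb (smult c p) = smult (frac_emb c) (map_poly frac_emb p)"
  using map_poly_hom[OF subring_UNIV hom_frac_emb, of p q] map_poly_hom_const[OF subring_UNIV hom_frac_emb, of c]
    map_poly_hom_mult[OF subring_UNIV hom_frac_emb, of "[:c:]" p] by (simp_all add: poly_over_UNIV)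

lemma coeff_map_poly_frac_emb [simp]: "coeff (map_poly frac_emb p) i = frac_emb (coeff p i)"
  by (simp add: coeff_map_poly)

lemma map_poly_frac_emb_eq_iff [simp]: "map_poly frac_emb p = map_poly frac_emb q \<longleftrightarrow> p = q"
  by (auto simp: poly_eq_iff)

lemma degree_map_poly_frac_emb [simp]: "degree (map_poly frac_emb p) = degree p"
  by (rule degree_map_poly) auto

lemma poly_map_poly_frac_emb: "poly (map_poly frac_emb p) (frac_emb x) = frac_emb (poly p x)"
  by (induction p) (simp_all add: map_poly_pCons)

lemma map_poly_frac_emb_lift:
  assumes "\<And>i. coeff p i \<in> range frac_emb"
  obtains q where "p = map_poly frac_emb q"
proof -
  define g :: "'a fract \<Rightarrow> 'a" where "g = inv_into UNIV frac_emb"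
  have "inj (frac_emb :: 'a \<Rightarrow> _)" by (rule injI) simp
  then have g: "g (frac_emb c) = c" for c by (simp add: g_def)
  have g0: "g 0 = 0" using g[of 0] by simp
  have "p = map_poly frac_emb (map_poly g p)"
  proof (rule poly_eqI)
    fix i obtain c where c: "coeff p i = frac_emb c" using assms by blast
    show "coeff p i = coeff (map_poly frac_emb (map_poly g p)) i" by (simp add: coeff_map_poly g0 c g)
  qed
  then show ?thesis using that by blast
qed

lemma common_denominator_poly:
  fixes h :: "'b::idom fract poly"
  obtains w H where "w \<noteq> 0" "map_poly frac_emb H = smult (frac_emb w) h"
proof -
  obtain w where w: "w \<noteq> 0" "\<forall>z\<in>coeff h ` {..degree h}. \<exists>a. frac_emb w * z = frac_emb a"
    using fract_common_denominator[of "coeff h ` {..degree h}"] by auto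
  have "coeff (smult (frac_emb w) h) i \<in> range frac_emb" for i
  proof (cases "i \<le> degree h")
    case True
    then show ?thesis using w by auto
  next
    case False
    then have "coeff (smult (frac_emb w) h) i = frac_emb 0" by (simp add: coeff_eq_0)
    then show ?thesis by blast
  qed
  then obtain H where "smult (frac_emb w) h = map_poly frac_emb H" by (rule map_poly_frac_emb_lift)
  then show ?thesis using that w by metis
qed

text \<open>Gauss' lemma: a monic factor over \<open>L(t)\<close> of a polynomial over \<open>L[t]\<close> whose leading
  coefficient is a unit has its coefficients in \<open>L[t]\<close>. With denominators \<open>w\<close> and \<open>v\<close> of least
  degree for the two factors, no prime of \<open>L[t]\<close> can divide \<open>w\<close>.\<close>

lemma gauss_monic_factor:
  fixes h Q :: "'l::field poly fract poly"
  assumes h: "lead_coeff h = 1" and hQ: "h * Q = map_poly frac_emb G" and G: "lead_coeff G = [:c:]" "c \<noteq> 0"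
  shows "\<exists>H. h = map_poly frac_emb H"
proof -
  have min: "\<exists>w H. w \<noteq> 0 \<and> map_poly frac_emb H = smult (frac_emb w) p \<and>
     (\<forall>w' H'. w' \<noteq> 0 \<longrightarrow> map_poly frac_emb H' = smult (frac_emb w') p \<longrightarrow> degree w \<le> degree w')"
    for p :: "'l poly fract poly"
  proof -
    define n where "n = (LEAST n. \<exists>w H. w \<noteq> 0 \<and> map_poly frac_emb H = smult (frac_emb w) p \<and> degree w = n)"
    obtain w0 H0 where "w0 \<noteq> 0" "map_poly frac_emb H0 = smult (frac_emb w0) p" using common_denominator_poly by blast
    then have "\<exists>n w H. w \<noteq> 0 \<and> map_poly frac_emb H = smult (frac_emb w) p \<and> degree w = n" by blast
    then have "\<exists>w H. w \<noteq> 0 \<and> map_poly frac_emb H = smult (frac_emb w) p \<and> degree w = n"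
      unfolding n_def by (rule LeastI_ex)
    moreover have "n \<le> degree w'" if "w' \<noteq> 0" "map_poly frac_emb H' = smult (frac_emb w') p" for w' H'
      unfolding n_def using that by (intro Least_le) blast
    ultimately show ?thesis by blast
  qed
  have reduce: False if w: "w \<noteq> 0" "map_poly frac_emb H = smult (frac_emb w) p"
      "\<forall>w' H'. w' \<noteq> 0 \<longrightarrow> map_poly frac_emb H' = smult (frac_emb w') p \<longrightarrow> degree w \<le> degree w'"
      and d: "[:\<pi>:] dvd H" "\<pi> dvd w" "degree \<pi> > 0" for \<pi> w H and p :: "'l poly fract poly"
  proof -
    obtain H1 where H1: "H = [:\<pi>:] * H1" using d by (elim dvdE)
    obtain w1 where w1: "w = \<pi> * w1" using d by (elim dvdE)
    have nz: "\<pi> \<noteq> 0" "w1 \<noteq> 0" using w1 w by auto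
    have "smult (frac_emb \<pi>) (map_poly frac_emb H1) = smult (frac_emb \<pi>) (smult (frac_emb w1) p)"
      using w(2) by (simp add: H1 w1)
    then have "map_poly frac_emb H1 = smult (frac_emb w1) p"
      using nz by (auto simp: poly_eq_iff)
    then have "degree w \<le> degree w1" using w(3) nz by blast
    then show False using w1 nz d by (simp add: degree_mult_eq)
  qed
  obtain w H where w: "w \<noteq> 0" "map_poly frac_emb H = smult (frac_emb w) h"
     "\<forall>w' H'. w' \<noteq> 0 \<longrightarrow> map_poly frac_emb H' = smult (frac_emb w') h \<longrightarrow> degree w \<le> degree w'" using min[of h] by blast
  obtain v N where v: "v \<noteq> 0" "map_poly frac_emb N = smult (frac_emb v) Q"
     "\<forall>w' H'. w' \<noteq> 0 \<longrightarrow> map_poly frac_emb H' = smult (frac_emb w') Q \<longrightarrow> degree v \<le> degree w'" using min[of Q] by blast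
  have HN: "H * N = smult (w * v) G"
  proof -
    have "map_poly frac_emb (H * N) = smult (frac_emb w * frac_emb v) (h * Q)"
      by (simp add: w v mult.commute)
    also have "\<dots> = map_poly frac_emb (smult (w * v) G)" by (simp add: hQ)
    finally show ?thesis by (simp only: map_poly_frac_emb_eq_iff)
  qed
  have lN: "lead_coeff N = v * [:c:]"
  proof -
    have "frac_emb (lead_coeff G) = lead_coeff (h * Q)" by (simp add: hQ)
    also have "\<dots> = lead_coeff Q" using h by (simp add: lead_coeff_mult)
    finally have "lead_coeff (map_poly frac_emb N) = frac_emb v * frac_emb [:c:]"
      using v by (simp add: G)
    then have "frac_emb (lead_coeff N) = frac_emb (v * [:c:])" by (simp only: frac_emb_simps coeff_map_poly_frac_emb degree_map_poly_frac_emb)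
    then show ?thesis by (simp only: frac_emb_simps(7))
  qed
  have "degree w = 0"
  proof (rule ccontr)
    assume "degree w \<noteq> 0"
    then obtain \<pi> where \<pi>: "irreducible \<pi>" "\<pi> dvd w" using exists_irreducible_factor[of w] by blast
    have pr: "prime_elem \<pi>" by (rule field_poly_irreducible_imp_prime[OF \<pi>(1)])
    have d\<pi>: "degree \<pi> > 0" using \<pi>(1) by (metis gr_zeroI irreducible_def is_unit_iff_degree)
    obtain w1 where "w = \<pi> * w1" using \<pi>(2) by (elim dvdE)
    then have "smult (w * v) G = [:\<pi>:] * smult (w1 * v) G" by (simp add: mult.assoc mult.commute mult.left_commute)
    then have "[:\<pi>:] dvd smult (w * v) G" by (rule dvdI)
    then have "[:\<pi>:] dvd H \<or> [:\<pi>:] dvd N"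
      using lift_prime_elem_poly[OF pr] HN by (metis prime_elem_dvd_mult_iff)
    moreover have "\<not> [:\<pi>:] dvd H" using reduce[OF w _ \<pi>(2) d\<pi>] by blast
    ultimately have dN: "[:\<pi>:] dvd N" by blast
    then have "\<pi> dvd lead_coeff N" by (simp add: const_poly_dvd_iff)
    then have "\<pi> dvd v \<or> \<pi> dvd [:c:]" using pr lN by (metis prime_elem_dvd_mult_iff)
    moreover have "\<not> \<pi> dvd [:c:]"
    proof
      assume "\<pi> dvd [:c:]"
      then have "degree \<pi> \<le> degree [:c:]" using G(2) by (intro dvd_imp_degree_le) auto
      then show False using d\<pi> by simp
    qed
    ultimately show False using reduce[OF v dN _ d\<pi>] by blast
  qed
  then obtain w0 where w0: "w = [:w0:]" "w0 \<noteq> 0" using w(1) by (metis degree_eq_zeroE pCons_0_0)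
  have "frac_emb [:inverse w0:] * frac_emb [:w0:] = frac_emb ([:inverse w0:] * [:w0:])" by (simp only: frac_emb_simps)
  also have "\<dots> = 1" using w0 by (simp add: one_pCons[symmetric])
  finally have "map_poly frac_emb (smult [:inverse w0:] H) = h" using w(2) w0 by simp
  then show ?thesis by metis
qed

text \<open>Expansion in powers of \<open>q\<close>: the powers \<open>1, t, \<dots>, t\<^sup>d\<^sup>-\<^sup>1\<close> generate \<open>L[t]\<close> over \<open>L[q]\<close>, \<open>d = deg q\<close>.\<close>

lemma q_adic_expansion:
  fixes a q :: "'l::field poly"
  assumes q: "degree q > 0"
  shows "\<exists>\<rho>. a = (\<Sum>i<degree q. Polynomial.monom 1 i * pcompose (\<rho> i) q)"
proof (induction "degree a" arbitrary: a rule: less_induct)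
  case less
  have q0: "q \<noteq> 0" using q by auto
  obtain s r where sr: "a = s * q + r" "r = 0 \<or> degree r < degree q"
    using poly_over_divide[OF subfield_UNIV, of a q] q0 by (auto simp: poly_over_UNIV)
  have r: "r = (\<Sum>i<degree q. Polynomial.monom (coeff r i) i)"
    using sr(2) q by (intro poly_eqI) (auto simp: coeff_sum coeff_eq_0)
  obtain \<sigma> where \<sigma>: "s = (\<Sum>i<degree q. Polynomial.monom 1 i * pcompose (\<sigma> i) q)"
  proof (cases "s = 0")
    case True
    then show ?thesis using that[of "\<lambda>_. 0"] by simp
  next
    case False
    have "degree (s * q) = degree s + degree q" using False q0 by (rule degree_mult_eq)
    then have "degree a = degree s + degree q" unfolding sr(1) using sr(2) q
      by (cases "r = 0") (auto simp: degree_add_eq_left)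
    then have "degree s < degree a" using q by simp
    then show ?thesis using less that by blast
  qed
  have "a = (\<Sum>i<degree q. Polynomial.monom 1 i * pcompose (\<sigma> i) q) * q + (\<Sum>i<degree q. Polynomial.monom (coeff r i) i)"
    using sr(1) r \<sigma> by metis
  also have "\<dots> = (\<Sum>i<degree q. Polynomial.monom 1 i * pcompose (pCons (coeff r i) (\<sigma> i)) q)"
    unfolding sum_distrib_right sum.distrib[symmetric]
    by (intro sum.cong refl) (simp add: pcompose_pCons distrib_left smult_monom mult.commute mult.left_commute)
  finally show ?case by (intro exI[of _ "\<lambda>i. pCons (coeff r i) (\<sigma> i)"])
qed

text \<open>\<open>a(T) - a(t)\<close>, as a polynomial in \<open>T\<close> over \<open>L[t]\<close>.\<close>

definition diff_poly :: "'l::field poly \<Rightarrow> 'l poly poly" where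
  "diff_poly a = map_poly (\<lambda>c. [:c:]) a - [:a:]"

lemma coeff_diff_poly: "coeff (diff_poly a) i = [:coeff a i:] - (if i = 0 then a else 0)"
  by (simp add: diff_poly_def coeff_map_poly coeff_pCons split: nat.split)

lemma poly_diff_poly: "poly (diff_poly a) [:0, 1:] = 0"
proof -
  have "poly (map_poly (\<lambda>c. [:c:]) a) [:0, 1:] = a"
    by (induction a) (simp_all add: map_poly_pCons)
  then show ?thesis by (simp add: diff_poly_def)
qed

lemma degree_diff_poly: "degree a > 0 \<Longrightarrow> degree (diff_poly a) = degree a \<and> lead_coeff (diff_poly a) = [:lead_coeff a:]"
proof -
  assume a: "degree a > 0"
  have "degree (diff_poly a) = degree a"
  proof (rule antisym)
    show "degree (diff_poly a) \<le> degree a" by (rule degree_le) (use a in \<open>auto simp: coeff_diff_poly coeff_eq_0\<close>)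
    show "degree a \<le> degree (diff_poly a)" using a by (intro le_degree) (auto simp: coeff_diff_poly)
  qed
  then show ?thesis using a by (simp add: coeff_diff_poly)
qed

lemma coeff_mult_top:
  assumes "degree p \<le> m" "degree q \<le> n"
  shows "coeff (p * q) (m + n) = coeff p m * coeff q n"
proof -
  have "coeff (p * q) (m + n) = (\<Sum>i\<le>m + n. coeff p i * coeff q (m + n - i))" by (simp add: coeff_mult)
  also have "\<dots> = (\<Sum>i\<in>{m}. coeff p i * coeff q (m + n - i))"
  proof (rule sum.mono_neutral_right)
    show "\<forall>i\<in>{..m + n} - {m}. coeff p i * coeff q (m + n - i) = 0"
    proof
      fix i assume "i \<in> {..m + n} - {m}"
      then consider "i > m" | "m + n - i > n" by fastforce
      then show "coeff p i * coeff q (m + n - i) = 0" using assms by cases (auto simp: coeff_eq_0)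
    qed
  qed auto
  finally show ?thesis by simp
qed

lemma top_coeff_mult:
  fixes P Q :: "'l::field poly poly"
  assumes P: "\<And>i. degree (coeff P i) \<le> m" and Q: "\<And>i. degree (coeff Q i) \<le> n"
  shows "map_poly (\<lambda>p. coeff p (m + n)) (P * Q) = map_poly (\<lambda>p. coeff p m) P * map_poly (\<lambda>p. coeff p n) Q"
proof (rule poly_eqI)
  fix k
  show "coeff (map_poly (\<lambda>p. coeff p (m + n)) (P * Q)) k = coeff (map_poly (\<lambda>p. coeff p m) P * map_poly (\<lambda>p. coeff p n) Q) k"
  proof -
    have "coeff (map_poly (\<lambda>p. coeff p (m + n)) (P * Q)) k = coeff (\<Sum>i\<le>k. coeff P i * coeff Q (k - i)) (m + n)"
      by (simp add: coeff_map_poly coeff_mult[of P])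
    also have "\<dots> = (\<Sum>i\<le>k. coeff (coeff P i) m * coeff (coeff Q (k - i)) n)"
      by (simp only: coeff_sum coeff_mult_top[OF P Q])
    also have "\<dots> = coeff (map_poly (\<lambda>p. coeff p m) P * map_poly (\<lambda>p. coeff p n) Q) k"
      by (subst coeff_mult) (simp add: coeff_map_poly)
    finally show ?thesis .
  qed
qed

text \<open>Lueroth's theorem for polynomials. The coefficients of the minimal polynomial \<open>h\<close> of \<open>t\<close>
  over the fraction field \<open>E\<close> of \<open>R\<close> are polynomials in \<open>t\<close> by Gauss' lemma. Let \<open>q\<close> be one of
  largest degree in \<open>t\<close>. Since \<open>h\<close> divides \<open>q(T) - q(t)\<close>, comparing degrees in \<open>t\<close> and then in \<open>T\<close>
  shows that they agree up to a scalar, so \<open>deg q = [E(t) : E]\<close>. The expansion of an element of \<open>R\<close>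
  in powers of \<open>q\<close> is then an equation of smaller degree for \<open>t\<close>, hence trivial.\<close>

theorem lueroth_polynomial:
  fixes R :: "'l::field poly set"
  assumes R: "is_subring R" and const: "\<And>c. [:c:] \<in> R" and a0: "a0 \<in> R" "degree a0 > 0"
  obtains q \<alpha> \<beta> where "\<alpha> \<in> R" "\<beta> \<in> R" "\<alpha> \<noteq> 0" "q * \<alpha> = \<beta>" "degree q > 0"
    "\<And>f. f \<in> R \<Longrightarrow> \<exists>P. f = pcompose P q"
proof -
  let ?e = "frac_emb :: 'l poly \<Rightarrow> 'l poly fract"
  define t where "t = ?e [:0, 1:]"
  have eR: "is_subring (?e ` R)" by (rule hom_on_image_subring[OF R hom_on_mono[OF subset_UNIV hom_frac_emb]])
  define E where "E = is_subfield hull (?e ` R)"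
  have E: "is_subfield E" unfolding E_def by (rule subfield_hull)
  note E' = subfield_subring[OF E]
  have RE: "?e f \<in> E" if "f \<in> R" for f using that hull_subset[of "?e ` R" is_subfield] by (auto simp: E_def)
  have diffE: "map_poly ?e (diff_poly f) \<in> poly_over E" if "?e f \<in> E" for f
    using that RE[OF const] subring_diff[OF E'] subring_0[OF E'] by (auto simp: poly_over_def coeff_diff_poly)
  have diff0: "poly (map_poly ?e (diff_poly f)) t = 0" for f
    unfolding t_def poly_map_poly_frac_emb by (simp add: poly_diff_poly)
  let ?G0 = "diff_poly a0"
  have G0: "degree ?G0 = degree a0" "lead_coeff ?G0 = [:lead_coeff a0:]" using degree_diff_poly[OF a0(2)] by auto
  have la0: "lead_coeff a0 \<noteq> 0" using a0 by auto
  have "?G0 \<noteq> 0" using G0 a0(2) by auto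
  then have "map_poly ?e ?G0 \<noteq> 0" using map_poly_frac_emb_eq_iff[of ?G0 0] by simp
  then have "alg_over E t" using alg_overI[OF diffE[OF RE[OF a0(1)]] _ diff0] by blast
  define n where "n = (LEAST n. \<exists>f\<in>poly_over E. f \<noteq> 0 \<and> poly f t = 0 \<and> degree f = n)"
  have "\<exists>n. \<exists>f\<in>poly_over E. f \<noteq> 0 \<and> poly f t = 0 \<and> degree f = n"
    using \<open>alg_over E t\<close> by (auto simp: alg_over_def)
  then have "\<exists>f\<in>poly_over E. f \<noteq> 0 \<and> poly f t = 0 \<and> degree f = n"
    unfolding n_def by (rule LeastI_ex)
  then obtain f where f: "f \<in> poly_over E" "f \<noteq> 0" "poly f t = 0" "degree f = n" by blast
  have min: "r = 0" if "r \<in> poly_over E" "poly r t = 0" "degree r < n" for r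
    using that not_less_Least[of "degree r" "\<lambda>n. \<exists>f\<in>poly_over E. f \<noteq> 0 \<and> poly f t = 0 \<and> degree f = n"]
    unfolding n_def[symmetric] by blast
  define h where "h = smult (inverse (lead_coeff f)) f"
  have h: "h \<in> poly_over E" "lead_coeff h = 1" "poly h t = 0" "degree h = n"
    using f by (auto simp: h_def intro!: poly_over_smult E' subfield_inverse[OF E] coeff_poly_over)
  have h0: "h \<noteq> 0" using h(2) by auto
  have n0: "n > 0" using h h0 by (metis degree_eq_zeroE gr_zeroI poly_const_conv pCons_0_0)
  have hdvd: "\<exists>Q. p = h * Q" if p: "p \<in> poly_over E" "poly p t = 0" for p
  proof -
    obtain Q r where Q: "r \<in> poly_over E" "p = Q * h + r" "r = 0 \<or> degree r < degree h"
      using poly_over_divide[OF E p(1) h(1) h0] by blast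
    have "poly r t = 0" using Q(2) p(2) h(3) by simp
    then have "r = 0" using min[OF Q(1)] Q(3) h(4) by auto
    then show ?thesis using Q(2) by (auto simp: mult.commute)
  qed
  obtain Q where Q: "map_poly ?e ?G0 = h * Q" using hdvd[OF diffE[OF RE[OF a0(1)]] diff0] by blast
  obtain H where H: "h = map_poly ?e H" using gauss_monic_factor[OF h(2) Q[symmetric] G0(2) la0] by blast
  have dH: "degree H = n" using h(4) H by simp
  have lH: "lead_coeff H = 1" using h(2) H by simp (metis frac_emb_simps(2,7))
  have H0: "H \<noteq> 0" using lH by auto
  define m where "m = Max ((\<lambda>i. degree (coeff H i)) ` {..n})"
  have m: "degree (coeff H i) \<le> m" for i
  proof (cases "i \<le> n")
    case True
    then show ?thesis unfolding m_def by (intro Max_ge) auto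
  next
    case False
    then show ?thesis using dH by (simp add: coeff_eq_0)
  qed
  have "m \<in> (\<lambda>i. degree (coeff H i)) ` {..n}" unfolding m_def by (rule Max_in) auto
  then obtain i0 where i0: "degree (coeff H i0) = m" by auto
  define q where "q = coeff H i0"
  have m0: "m > 0"
  proof (rule ccontr)
    assume "\<not> m > 0"
    then have c: "coeff H i = [:coeff (coeff H i) 0:]" for i using m[of i] by (metis degree_0_id le_zero_eq not_gr_zero)
    define h' where "h' = map_poly (\<lambda>p. coeff p 0) H"
    have "H = map_poly (\<lambda>c. [:c:]) h'" using c by (intro poly_eqI) (simp add: h'_def coeff_map_poly)
    then have "H - [:h':] = diff_poly h'" by (simp add: diff_poly_def)
    then have "poly H [:0, 1:] = h'" using poly_diff_poly[of h'] by (metis diff_eq_eq add_0 poly_diff poly_const_conv)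
    moreover have "?e (poly H [:0, 1:]) = 0" using h(3) H by (simp add: t_def poly_map_poly_frac_emb)
    ultimately have "h' = 0" by simp
    then have "coeff h' n = 0" by simp
    then show False using lH dH by (simp add: h'_def coeff_map_poly)
  qed
  have dq: "degree q = m" by (simp add: q_def i0)
  have qE: "?e q \<in> E" using coeff_poly_over[OF h(1), of i0] H by (simp add: q_def)
  have mn: "m = n"
  proof -
    let ?G = "diff_poly q"
    have dG: "degree ?G = m" using degree_diff_poly[of q] dq m0 by simp
    obtain Q where Q: "map_poly ?e ?G = h * Q" using hdvd[OF diffE[OF qE] diff0] by blast
    obtain N r where Nr: "?G = N * H + r" "r = 0 \<or> degree r < degree H"
      using poly_over_divide_monic[OF subring_UNIV _ lH, of ?G] by (auto simp: poly_over_UNIV)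
    have hr: "h * (Q - map_poly ?e N) = map_poly ?e r" using Q Nr(1) H by (simp add: algebra_simps)
    have "r = 0"
    proof (rule ccontr)
      assume r: "r \<noteq> 0"
      then have "map_poly ?e r \<noteq> 0" using map_poly_frac_emb_eq_iff[of r 0] by simp
      then have "Q - map_poly ?e N \<noteq> 0" using hr by auto
      then have "degree h \<le> degree (map_poly ?e r)" unfolding hr[symmetric] using h0 by (simp add: degree_mult_eq)
      then show False using r Nr(2) h(4) dH by simp
    qed
    then have G: "?G = H * N" using Nr by simp
    have N0: "N \<noteq> 0" using G dG m0 by auto
    define l where "l = Max ((\<lambda>i. degree (coeff N i)) ` {..degree N})"
    have l: "degree (coeff N i) \<le> l" for i
    proof (cases "i \<le> degree N")
      case True
      then show ?thesis unfolding l_def by (intro Max_ge) auto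
    qed (simp add: coeff_eq_0)
    have "l \<in> (\<lambda>i. degree (coeff N i)) ` {..degree N}" unfolding l_def by (rule Max_in) auto
    then obtain i1 where i1: "degree (coeff N i1) = l" "i1 \<le> degree N" by auto
    let ?tH = "map_poly (\<lambda>p. coeff p m) H" and ?tN = "map_poly (\<lambda>p. coeff p l) N"
    have tH: "?tH \<noteq> 0"
    proof
      assume "?tH = 0"
      then have "coeff ?tH i0 = 0" by simp
      then show False using i0 m0 by (auto simp: coeff_map_poly)
    qed
    have tN: "?tN \<noteq> 0"
    proof
      assume z: "?tN = 0"
      have "coeff (coeff N i) l = 0" for i using z by (metis coeff_0 coeff_map_poly)
      note nl = this
      have "lead_coeff (coeff N i1) = 0" using nl[of i1] i1(1) by metis
      then have "l = 0" using i1(1) by (metis degree_0 leading_coeff_0_iff)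
      then have "lead_coeff (lead_coeff N) = 0" using l[of "degree N"] nl[of "degree N"] by simp
      then show False using N0 by simp
    qed
    have top: "map_poly (\<lambda>p. coeff p (m + l)) ?G = ?tH * ?tN" unfolding G by (rule top_coeff_mult[OF m l])
    have l0: "l = 0"
    proof (rule ccontr)
      assume "l \<noteq> 0"
      then have "map_poly (\<lambda>p. coeff p (m + l)) ?G = 0"
        using dq by (intro poly_eqI) (auto simp: coeff_map_poly coeff_diff_poly coeff_eq_0 coeff_pCons split: nat.split)
      then show False using top tH tN by simp
    qed
    have "map_poly (\<lambda>p. coeff p m) ?G = [:- lead_coeff q:]"
      using dq m0 by (intro poly_eqI) (auto simp: coeff_map_poly coeff_diff_poly coeff_pCons split: nat.split)
    then have "?tH * ?tN = [:- lead_coeff q:]" using top l0 by simp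
    then have "degree (?tH * ?tN) = 0" by (simp only: degree_pCons_0)
    then have "degree ?tN = 0" using tH tN by (simp add: degree_mult_eq)
    then have tN0: "coeff ?tN i = 0" if "i > 0" for i using that by (simp add: coeff_eq_0)
    have "coeff N i = 0" if "i > 0" for i
    proof -
      have "degree (coeff N i) = 0" using l[of i] l0 by simp
      moreover have "coeff (coeff N i) 0 = 0" using tN0[OF that] l0 by (simp add: coeff_map_poly)
      ultimately have "lead_coeff (coeff N i) = 0" by metis
      then show ?thesis by simp
    qed
    then have "degree N \<le> 0" by (intro degree_le) auto
    then have "degree N = 0" by simp
    then have "degree ?G = degree H" unfolding G using H0 N0 by (simp add: degree_mult_eq)
    then show ?thesis using dG dH by simp
  qed
  have qP: "?e (pcompose P q) \<in> E" for P
  proof (induction P)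
    case 0
    then show ?case using subring_0[OF E'] by simp
  next
    case (pCons c P)
    then show ?case using subring_add[OF E' RE[OF const[of c]] subring_mult[OF E' qE]] by (simp add: pcompose_pCons)
  qed
  have "\<exists>P. g = pcompose P q" if g: "g \<in> R" for g
  proof -
    obtain \<rho> where \<rho>: "g = (\<Sum>i<n. Polynomial.monom 1 i * pcompose (\<rho> i) q)"
      using q_adic_expansion[of q g] dq m0 mn by auto
    define p where "p = (\<Sum>i<n. Polynomial.monom (?e (pcompose (\<rho> i) q)) i) - [:?e g:]"
    have "p \<in> poly_over E" unfolding p_def
      by (intro subring_diff subring_poly_over E' subring_sum poly_over_monom qP poly_over_const RE g)
    moreover have "poly p t = 0"
    proof -
      have "t ^ i = ?e (Polynomial.monom 1 i)" for i
        by (simp add: t_def monom_altdef flip: frac_emb_simps(8))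
      then have "poly p t = (\<Sum>i<n. ?e (Polynomial.monom 1 i * pcompose (\<rho> i) q)) - ?e g"
        by (simp add: p_def poly_sum poly_monom mult.commute)
      also have "(\<Sum>i<n. ?e (Polynomial.monom 1 i * pcompose (\<rho> i) q)) = ?e (\<Sum>i<n. Polynomial.monom 1 i * pcompose (\<rho> i) q)"
        by (rule hom_on_sum[OF subring_UNIV hom_frac_emb, symmetric]) simp
      finally show ?thesis using \<rho> by simp
    qed
    moreover have "degree p < n"
    proof -
      have "coeff p i = 0" if "i \<ge> n" for i
        using that n0 by (auto simp: p_def coeff_sum coeff_pCons split: nat.split)
      then show ?thesis using n0 by (metis degree_0 leI leading_coeff_0_iff)
    qed
    ultimately have "p = 0" by (rule min)
    then have "coeff p 0 = 0" by simp
    then have "?e (pcompose (\<rho> 0) q) = ?e g" using n0 by (simp add: p_def coeff_sum)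
    then show ?thesis by auto
  qed
  moreover obtain \<alpha> \<beta> where "\<alpha> \<in> R" "\<beta> \<in> R" "\<alpha> \<noteq> 0" "q * \<alpha> = \<beta>"
  proof -
    obtain a b where ab: "a \<in> ?e ` R" "b \<in> ?e ` R" "b \<noteq> 0" "?e q = a / b"
      using subfield_hull_fractions[OF eR] qE unfolding E_def by blast
    then obtain \<alpha> \<beta> where *: "\<alpha> \<in> R" "\<beta> \<in> R" "a = ?e \<beta>" "b = ?e \<alpha>" by auto
    then have "?e (q * \<alpha>) = ?e \<beta>" using ab by simp
    then have "q * \<alpha> = \<beta>" by (simp only: frac_emb_simps(7))
    then show ?thesis using that * ab by auto
  qed
  ultimately show ?thesis using that dq m0 by blast
qed

section \<open>Polynomial rings are completely integrally closed\<close>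

text \<open>The numerators and denominators of \<open>x\<close> that stay polynomial after multiplication by every power of
  \<open>x\<close> form a principal ideal which is stable under multiplication by \<open>x\<close>.\<close>

lemma eval_image_almost_integral:
  fixes L :: "'a::field set"
  assumes L: "is_subfield L" and t: "\<not> alg_over L t"
    and \<gamma>: "\<gamma> \<in> (\<lambda>p. poly p t) ` poly_over L" "\<gamma> \<noteq> 0"
    and x: "\<And>k. \<gamma> * x ^ k \<in> (\<lambda>p. poly p t) ` poly_over L"
  shows "x \<in> (\<lambda>p. poly p t) ` poly_over L"
proof -
  let ?S = "(\<lambda>p. poly p t) ` poly_over L"
  note L' = subfield_subring[OF L]
  note S = subring_eval_image[OF L', of t]
  define J where "J = {p\<in>poly_over L. \<forall>k. poly p t * x ^ k \<in> ?S}"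
  obtain g where g: "g \<in> poly_over L" "\<gamma> = poly g t" using \<gamma> by auto
  then have "g \<in> J" "g \<noteq> 0" using x \<gamma> by (auto simp: J_def)
  define n where "n = (LEAST n. \<exists>w\<in>J. w \<noteq> 0 \<and> degree w = n)"
  have "\<exists>n. \<exists>w\<in>J. w \<noteq> 0 \<and> degree w = n" using \<open>g \<in> J\<close> \<open>g \<noteq> 0\<close> by blast
  then have "\<exists>w\<in>J. w \<noteq> 0 \<and> degree w = n" unfolding n_def by (rule LeastI_ex)
  then obtain w where w: "w \<in> J" "w \<noteq> 0" "degree w = n" by blast
  have min: "n \<le> degree p" if "p \<in> J" "p \<noteq> 0" for p
    unfolding n_def using that by (intro Least_le) blast
  have wL: "w \<in> poly_over L" using w by (simp add: J_def)
  have "poly w t * x ^ 1 \<in> ?S" using w(1) unfolding J_def by blast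
  then obtain p where p: "p \<in> poly_over L" "poly w t * x = poly p t" by auto
  have "poly p t * x ^ k = poly w t * x ^ Suc k" for k by (simp add: p(2)[symmetric])
  then have pJ: "p \<in> J" using w p(1) by (simp add: J_def del: power_Suc)
  obtain Q R where QR: "Q \<in> poly_over L" "R \<in> poly_over L" "p = Q * w + R" "R = 0 \<or> degree R < degree w"
    using poly_over_divide[OF L p(1) wL w(2)] by blast
  have "poly R t * x ^ k \<in> ?S" for k
  proof -
    have "poly R t * x ^ k = poly p t * x ^ k - poly Q t * (poly w t * x ^ k)"
      by (simp add: QR(3) algebra_simps)
    also have "\<dots> \<in> ?S"
    proof (intro subring_diff[OF S] subring_mult[OF S, of "poly Q t"])
      show "poly p t * x ^ k \<in> ?S" "poly w t * x ^ k \<in> ?S" using pJ w(1) unfolding J_def by blast+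
      show "poly Q t \<in> ?S" using QR(1) by blast
    qed
    finally show ?thesis .
  qed
  then have "R \<in> J" using QR by (simp add: J_def)
  then have "R = 0" using min[of R] QR(4) w(3) by fastforce
  then have "poly w t * x = poly w t * poly Q t" using p QR(3) by (simp add: mult.commute)
  moreover have "poly w t \<noteq> 0" using t wL w(2) alg_overI by blast
  ultimately have "x = poly Q t" by simp
  then show ?thesis using QR by blast
qed

section \<open>Algebras of transcendence degree one inside a polynomial ring\<close>

lemma map_poly_derivation:
  fixes \<delta> :: "'l::idom \<Rightarrow> 'l"
  assumes \<delta>: "is_derivation \<delta>"
  shows "is_derivation (map_poly \<delta>)"
  unfolding is_derivation_def
proof (intro conjI allI)
  have c: "coeff (map_poly \<delta> p) i = \<delta> (coeff p i)" for p i by (simp add: coeff_map_poly derivation_0[OF \<delta>])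
  fix p q
  show "map_poly \<delta> (p + q) = map_poly \<delta> p + map_poly \<delta> q"
    by (rule poly_eqI) (simp add: c derivation_add[OF \<delta>])
  show "map_poly \<delta> (p * q) = map_poly \<delta> p * q + p * map_poly \<delta> q"
    by (rule poly_eqI) (simp add: c coeff_mult derivation_sum[OF \<delta>] derivation_mult[OF \<delta>] sum.distrib)
qed

lemma pderiv_derivation: "is_derivation (pderiv :: 'l::idom poly \<Rightarrow> _)"
  by (simp add: is_derivation_def pderiv_add pderiv_mult mult.commute)

lemma map_poly_derivation_pcompose:
  fixes \<delta> :: "'l::idom \<Rightarrow> 'l"
  assumes \<delta>: "is_derivation \<delta>"
  shows "map_poly \<delta> (pcompose P q) = pcompose (map_poly \<delta> P) q + pcompose (pderiv P) q * map_poly \<delta> q"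
proof (induction P)
  case 0
  then show ?case by simp
next
  case (pCons c P)
  note d = map_poly_derivation[OF \<delta>]
  have c: "map_poly \<delta> [:c:] = [:\<delta> c:]" using derivation_0[OF \<delta>] by (simp add: map_poly_pCons)
  show ?case
    by (simp add: pcompose_pCons derivation_add[OF d] derivation_mult[OF d] c pCons.IH map_poly_pCons
        derivation_0[OF \<delta>] pderiv_pCons pcompose_add algebra_simps)
qed

interpretation PV: vector_space "smult :: 'l::field \<Rightarrow> 'l poly \<Rightarrow> 'l poly"
  by unfold_locales (simp_all add: smult_add_right smult_add_left)

text \<open>Throughout, \<open>K\<close> is the common field of constants of a set of derivations of the field \<open>L\<close>,
  \<open>A\<close> is a non-constant \<open>K\<close>-algebra in \<open>L[t]\<close>, and the vanishing of the Jacobians says that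
  \<open>A\<close> has transcendence degree one over \<open>K\<close>.\<close>

locale curve_algebra =
  fixes \<D> :: "('l::field \<Rightarrow> 'l) set" and A :: "'l poly set"
  assumes der: "\<And>\<delta>. \<delta> \<in> \<D> \<Longrightarrow> is_derivation \<delta>"
    and char: "\<And>n. of_nat (Suc n) \<noteq> (0::'l)"
    and A_subring: "is_subring A"
    and A_const: "\<And>c. \<forall>\<delta>\<in>\<D>. \<delta> c = 0 \<Longrightarrow> [:c:] \<in> A"
    and A_jac: "\<And>\<delta> f g. \<delta> \<in> \<D> \<Longrightarrow> f \<in> A \<Longrightarrow> g \<in> A \<Longrightarrow> map_poly \<delta> f * pderiv g = map_poly \<delta> g * pderiv f"
    and A_nonconst: "\<exists>a\<in>A. degree a > 0"
begin

definition "K = {c. \<forall>\<delta>\<in>\<D>. \<delta> c = 0}"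

lemma K_subfield: "is_subfield K"
  unfolding K_def by (rule subfield_constants[OF der])

lemma A_smult: "c \<in> K \<Longrightarrow> f \<in> A \<Longrightarrow> smult c f \<in> A"
  using subring_mult[OF A_subring A_const[of c], of f] by (simp add: K_def)

lemma coeff_derivation: "\<delta> \<in> \<D> \<Longrightarrow> coeff (map_poly \<delta> p) i = \<delta> (coeff p i)"
  by (simp add: coeff_map_poly derivation_0[OF der])

lemma degree_derivation_le: "\<delta> \<in> \<D> \<Longrightarrow> degree (map_poly \<delta> p) \<le> degree p"
  by (rule degree_le) (auto simp: coeff_derivation coeff_eq_0 derivation_0[OF der])

lemma pderiv_nonzero: "degree (p :: 'l poly) > 0 \<Longrightarrow> pderiv p \<noteq> 0"
proof
  assume p: "degree p > 0" "pderiv p = 0"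
  obtain k where k: "degree p = Suc k" using p(1) by (cases "degree p") auto
  have "coeff (pderiv p) k = of_nat (Suc k) * lead_coeff p" unfolding k by (rule coeff_pderiv)
  moreover have "lead_coeff p \<noteq> 0" using k by (metis degree_0 leading_coeff_0_iff nat.distinct(1))
  ultimately show False using p(2) char[of k] by (auto simp del: of_nat_Suc)
qed

text \<open>Compare the leading coefficients in the Jacobian relation of two elements of equal degree: their quotient is
  killed by every derivation.\<close>

lemma lead_coeff_ratio:
  assumes f: "f \<in> A" and g: "g \<in> A" "g \<noteq> 0" and deg: "degree f = degree g"
  shows "lead_coeff f / lead_coeff g \<in> K"
proof -
  have dz: "\<delta> (lead_coeff f) * lead_coeff g = \<delta> (lead_coeff g) * lead_coeff f" if \<delta>: "\<delta> \<in> \<D>" for \<delta>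
  proof (cases "degree g = 0")
    case True
    obtain a where a: "a \<in> A" "degree a > 0" using A_nonconst by blast
    have "\<delta> (lead_coeff h) = 0" if h: "h \<in> A" "degree h = 0" for h
    proof -
      obtain c where c: "h = [:c:]" using h by (metis degree_eq_zeroE)
      have "map_poly \<delta> h * pderiv a = 0" using A_jac[OF \<delta> h(1) a(1)] c by (simp add: pderiv_pCons)
      then have "map_poly \<delta> h = 0" using pderiv_nonzero[OF a(2)] by simp
      then have "coeff (map_poly \<delta> h) 0 = 0" by simp
      then show ?thesis using h by (simp add: coeff_derivation[OF \<delta>])
    qed
    then show ?thesis using f g deg True by simp
  next
    case False
    then obtain k where k: "degree g = Suc k" by (cases "degree g") auto
    have t: "coeff (map_poly \<delta> p * pderiv q) (Suc k + k) = \<delta> (lead_coeff p) * (of_nat (Suc k) * lead_coeff q)"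
      if "degree p = Suc k" "degree q = Suc k" for p q
    proof -
      have "degree (map_poly \<delta> p) \<le> Suc k" using degree_derivation_le[OF \<delta>, of p] that by simp
      moreover have "degree (pderiv q) \<le> k" using degree_pderiv_less[of q] that by simp
      ultimately have "coeff (map_poly \<delta> p * pderiv q) (Suc k + k) = coeff (map_poly \<delta> p) (Suc k) * coeff (pderiv q) k"
        by (rule coeff_mult_top)
      then show ?thesis using that by (simp add: coeff_derivation[OF \<delta>] coeff_pderiv del: of_nat_Suc)
    qed
    have "of_nat (Suc k) * (\<delta> (lead_coeff f) * lead_coeff g) = of_nat (Suc k) * (\<delta> (lead_coeff g) * lead_coeff f)"
      using A_jac[OF \<delta> f g(1)] t[of f g] t[of g f] deg k by (simp add: algebra_simps del: of_nat_Suc)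
    then show ?thesis using char[of k] by (simp del: of_nat_Suc)
  qed
  have "\<delta> (lead_coeff f / lead_coeff g) = 0" if \<delta>: "\<delta> \<in> \<D>" for \<delta>
  proof -
    let ?c = "lead_coeff f / lead_coeff g"
    have lg: "lead_coeff g \<noteq> 0" using g by simp
    have "\<delta> (?c * lead_coeff g) = \<delta> ?c * lead_coeff g + ?c * \<delta> (lead_coeff g)" by (rule derivation_mult[OF der[OF \<delta>]])
    then have "\<delta> (lead_coeff f) = \<delta> ?c * lead_coeff g + ?c * \<delta> (lead_coeff g)" using lg by simp
    then have "\<delta> (lead_coeff f) * lead_coeff g = \<delta> ?c * lead_coeff g * lead_coeff g + ?c * \<delta> (lead_coeff g) * lead_coeff g"
      by (simp add: algebra_simps)
    then show ?thesis using dz[OF \<delta>] lg by simp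
  qed
  then show ?thesis by (simp add: K_def)
qed

lemma subtract_lead:
  assumes f: "f \<in> A" and g: "g \<in> A" "g \<noteq> 0" and deg: "degree f = degree g"
  obtains c where "c \<in> K" "f - smult c g \<in> A" "f - smult c g = 0 \<or> degree (f - smult c g) < degree g"
proof -
  define c where "c = lead_coeff f / lead_coeff g"
  have c: "c \<in> K" unfolding c_def by (rule lead_coeff_ratio[OF f g deg])
  have lg: "lead_coeff g \<noteq> 0" using g by simp
  have "f - smult c g \<in> A" by (intro subring_diff[OF A_subring] f A_smult c g)
  moreover have "f - smult c g = 0 \<or> degree (f - smult c g) < degree g"
  proof -
    have "degree (f - smult c g) \<le> degree g" using deg by (intro degree_diff_le) auto
    moreover have "coeff (f - smult c g) (degree g) = 0" using deg lg by (simp add: c_def)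
    ultimately show ?thesis by (metis le_neq_implies_less leading_coeff_0_iff)
  qed
  ultimately show ?thesis using that c by blast
qed

text \<open>Passing to the \<open>L\<close>-span of \<open>A\<close> creates no new degrees: the leading coefficients in each degree
  are proportional over \<open>K\<close>.\<close>

lemma span_degree_aux: "p \<in> PV.span {f\<in>A. degree f < m} \<Longrightarrow> p \<noteq> 0 \<Longrightarrow> \<exists>f\<in>A. f \<noteq> 0 \<and> degree f = degree p"
proof (induction m arbitrary: p)
  case 0
  then show ?case by simp
next
  case (Suc m)
  let ?S = "{f\<in>A. degree f < m}"
  have low: "PV.span ?S \<subseteq> {p. p = 0 \<or> degree p < m}"
  proof (rule PV.span_minimal)
    show "PV.subspace {p. p = 0 \<or> degree p < m}"
      unfolding PV.subspace_def by (auto simp: degree_add_less)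
  qed auto
  show ?case
  proof (cases "\<exists>g\<in>A. g \<noteq> 0 \<and> degree g = m")
    case True
    then obtain g where g: "g \<in> A" "g \<noteq> 0" "degree g = m" by blast
    have "{f\<in>A. degree f < Suc m} \<subseteq> PV.span (insert g ?S)"
    proof
      fix f assume f: "f \<in> {f\<in>A. degree f < Suc m}"
      show "f \<in> PV.span (insert g ?S)"
      proof (cases "degree f < m")
        case True
        then show ?thesis using f by (intro PV.span_base) auto
      next
        case False
        then have "f \<in> A" "degree f = degree g" using f g by auto
        then obtain c where c: "f - smult c g \<in> A" "f - smult c g = 0 \<or> degree (f - smult c g) < degree g"
          using subtract_lead[OF _ g(1,2)] by blast
        then have "f - smult c g \<in> PV.span ?S" using g by (cases "f - smult c g = 0") (auto intro: PV.span_base PV.span_zero)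
        then show ?thesis unfolding PV.span_breakdown_eq by blast
      qed
    qed
    then have "PV.span {f\<in>A. degree f < Suc m} \<subseteq> PV.span (insert g ?S)"
      by (intro PV.span_minimal PV.subspace_span)
    then obtain k where k: "p - smult k g \<in> PV.span ?S" using Suc.prems PV.span_breakdown_eq by blast
    show ?thesis
    proof (cases "k = 0")
      case True
      then show ?thesis using k Suc by simp
    next
      case False
      have "p = (p - smult k g) + smult k g" by simp
      moreover have "p - smult k g = 0 \<or> degree (p - smult k g) < degree (smult k g)" using low k False g by auto
      ultimately have "degree p = degree (smult k g)" by (metis add_0 degree_add_eq_right)
      then show ?thesis using g False by auto
    qed
  next
    case False
    then have "{f\<in>A. degree f < Suc m} \<subseteq> insert 0 ?S" by (auto simp: less_Suc_eq)
    then have "p \<in> PV.span (insert 0 ?S)" using Suc.prems PV.span_mono by blast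
    then show ?thesis using Suc by simp
  qed
qed

definition "LA = PV.span A"

lemma A_LA: "f \<in> A \<Longrightarrow> f \<in> LA"
  unfolding LA_def by (rule PV.span_base)

lemma LA_smult: "f \<in> LA \<Longrightarrow> smult c f \<in> LA"
  unfolding LA_def by (rule PV.span_scale)

lemma LA_add: "f \<in> LA \<Longrightarrow> g \<in> LA \<Longrightarrow> f + g \<in> LA"
  unfolding LA_def by (rule PV.span_add)

lemma LA_0: "0 \<in> LA"
  unfolding LA_def by (rule PV.span_zero)

lemma LA_induct [consumes 1, case_names zero step]:
  assumes "p \<in> LA" "Q 0" "\<And>c f p. f \<in> A \<Longrightarrow> p \<in> LA \<Longrightarrow> Q p \<Longrightarrow> Q (smult c f + p)"
  shows "Q p"
proof -
  have "p \<in> LA \<and> Q p" using assms(1) unfolding LA_def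
    by (induction rule: PV.span_induct_alt)
      (use assms in \<open>auto simp: LA_def intro: PV.span_zero PV.span_add PV.span_scale PV.span_base\<close>)
  then show ?thesis by blast
qed

lemma LA_degree:
  assumes "p \<in> LA" "p \<noteq> 0" shows "\<exists>f\<in>A. f \<noteq> 0 \<and> degree f = degree p"
proof -
  have "\<exists>m. p \<in> PV.span {f\<in>A. degree f < m}"
    using assms(1)
  proof (induction rule: LA_induct)
    case zero
    then show ?case using PV.span_zero by blast
  next
    case (step c f p)
    then obtain m where m: "p \<in> PV.span {f\<in>A. degree f < m}" by blast
    let ?m = "max m (Suc (degree f))"
    have "{f\<in>A. degree f < m} \<subseteq> {f\<in>A. degree f < ?m}" by auto
    then have "p \<in> PV.span {f\<in>A. degree f < ?m}" using m PV.span_mono by blast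
    moreover have "f \<in> PV.span {f\<in>A. degree f < ?m}" using step by (intro PV.span_base) auto
    ultimately show ?case using PV.span_add PV.span_scale by blast
  qed
  then show ?thesis using span_degree_aux assms(2) by blast
qed

lemma LA_mult:
  assumes "p \<in> LA" "q \<in> LA" shows "p * q \<in> LA"
  using assms(1)
proof (induction rule: LA_induct)
  case zero
  then show ?case by (simp add: LA_0)
next
  case (step c f p)
  have "f * q \<in> LA" using assms(2)
  proof (induction rule: LA_induct)
    case zero
    then show ?case by (simp add: LA_0)
  next
    case (step d g q)
    have "f * g \<in> LA" using \<open>f \<in> A\<close> step by (intro A_LA subring_mult[OF A_subring])
    then have "smult d (f * g) + f * q \<in> LA" using step by (intro LA_add LA_smult)
    then show ?case by (simp add: distrib_left)
  qed
  then have "smult c (f * q) + p * q \<in> LA" using step by (intro LA_add LA_smult)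
  then show ?case by (simp add: distrib_right)
qed

lemma LA_const: "[:c:] \<in> LA"
  using LA_smult[OF A_LA[OF subring_1[OF A_subring]], of c] by simp

lemma LA_subring: "is_subring LA"
proof -
  have "p - q \<in> LA" if "p \<in> LA" "q \<in> LA" for p q
    using LA_add[OF that(1) LA_smult[OF that(2), of "-1"]] by simp
  then show ?thesis using LA_mult A_LA[OF subring_1[OF A_subring]] by (auto simp: is_subring_def)
qed

text \<open>Change of variable: if \<open>A\<close> lies in \<open>L[q]\<close>, read its elements as polynomials in \<open>q\<close>.\<close>

lemma pull_curve_algebra:
  assumes q: "degree q > 0" and Aq: "\<And>f. f \<in> A \<Longrightarrow> \<exists>P. f = pcompose P q"
  shows "curve_algebra \<D> {P. pcompose P q \<in> A}"
proof
  show "is_subring {P. pcompose P q \<in> A}"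
    using A_subring by (auto simp: is_subring_def pcompose_diff pcompose_mult pcompose_1)
  show "[:c:] \<in> {P. pcompose P q \<in> A}" if "\<forall>\<delta>\<in>\<D>. \<delta> c = 0" for c using A_const[OF that] by simp
  show "\<exists>P\<in>{P. pcompose P q \<in> A}. degree P > 0"
  proof -
    obtain a where a: "a \<in> A" "degree a > 0" using A_nonconst by blast
    obtain P where P: "a = pcompose P q" using Aq[OF a(1)] by blast
    have "degree P > 0" using a(2) unfolding P degree_pcompose by simp
    then show ?thesis using a P by auto
  qed
  show "map_poly \<delta> P * pderiv Q = map_poly \<delta> Q * pderiv P"
    if \<delta>: "\<delta> \<in> \<D>" and PQ: "P \<in> {P. pcompose P q \<in> A}" "Q \<in> {P. pcompose P q \<in> A}" for \<delta> P Q
  proof -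
    let ?c = "\<lambda>P. pcompose P q"
    have "(?c (map_poly \<delta> P) + ?c (pderiv P) * map_poly \<delta> q) * (?c (pderiv Q) * pderiv q)
        = (?c (map_poly \<delta> Q) + ?c (pderiv Q) * map_poly \<delta> q) * (?c (pderiv P) * pderiv q)"
      using A_jac[OF \<delta>, of "?c P" "?c Q"] PQ
      by (simp add: map_poly_derivation_pcompose[OF der[OF \<delta>]] pderiv_pcompose)
    then have "pderiv q * (?c (map_poly \<delta> P) * ?c (pderiv Q)) = pderiv q * (?c (map_poly \<delta> Q) * ?c (pderiv P))"
      by (simp add: algebra_simps)
    then have "?c (map_poly \<delta> P * pderiv Q - map_poly \<delta> Q * pderiv P) = 0"
      using pderiv_nonzero[OF q] by (simp add: pcompose_diff pcompose_mult)
    then have "map_poly \<delta> P * pderiv Q - map_poly \<delta> Q * pderiv P = 0" using q by (rule pcompose_eq_0)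
    then show ?thesis by simp
  qed
qed (use der char in auto)

lemma pull_span:
  assumes q: "degree q > 0" and Aq: "\<And>f. f \<in> A \<Longrightarrow> \<exists>P. f = pcompose P q" and p: "p \<in> LA"
  shows "\<exists>P\<in>PV.span {P. pcompose P q \<in> A}. p = pcompose P q"
  using p
proof (induction rule: LA_induct)
  case zero
  then show ?case by (intro bexI[of _ 0]) (auto intro: PV.span_zero)
next
  case (step c f p)
  obtain F P where FP: "f = pcompose F q" "P \<in> PV.span {P. pcompose P q \<in> A}" "p = pcompose P q" using Aq step by blast
  then have "F \<in> PV.span {P. pcompose P q \<in> A}" using step(1) by (intro PV.span_base) simp
  then have "smult c F + P \<in> PV.span {P. pcompose P q \<in> A}" using FP by (intro PV.span_add PV.span_scale)
  then show ?case using FP by (intro bexI[of _ "smult c F + P"]) (auto simp: pcompose_add pcompose_smult)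
qed

end

text \<open>Iterated commutators with the multiplication by \<open>x\<close>. On the \<open>k\<close>-th power of a derivation the \<open>k\<close>-th
  commutator is the multiplication by \<open>k! (\<delta> x)\<^sup>k\<close>.\<close>

fun commut :: "'a::comm_ring_1 \<Rightarrow> ('a \<Rightarrow> 'a) \<Rightarrow> nat \<Rightarrow> 'a \<Rightarrow> 'a" where
  "commut x T 0 y = T y"
| "commut x T (Suc n) y = commut x T n (x * y) - x * commut x T n y"

lemma commut_derivation:
  fixes \<delta> :: "'a::comm_ring_1 \<Rightarrow> 'a"
  assumes \<delta>: "is_derivation \<delta>"
  shows "commut x (\<lambda>y. \<delta> (T y)) (Suc n) y = \<delta> (commut x T (Suc n) y) + of_nat (Suc n) * \<delta> x * commut x T n y"
proof (induction n arbitrary: y)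
  case 0
  then show ?case by (simp add: derivation_diff[OF \<delta>] derivation_mult[OF \<delta>])
next
  case (Suc n)
  have "commut x (\<lambda>y. \<delta> (T y)) (Suc (Suc n)) y
    = commut x (\<lambda>y. \<delta> (T y)) (Suc n) (x * y) - x * commut x (\<lambda>y. \<delta> (T y)) (Suc n) y" by simp
  also have "\<dots> = \<delta> (commut x T (Suc n) (x * y)) - x * \<delta> (commut x T (Suc n) y)
      + of_nat (Suc n) * \<delta> x * (commut x T n (x * y) - x * commut x T n y)"
    unfolding Suc by (simp add: algebra_simps del: commut.simps of_nat_Suc)
  also have "commut x T n (x * y) - x * commut x T n y = commut x T (Suc n) y" by simp
  also have "\<delta> (commut x T (Suc n) (x * y)) - x * \<delta> (commut x T (Suc n) y)
      = \<delta> (commut x T (Suc (Suc n)) y) + \<delta> x * commut x T (Suc n) y"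
    by (simp only: commut.simps(2)[of x T "Suc n"] derivation_diff[OF \<delta>] derivation_mult[OF \<delta>])
      (simp add: algebra_simps del: commut.simps)
  finally show ?case by (simp add: algebra_simps del: commut.simps)
qed

lemma commut_derivation_power:
  fixes \<delta> :: "'a::comm_ring_1 \<Rightarrow> 'a"
  assumes \<delta>: "is_derivation \<delta>"
  shows "commut x (\<delta> ^^ k) k y = of_nat (fact k) * \<delta> x ^ k * y \<and> (\<forall>n>k. commut x (\<delta> ^^ k) n y = 0)"
proof (induction k arbitrary: y)
  case 0
  have "commut x (\<lambda>y. y) (Suc n) y = 0" for n y by (induction n arbitrary: y) simp_all
  then have "commut x (\<lambda>y. y) n y = 0" if "n > 0" for n using that by (cases n) auto
  then show ?case by (simp add: id_def)
next
  case (Suc k)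
  have e: "\<delta> ^^ Suc k = (\<lambda>y. \<delta> ((\<delta> ^^ k) y))" by auto
  have c: "commut x (\<delta> ^^ Suc k) (Suc n) y = \<delta> (commut x (\<delta> ^^ k) (Suc n) y) + of_nat (Suc n) * \<delta> x * commut x (\<delta> ^^ k) n y" for n y
    unfolding e by (rule commut_derivation[OF \<delta>])
  have "commut x (\<delta> ^^ Suc k) (Suc k) y = of_nat (Suc k) * \<delta> x * (of_nat (fact k) * \<delta> x ^ k * y)"
    unfolding c using Suc by (simp add: derivation_0[OF \<delta>] del: commut.simps of_nat_Suc)
  also have "\<dots> = of_nat (fact (Suc k)) * \<delta> x ^ Suc k * y" by (simp add: algebra_simps)
  finally have 1: "commut x (\<delta> ^^ Suc k) (Suc k) y = of_nat (fact (Suc k)) * \<delta> x ^ Suc k * y" .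
  have 2: "commut x (\<delta> ^^ Suc k) n y = 0" if "n > Suc k" for n
  proof -
    obtain m where m: "n = Suc m" "m > k" using \<open>n > Suc k\<close> by (metis Suc_less_eq Suc_less_eq2)
    then show ?thesis unfolding m(1) c using Suc by (simp add: derivation_0[OF \<delta>] del: commut.simps of_nat_Suc)
  qed
  show ?case using 1 2 by blast
qed

lemma frac_emb_of_nat: "frac_emb (of_nat n) = of_nat n"
  by (induction n) simp_all

text \<open>The abstract statement about \<open>L[t]\<close> inside a field, applied to the field of rational functions.\<close>

lemma frac_poly_almost_integral:
  fixes r :: "'l::field poly fract"
  assumes \<gamma>: "\<gamma> \<noteq> 0" and r: "\<And>k. frac_emb \<gamma> * r ^ k \<in> range frac_emb"
  shows "r \<in> range frac_emb"
proof -
  let ?e = "frac_emb :: 'l poly \<Rightarrow> 'l poly fract"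
  define \<kappa> where "\<kappa> c = ?e [:c:]" for c
  have "?e [:1:] = 1" by (simp add: one_pCons[symmetric])
  then have \<kappa>: "is_ring_hom \<kappa>" by (simp add: is_ring_hom_def \<kappa>_def flip: frac_emb_simps(3,5))
  let ?L = "range \<kappa>" and ?t = "?e [:0, 1:]"
  have L: "is_subfield ?L" by (rule ring_hom_range_subfield[OF \<kappa>])
  have ev: "poly (map_poly \<kappa> P) ?t = ?e P" for P
  proof (induction P)
    case (pCons c P)
    have "poly (map_poly \<kappa> (pCons c P)) ?t = \<kappa> c + ?t * poly (map_poly \<kappa> P) ?t"
      by (simp add: map_poly_pCons ring_hom_0[OF \<kappa>])
    also have "\<dots> = ?e ([:c:] + [:0, 1:] * P)" unfolding pCons.IH by (simp only: \<kappa>_def frac_emb_simps)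
    also have "[:c:] + [:0, 1:] * P = pCons c P" by simp
    finally show ?case .
  qed (simp add: ring_hom_0[OF \<kappa>])
  define g where "g = inv_into UNIV \<kappa>"
  have g: "g (\<kappa> c) = c" for c by (simp add: g_def inv_f_f[OF ring_hom_inj[OF \<kappa>]])
  have g0: "g 0 = 0" using g[of 0] ring_hom_0[OF \<kappa>] by simp
  have lift: "p = map_poly \<kappa> (map_poly g p)" if p: "p \<in> poly_over ?L" for p
  proof (rule poly_eqI)
    fix i obtain c where "coeff p i = \<kappa> c" using coeff_poly_over[OF p, of i] by blast
    then show "coeff p i = coeff (map_poly \<kappa> (map_poly g p)) i"
      using g by (simp add: coeff_map_poly[of \<kappa>, OF ring_hom_0[OF \<kappa>]] coeff_map_poly[of g, OF g0])
  qed
  have S: "(\<lambda>p. poly p ?t) ` poly_over ?L = range ?e"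
  proof
    show "(\<lambda>p. poly p ?t) ` poly_over ?L \<subseteq> range ?e"
    proof clarify
      fix p assume "p \<in> poly_over ?L"
      then have "poly p ?t = ?e (map_poly g p)" using lift ev by metis
      then show "poly p ?t \<in> range ?e" by simp
    qed
    show "range ?e \<subseteq> (\<lambda>p. poly p ?t) ` poly_over ?L"
    proof clarify
      fix P :: "'l poly"
      have "map_poly \<kappa> P \<in> poly_over ?L" by (simp add: poly_over_def coeff_map_poly[of \<kappa>, OF ring_hom_0[OF \<kappa>]])
      then show "?e P \<in> (\<lambda>p. poly p ?t) ` poly_over ?L" using ev[of P] by (metis image_eqI)
    qed
  qed
  have "\<not> alg_over ?L ?t"
  proof
    assume "alg_over ?L ?t"
    then obtain p where p: "p \<in> poly_over ?L" "p \<noteq> 0" "poly p ?t = 0" by (auto simp: alg_over_def)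
    have "?e (map_poly g p) = 0" using ev[of "map_poly g p"] lift[OF p(1)] p(3) by simp
    then have "map_poly g p = 0" by simp
    then show False using lift[OF p(1)] p(2) by simp
  qed
  then show ?thesis
    using eval_image_almost_integral[OF L, of ?t "?e \<gamma>" r] \<gamma> r unfolding S by simp
qed

context curve_algebra
begin

lemma pcompose_LA: "a \<in> LA \<Longrightarrow> pcompose P a \<in> LA"
  by (induction P) (auto simp: pcompose_pCons intro: LA_0 LA_add LA_mult LA_const)

text \<open>Each derivation \<open>\<delta>\<close> of \<open>L\<close> extends to a derivation of \<open>L(t)\<close> that kills \<open>A\<close>. If \<open>t\<close> is a quotient of
  elements of the span of \<open>A\<close>, this extension preserves \<open>L[t]\<close>. Indeed it preserves the span of \<open>A\<close>, which
  contains a nonzero ideal \<open>\<gamma> L[t]\<close>; by the commutator identity \<open>\<gamma>\<close> times any power of \<open>\<delta> t\<close> is then a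
  polynomial.\<close>

lemma derivation_preserves_polynomials:
  assumes \<delta>: "\<delta> \<in> \<D>" and \<alpha>: "\<alpha> \<in> LA" "[:0, 1:] * \<alpha> \<in> LA" "\<alpha> \<noteq> 0"
  obtains \<rho> where "\<And>f. f \<in> A \<Longrightarrow> map_poly \<delta> f = - (\<rho> * pderiv f)"
proof -
  let ?e = "frac_emb :: 'l poly \<Rightarrow> 'l poly fract"
  obtain a where a: "a \<in> A" "degree a > 0" using A_nonconst by blast
  have a': "pderiv a \<noteq> 0" by (rule pderiv_nonzero[OF a(2)])
  define r where "r = - ?e (map_poly \<delta> a) / ?e (pderiv a)"
  \<comment> \<open>the extension of \<open>\<delta>\<close> with \<open>d t = r\<close>, where \<open>r\<close> is chosen such that \<open>d a = 0\<close>\<close>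
  define d where "d z = fder (map_poly \<delta>) z + r * fder pderiv z" for z
  note m = map_poly_derivation[OF der[OF \<delta>]]
  have d: "is_derivation d"
    unfolding is_derivation_def d_def
    by (simp add: derivation_add[OF fder_derivation[OF m]] derivation_mult[OF fder_derivation[OF m]]
      derivation_add[OF fder_derivation[OF pderiv_derivation]] derivation_mult[OF fder_derivation[OF pderiv_derivation]]
      algebra_simps)
  have de: "d (?e p) = ?e (map_poly \<delta> p) + r * ?e (pderiv p)" for p
    by (simp add: d_def fder_emb[OF m] fder_emb[OF pderiv_derivation])
  have dA: "d (?e f) = 0" if f: "f \<in> A" for f
  proof -
    have "?e (pderiv a) * d (?e f) = ?e (map_poly \<delta> f * pderiv a) - ?e (map_poly \<delta> a * pderiv f)"
      using a' by (simp add: de r_def algebra_simps)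
    also have "\<dots> = 0" using A_jac[OF \<delta> f a(1)] by simp
    finally show ?thesis using a' by simp
  qed
  define x where "x = ?e [:0, 1:]"
  have "map_poly \<delta> [:0, 1:] = 0"
    using derivation_0[OF der[OF \<delta>]] derivation_1[OF der[OF \<delta>]] by (simp add: map_poly_pCons)
  moreover have "pderiv [:0, 1 :: 'l:] = 1" by (simp add: pderiv_pCons one_pCons)
  ultimately have dx: "d x = r" by (simp add: x_def de)
  have dLA: "d z \<in> ?e ` LA" if z: "z \<in> ?e ` LA" for z
  proof -
    obtain p where p: "p \<in> LA" "z = ?e p" using z by blast
    have "\<exists>p'\<in>LA. d (?e p) = ?e p'" using p(1)
    proof (induction rule: LA_induct)
      case zero
      then show ?case by (intro bexI[of _ 0]) (simp_all add: derivation_0[OF d] LA_0)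
    next
      case (step c f p)
      then obtain p' where p': "p' \<in> LA" "d (?e p) = ?e p'" by blast
      have "?e (smult c f + p) = ?e [:c:] * ?e f + ?e p" by (simp flip: frac_emb_simps(5))
      then have "d (?e (smult c f + p)) = d (?e [:c:]) * ?e f + ?e [:c:] * d (?e f) + d (?e p)"
        by (simp only: derivation_add[OF d] derivation_mult[OF d])
      also have "d (?e [:c:]) = ?e [:\<delta> c:]"
        using derivation_0[OF der[OF \<delta>]] by (simp add: de map_poly_pCons pderiv_pCons)
      also have "?e [:\<delta> c:] * ?e f + ?e [:c:] * d (?e f) + d (?e p) = ?e (smult (\<delta> c) f + p')"
        using dA[OF step(1)] p'(2) by (simp flip: frac_emb_simps(5))
      finally show ?case using step p' by (intro bexI[of _ "smult (\<delta> c) f + p'"]) (auto intro: LA_add LA_smult A_LA)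
    qed
    then show ?thesis using p by auto
  qed
  have dkLA: "(d ^^ k) z \<in> ?e ` LA" if "z \<in> ?e ` LA" for k z
    using that by (induction k) (auto intro: dLA)
  have com: "commut x (d ^^ k) n y \<in> range ?e" if "\<And>i. y * x ^ i \<in> ?e ` LA" for k n y
    using that
  proof (induction n arbitrary: y)
    case 0
    then have "y \<in> ?e ` LA" using 0[of 0] by simp
    then have "(d ^^ k) y \<in> ?e ` LA" by (rule dkLA)
    then show ?case by auto
  next
    case (Suc n)
    have "x * y * x ^ i \<in> ?e ` LA" for i using Suc.prems[of "Suc i"] by (simp add: algebra_simps)
    then have "commut x (d ^^ k) n (x * y) \<in> range ?e" by (rule Suc.IH)
    moreover have "commut x (d ^^ k) n y \<in> range ?e" by (rule Suc.IH[OF Suc.prems])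
    ultimately obtain u v where "commut x (d ^^ k) n (x * y) = ?e u" "commut x (d ^^ k) n y = ?e v" by blast
    then have "commut x (d ^^ k) (Suc n) y = ?e (u - [:0, 1:] * v)" unfolding x_def by (simp only: commut.simps frac_emb_simps)
    then show ?case by (simp only: rangeI)
  qed
  \<comment> \<open>by the expansion in powers of \<open>a\<close>, the span of \<open>A\<close> and the powers of \<open>t\<close> below \<open>deg a\<close> generate all polynomials\<close>
  define \<gamma> where "\<gamma> = \<alpha> ^ degree a"
  have \<gamma>p: "\<gamma> * p \<in> LA" for p
  proof -
    obtain \<sigma> where p: "p = (\<Sum>i<degree a. Polynomial.monom 1 i * pcompose (\<sigma> i) a)"
      using q_adic_expansion[OF a(2)] by blast
    have "\<gamma> * (Polynomial.monom 1 i * pcompose (\<sigma> i) a) \<in> LA" if "i < degree a" for i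
    proof -
      have "\<gamma> = \<alpha> ^ (degree a - i) * \<alpha> ^ i" using that by (simp add: \<gamma>_def flip: power_add)
      moreover have "Polynomial.monom (1::'l) i = [:0, 1:] ^ i" by (simp add: monom_altdef)
      ultimately have "\<gamma> * (Polynomial.monom 1 i * pcompose (\<sigma> i) a) =
          \<alpha> ^ (degree a - i) * ([:0, 1:] * \<alpha>) ^ i * pcompose (\<sigma> i) a"
        by (simp only: power_mult_distrib mult.assoc mult.commute mult.left_commute)
      also have "\<dots> \<in> LA"
        by (intro LA_mult pcompose_LA A_LA a(1) subring_power[OF LA_subring] \<alpha>)
      finally show ?thesis .
    qed
    then show ?thesis unfolding p sum_distrib_left by (intro subring_sum[OF LA_subring]) auto
  qed
  have "?e \<gamma> * x ^ i \<in> ?e ` LA" for i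
  proof -
    have "?e \<gamma> * x ^ i = ?e (\<gamma> * [:0, 1:] ^ i)" by (simp add: x_def)
    then show ?thesis using \<gamma>p by blast
  qed
  then have c: "commut x (d ^^ k) k (?e \<gamma>) \<in> range ?e" for k by (rule com)
  have "?e \<gamma> * r ^ k \<in> range ?e" for k
  proof -
    obtain u where u: "of_nat (fact k) * r ^ k * ?e \<gamma> = ?e u"
      using c[of k] commut_derivation_power[OF d, of x k "?e \<gamma>"] dx by auto
    have f0: "of_nat (fact k) \<noteq> (0::'l)" using char[of "fact k - 1"] by (simp del: of_nat_fact of_nat_Suc)
    have "?e [:inverse (of_nat (fact k)):] * of_nat (fact k) = ?e ([:inverse (of_nat (fact k)):] * of_nat (fact k))"
      by (simp only: frac_emb_simps frac_emb_of_nat)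
    also have "[:inverse (of_nat (fact k)):] * of_nat (fact k) = (1::'l poly)"
      using f0 by (simp add: of_nat_poly one_pCons del: of_nat_fact)
    finally have i: "?e [:inverse (of_nat (fact k)):] * of_nat (fact k) = 1" by simp
    have "?e \<gamma> * r ^ k = (?e [:inverse (of_nat (fact k)):] * of_nat (fact k)) * (r ^ k * ?e \<gamma>)" by (simp add: i)
    also have "\<dots> = ?e ([:inverse (of_nat (fact k)):] * u)" unfolding frac_emb_simps(5) u[symmetric] by (simp only: mult.assoc)
    finally show ?thesis by blast
  qed
  moreover have "\<gamma> \<noteq> 0" using \<alpha> by (simp add: \<gamma>_def)
  ultimately obtain \<rho> where \<rho>: "r = ?e \<rho>" using frac_poly_almost_integral by blast
  have "map_poly \<delta> f = - (\<rho> * pderiv f)" if "f \<in> A" for f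
  proof -
    have "?e (map_poly \<delta> f + \<rho> * pderiv f) = 0" using dA[OF that] de[of f] \<rho> by simp
    then have "map_poly \<delta> f + \<rho> * pderiv f = 0" by (simp only: frac_emb_eq_0)
    then show ?thesis by (simp add: eq_neg_iff_add_eq_0)
  qed
  then show ?thesis using that by blast
qed

text \<open>Let \<open>\<rho>\<close> be the image of \<open>t\<close> under the extension of \<open>\<delta>\<close> that kills \<open>A\<close>. It has degree at most one, and
  the two leading coefficients of an element of \<open>A\<close> satisfy linear differential equations with the coefficients of
  \<open>\<rho>\<close>. Two elements of consecutive degrees therefore provide an affine change of the variable, the same for all
  \<open>\<delta>\<close>, after which the variable is killed; then all coefficients of \<open>A\<close> are constants.\<close>

lemma affine_variable:
  assumes \<alpha>: "\<alpha> \<in> LA" "[:0, 1:] * \<alpha> \<in> LA" "\<alpha> \<noteq> 0"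
  obtains \<mu> \<nu> where "\<nu> \<noteq> 0" "\<And>f. f \<in> A \<Longrightarrow> \<exists>P\<in>poly_over K. f = pcompose P [:\<mu>, \<nu>:]"
proof -
  have "\<exists>a\<in>A. \<exists>b\<in>A. \<exists>k. degree a = Suc k \<and> degree b = Suc (Suc k)"
  proof -
    obtain f where f: "f \<in> A" "f \<noteq> 0" "degree f = degree \<alpha>" using LA_degree[OF \<alpha>(1,3)] by blast
    \<comment> \<open>\<open>\<alpha>\<close> and \<open>t \<alpha>\<close> have consecutive degrees, which also occur in \<open>A\<close>; multiply by \<open>g\<close> to make both positive\<close>
    have X\<alpha>: "[:0, 1:] * \<alpha> \<noteq> 0" "degree ([:0, 1:] * \<alpha>) = Suc (degree \<alpha>)" using \<alpha>(3) by (auto simp: degree_mult_eq)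
    obtain g where g: "g \<in> A" "g \<noteq> 0" "degree g = Suc (degree \<alpha>)" using LA_degree[OF \<alpha>(2) X\<alpha>(1)] X\<alpha>(2) by auto
    have "degree (f * g) = Suc (2 * degree \<alpha>)" "degree (g * g) = Suc (Suc (2 * degree \<alpha>))"
      using f g by (simp_all add: degree_mult_eq)
    then show ?thesis using f g subring_mult[OF A_subring] by blast
  qed
  then obtain a b k where a: "a \<in> A" "degree a = Suc k" and b: "b \<in> A" "degree b = Suc (Suc k)" by blast
  define a1 where "a1 = coeff a (Suc k)"
  define b1 where "b1 = coeff b (Suc (Suc k))"
  define c where "c = coeff a k"
  have a1: "a1 \<noteq> 0" and b1: "b1 \<noteq> 0"
    using a(2) b(2) unfolding a1_def b1_def by (metis degree_0 leading_coeff_0_iff nat.distinct(1))+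
  let ?n = "of_nat (Suc k) :: 'l"
  define \<nu> where "\<nu> = b1 / a1"
  define \<mu> where "\<mu> = \<nu> * c / (?n * a1)"
  have \<nu>0: "\<nu> \<noteq> 0" using a1 b1 by (simp add: \<nu>_def)
  have e\<nu>: "\<nu> * a1 = b1" using a1 by (simp add: \<nu>_def)
  have e\<mu>: "?n * a1 * \<mu> = \<nu> * c" using a1 char[of k] by (simp add: \<mu>_def del: of_nat_Suc)
  have key: "map_poly \<delta> P = 0" if \<delta>: "\<delta> \<in> \<D>" and P: "pcompose P [:\<mu>, \<nu>:] \<in> A" for \<delta> P
  proof -
    note dr = der[OF \<delta>]
    obtain \<rho> where \<rho>: "\<And>f. f \<in> A \<Longrightarrow> map_poly \<delta> f = - (\<rho> * pderiv f)"
      using derivation_preserves_polynomials[OF \<delta> \<alpha>] by blast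
    have "degree \<rho> \<le> 1"
    proof (rule ccontr)
      assume "\<not> degree \<rho> \<le> 1"
      have "degree (pderiv a) \<le> k" using degree_pderiv_less[of a] a(2) by simp
      then have "coeff (\<rho> * pderiv a) (degree \<rho> + k) = lead_coeff \<rho> * (?n * a1)"
        using coeff_mult_top[of \<rho> "degree \<rho>" "pderiv a" k] by (simp add: coeff_pderiv a1_def del: of_nat_Suc)
      moreover have "coeff (map_poly \<delta> a) (degree \<rho> + k) = 0"
        using \<open>\<not> degree \<rho> \<le> 1\<close> a(2) by (simp add: coeff_derivation[OF \<delta>] coeff_eq_0 derivation_0[OF dr])
      ultimately have "lead_coeff \<rho> * (?n * a1) = 0" using \<rho>[OF a(1)] by simp
      then have "\<rho> = 0" using a1 char[of k] by (simp del: of_nat_Suc)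
      then show False using \<open>\<not> degree \<rho> \<le> 1\<close> by simp
    qed
    define r0 where "r0 = coeff \<rho> 0"
    define r1 where "r1 = coeff \<rho> 1"
    have \<rho>r: "\<rho> = [:r0, r1:]"
      using \<open>degree \<rho> \<le> 1\<close> by (intro poly_eqI) (auto simp: r0_def r1_def coeff_pCons coeff_eq_0 split: nat.split)
    have co: "\<delta> (coeff f i) = - (r0 * of_nat (Suc i) * coeff f (Suc i) + r1 * of_nat i * coeff f i)" if "f \<in> A" for f i
    proof -
      have "\<delta> (coeff f i) = - coeff (\<rho> * pderiv f) i"
        using \<rho>[OF that] coeff_derivation[OF \<delta>, of f i] by simp
      also have "coeff (\<rho> * pderiv f) i = r0 * of_nat (Suc i) * coeff f (Suc i) + r1 * of_nat i * coeff f i"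
        unfolding \<rho>r by (cases i) (simp_all add: coeff_pderiv coeff_pCons mult_pCons_left algebra_simps del: of_nat_Suc)
      finally show ?thesis .
    qed
    have da: "\<delta> a1 = - (r1 * ?n * a1)" using co[OF a(1), of "Suc k"] a(2) by (simp add: a1_def coeff_eq_0 del: of_nat_Suc)
    have db: "\<delta> b1 = - (r1 * of_nat (Suc (Suc k)) * b1)"
      using co[OF b(1), of "Suc (Suc k)"] b(2) by (simp add: b1_def coeff_eq_0 del: of_nat_Suc)
    have dc: "\<delta> c = - (r0 * ?n * a1 + r1 * of_nat k * c)" using co[OF a(1), of k] by (simp add: c_def a1_def del: of_nat_Suc)
    have "\<delta> \<nu> * a1 + \<nu> * \<delta> a1 = \<delta> b1" using derivation_mult[OF dr, of \<nu> a1] e\<nu> by simp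
    then have "\<delta> \<nu> * a1 + \<nu> * - (r1 * ?n * a1) = - (r1 * (?n + 1) * (\<nu> * a1))"
      unfolding da db e\<nu> by (simp only: of_nat_Suc add.commute)
    moreover have "x * z = - (r * y) * z" if "x * z + y * - (r * n * z) = - (r * (n + 1) * (y * z))" for x y z n r :: 'l
    proof -
      have "x * z = (x * z + y * - (r * n * z)) + y * (r * n * z)" by simp
      also have "\<dots> = - (r * (n + 1) * (y * z)) + y * (r * n * z)" unfolding that ..
      also have "\<dots> = - (r * y) * z" by (simp add: algebra_simps)
      finally show ?thesis .
    qed
    ultimately have "\<delta> \<nu> * a1 = - (r1 * \<nu>) * a1" by blast
    then have d\<nu>: "\<delta> \<nu> = - (r1 * \<nu>)" using mult_right_cancel[OF a1] by blast
    have "\<delta> (?n * a1 * \<mu>) = ?n * (\<delta> a1 * \<mu> + a1 * \<delta> \<mu>)"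
      using derivation_of_nat[OF dr, of "Suc k"] by (simp add: derivation_mult[OF dr] algebra_simps del: of_nat_Suc)
    then have "?n * (\<delta> a1 * \<mu> + a1 * \<delta> \<mu>) = \<delta> \<nu> * c + \<nu> * \<delta> c" unfolding e\<mu> derivation_mult[OF dr] by simp
    then have "?n * a1 * \<delta> \<mu> = \<delta> \<nu> * c + \<nu> * \<delta> c - ?n * (\<delta> a1 * \<mu>)" by (simp add: algebra_simps del: of_nat_Suc)
    also have "\<dots> = - (r1 * \<nu>) * c - \<nu> * (r0 * ?n * a1 + r1 * of_nat k * c) + r1 * ?n * (?n * a1 * \<mu>)"
      unfolding d\<nu> dc da by (simp add: algebra_simps del: of_nat_Suc)
    also have "\<dots> = ?n * a1 * - (\<nu> * r0)" unfolding e\<mu> by (simp add: algebra_simps)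
    finally have "?n * a1 * \<delta> \<mu> = ?n * a1 * - (\<nu> * r0)" .
    moreover have "?n * a1 \<noteq> 0" using a1 char[of k] by (simp del: of_nat_Suc)
    ultimately have d\<mu>: "\<delta> \<mu> = - (\<nu> * r0)" using mult_left_cancel by blast
    let ?lin = "[:\<mu>, \<nu>:]"
    have dl: "map_poly \<delta> ?lin = - smult \<nu> \<rho>"
      unfolding \<rho>r using derivation_0[OF dr] by (simp add: map_poly_pCons d\<mu> d\<nu>)
    have pl: "pderiv ?lin = [:\<nu>:]" by (simp add: pderiv_pCons)
    have "pcompose (map_poly \<delta> P) ?lin + pcompose (pderiv P) ?lin * map_poly \<delta> ?lin = - (\<rho> * (pcompose (pderiv P) ?lin * pderiv ?lin))"
      using \<rho>[OF P] map_poly_derivation_pcompose[OF dr, of P ?lin] by (simp add: pderiv_pcompose)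
    then have "pcompose (map_poly \<delta> P) ?lin + pcompose (pderiv P) ?lin * - smult \<nu> \<rho> =
        - (\<rho> * (pcompose (pderiv P) ?lin * [:\<nu>:]))" by (simp only: dl pl)
    moreover have "pcompose (pderiv P) ?lin * - smult \<nu> \<rho> = - (\<rho> * (pcompose (pderiv P) ?lin * [:\<nu>:]))"
      by (simp add: mult.commute)
    ultimately have "pcompose (map_poly \<delta> P) ?lin = 0" by (metis add_cancel_right_left)
    moreover have "degree ?lin > 0" using \<nu>0 by simp
    ultimately show ?thesis by (rule pcompose_eq_0)
  qed
  have "\<exists>P\<in>poly_over K. f = pcompose P [:\<mu>, \<nu>:]" if f: "f \<in> A" for f
  proof -
    define P where "P = pcompose f [:- \<mu> / \<nu>, 1 / \<nu>:]"
    have "pcompose [:- \<mu> / \<nu>, 1 / \<nu>:] [:\<mu>, \<nu>:] = [:0, 1:]" using \<nu>0 by (simp add: pcompose_pCons)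
    then have e: "f = pcompose P [:\<mu>, \<nu>:]"
      unfolding P_def pcompose_assoc[symmetric] by (simp only: pcompose_idR)
    have "\<delta> (coeff P i) = 0" if "\<delta> \<in> \<D>" for \<delta> i
      using key[OF that, of P] e f coeff_derivation[OF that, of P i] by simp
    then have "P \<in> poly_over K" by (simp add: poly_over_def K_def)
    then show ?thesis using e by blast
  qed
  then show ?thesis using that \<nu>0 by blast
qed

text \<open>If the coefficients of \<open>A\<close> are constants, a denominator of \<open>t\<close> of least degree in the span of \<open>A\<close> can be
  normalised to be monic. Differentiating its coefficients gives a denominator of smaller degree, so they are
  constants, and the elements of the span with constant coefficients are in \<open>A\<close>.\<close>

lemma constant_denominator:
  assumes AK: "A \<subseteq> poly_over K" and \<alpha>: "\<alpha> \<in> LA" "[:0, 1:] * \<alpha> \<in> LA" "\<alpha> \<noteq> 0"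
  shows "\<exists>a\<in>A. a \<noteq> 0 \<and> [:0, 1:] * a \<in> A"
proof -
  have dLA: "map_poly \<delta> p \<in> LA" if \<delta>: "\<delta> \<in> \<D>" and p: "p \<in> LA" for \<delta> p
    using p
  proof (induction rule: LA_induct)
    case zero
    then show ?case by (simp add: LA_0)
  next
    case (step c f p)
    note d = map_poly_derivation[OF der[OF \<delta>]]
    have "map_poly \<delta> f = 0"
      using AK step(1) \<delta> by (intro poly_eqI) (auto simp: coeff_derivation[OF \<delta>] poly_over_def K_def)
    then have "map_poly \<delta> ([:c:] * f) = smult (\<delta> c) f"
      using derivation_0[OF der[OF \<delta>]] by (simp only: derivation_mult[OF d]) (simp add: map_poly_pCons)
    then have "map_poly \<delta> (smult c f + p) = smult (\<delta> c) f + map_poly \<delta> p" by (simp add: derivation_add[OF d])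
    then show ?case using step by (auto intro: LA_add LA_smult A_LA)
  qed
  have LAK: "p \<in> A" if "p \<in> LA" "p \<in> poly_over K" for p
    using that
  proof (induction "degree p" arbitrary: p rule: less_induct)
    case less
    note K' = subfield_subring[OF K_subfield]
    show ?case
    proof (cases "p = 0")
      case True
      then show ?thesis using subring_0[OF A_subring] by simp
    next
      case False
      obtain f where f: "f \<in> A" "f \<noteq> 0" "degree f = degree p" using LA_degree less.prems(1) False by blast
      define c where "c = lead_coeff p / lead_coeff f"
      have c: "c \<in> K" unfolding c_def using f(1) AK less.prems(2)
        by (intro subfield_divide[OF K_subfield]) (auto intro: coeff_poly_over)
      have lf: "lead_coeff f \<noteq> 0" using leading_coeff_0_iff f(2) by blast
      define p' where "p' = p - smult c f"
      have cfA: "smult c f \<in> A" by (rule A_smult[OF c f(1)])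
      have p': "p' \<in> LA" "p' \<in> poly_over K" unfolding p'_def
        using subring_diff[OF LA_subring less.prems(1) A_LA[OF cfA]]
          subring_diff[OF subring_poly_over[OF K'] less.prems(2), of "smult c f"] cfA AK by blast+
      have "degree p' \<le> degree p" unfolding p'_def using f(3) by (intro degree_diff_le) auto
      moreover have "coeff p' (degree p) = 0" using f(3) lf by (simp add: p'_def c_def)
      ultimately have "p' = 0 \<or> degree p' < degree p" by (metis le_neq_implies_less leading_coeff_0_iff)
      then have "p' \<in> A" using less.hyps[OF _ p'] subring_0[OF A_subring] by auto
      then have "p' + smult c f \<in> A" using cfA by (rule subring_add[OF A_subring])
      then show ?thesis by (simp add: p'_def)
    qed
  qed
  define J where "J = {\<alpha>\<in>LA. [:0, 1:] * \<alpha> \<in> LA}"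
  define n where "n = (LEAST n. \<exists>w\<in>J. w \<noteq> 0 \<and> degree w = n)"
  have "\<exists>n. \<exists>w\<in>J. w \<noteq> 0 \<and> degree w = n" using \<alpha> by (auto simp: J_def)
  then have "\<exists>w\<in>J. w \<noteq> 0 \<and> degree w = n" unfolding n_def by (rule LeastI_ex)
  then obtain w where w: "w \<in> J" "w \<noteq> 0" "degree w = n" by blast
  have min: "n \<le> degree p" if "p \<in> J" "p \<noteq> 0" for p
    unfolding n_def using that by (intro Least_le) blast
  define v where "v = smult (inverse (lead_coeff w)) w"
  have "[:0, 1:] * v = smult (inverse (lead_coeff w)) ([:0, 1:] * w)" by (simp add: v_def)
  then have v: "v \<in> J" "v \<noteq> 0" "degree v = n" "lead_coeff v = 1"
    using w LA_smult[of w] LA_smult[of "[:0, 1:] * w"] by (auto simp: v_def J_def)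
  have "map_poly \<delta> v = 0" if \<delta>: "\<delta> \<in> \<D>" for \<delta>
  proof (rule ccontr)
    assume nz: "map_poly \<delta> v \<noteq> 0"
    note d = map_poly_derivation[OF der[OF \<delta>]]
    have "map_poly \<delta> [:0, 1:] = 0"
      using derivation_0[OF der[OF \<delta>]] derivation_1[OF der[OF \<delta>]] by (simp add: map_poly_pCons)
    then have "map_poly \<delta> ([:0, 1:] * v) = [:0, 1:] * map_poly \<delta> v" by (simp only: derivation_mult[OF d]) simp
    then have "map_poly \<delta> v \<in> J" using v(1) dLA[OF \<delta>, of v] dLA[OF \<delta>, of "[:0, 1:] * v"] by (auto simp: J_def)
    then have "n \<le> degree (map_poly \<delta> v)" using nz by (rule min)
    moreover have "degree (map_poly \<delta> v) \<le> n" using degree_derivation_le[OF \<delta>, of v] v by simp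
    moreover have "coeff (map_poly \<delta> v) n = 0" using v derivation_1[OF der[OF \<delta>]] by (simp add: coeff_derivation[OF \<delta>])
    ultimately show False using nz by (metis antisym leading_coeff_0_iff)
  qed
  then have dv: "\<delta> (coeff v i) = 0" if "\<delta> \<in> \<D>" for \<delta> i using that coeff_derivation[OF that, of v i] by simp
  then have vK: "v \<in> poly_over K" by (simp add: poly_over_def K_def)
  have XK: "[:0, 1:] * v \<in> poly_over K"
    using vK poly_over_pCons[of 0 K v] subring_0[OF subfield_subring[OF K_subfield]] by simp
  have "v \<in> A" "[:0, 1:] * v \<in> A" using LAK vK XK v(1) by (auto simp: J_def)
  then show ?thesis using v(2) by blast
qed

end

text \<open>Combining the steps: Lueroth's theorem for the span of \<open>A\<close> makes the variable a quotient of
  elements of the span, an affine change of variable makes the coefficients constant, and the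
  denominator can then be taken in \<open>A\<close>.\<close>

theorem (in curve_algebra) rational:
  obtains q \<alpha> \<beta> where "\<alpha> \<in> A" "\<beta> \<in> A" "\<alpha> \<noteq> 0" "q * \<alpha> = \<beta>" "degree q > 0"
    "\<And>f. f \<in> A \<Longrightarrow> \<exists>P\<in>poly_over K. f = pcompose P q"
proof -
  obtain a0 where a0: "a0 \<in> A" "degree a0 > 0" using A_nonconst by blast
  obtain q1 \<alpha> \<beta> where q1: "\<alpha> \<in> LA" "\<beta> \<in> LA" "\<alpha> \<noteq> 0" "q1 * \<alpha> = \<beta>" "degree q1 > 0"
    "\<And>f. f \<in> LA \<Longrightarrow> \<exists>P. f = pcompose P q1"
    by (rule lueroth_polynomial[OF LA_subring LA_const A_LA[OF a0(1)] a0(2)], rule that, assumption+)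
  have Aq1: "\<exists>P. f = pcompose P q1" if "f \<in> A" for f using q1(6) A_LA[OF that] by blast
  define A1 where "A1 = {P. pcompose P q1 \<in> A}"
  interpret C1: curve_algebra \<D> A1 unfolding A1_def by (rule pull_curve_algebra[OF q1(5) Aq1])
  obtain \<alpha>1 where \<alpha>1: "\<alpha>1 \<in> C1.LA" "\<alpha> = pcompose \<alpha>1 q1"
    using pull_span[OF q1(5) _ q1(1)] Aq1 unfolding C1.LA_def unfolding A1_def by blast
  obtain \<beta>1 where \<beta>1: "\<beta>1 \<in> C1.LA" "\<beta> = pcompose \<beta>1 q1"
    using pull_span[OF q1(5) _ q1(2)] Aq1 unfolding C1.LA_def unfolding A1_def by blast
  have "pcompose ([:0, 1:] * \<alpha>1 - \<beta>1) q1 = 0"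
    using q1(4) \<alpha>1 \<beta>1 by (simp add: pcompose_diff pcompose_mult pcompose_pCons)
  then have "[:0, 1:] * \<alpha>1 - \<beta>1 = 0" using q1(5) by (rule pcompose_eq_0)
  then have X\<alpha>1: "[:0, 1:] * \<alpha>1 \<in> C1.LA" using \<beta>1 by simp
  have \<alpha>10: "\<alpha>1 \<noteq> 0" using \<alpha>1 q1 by auto
  obtain \<mu> \<nu> where lin: "\<nu> \<noteq> 0" "\<And>f. f \<in> A1 \<Longrightarrow> \<exists>P\<in>poly_over K. f = pcompose P [:\<mu>, \<nu>:]"
    using C1.affine_variable[OF \<alpha>1(1) X\<alpha>1 \<alpha>10] unfolding C1.K_def K_def by blast
  let ?lin = "[:\<mu>, \<nu>:]"
  have dlin: "degree ?lin > 0" using lin by simp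
  have A1l: "\<exists>P. f = pcompose P ?lin" if "f \<in> A1" for f using lin(2)[OF that] by blast
  define A2 where "A2 = {P. pcompose P ?lin \<in> A1}"
  interpret C2: curve_algebra \<D> A2 unfolding A2_def by (rule C1.pull_curve_algebra[OF dlin A1l])
  have inj: "P = Q" if "pcompose P ?lin = pcompose Q ?lin" for P Q
  proof -
    have "pcompose (P - Q) ?lin = 0" using that by (simp add: pcompose_diff)
    then have "P - Q = 0" using dlin by (rule pcompose_eq_0)
    then show ?thesis by simp
  qed
  have A2K: "A2 \<subseteq> poly_over C2.K"
  proof
    fix P assume "P \<in> A2"
    then have "pcompose P ?lin \<in> A1" by (simp add: A2_def)
    then obtain P' where P': "P' \<in> poly_over K" "pcompose P ?lin = pcompose P' ?lin" using lin(2) by blast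
    have "C2.K = K" by (simp only: C2.K_def K_def)
    then show "P \<in> poly_over C2.K" using inj[OF P'(2)] P'(1) by simp
  qed
  obtain \<alpha>2 where \<alpha>2: "\<alpha>2 \<in> C2.LA" "\<alpha>1 = pcompose \<alpha>2 ?lin"
    using C1.pull_span[OF dlin _ \<alpha>1(1)] A1l unfolding C2.LA_def unfolding A2_def by blast
  have "?lin * \<alpha>1 = smult \<mu> \<alpha>1 + smult \<nu> ([:0, 1:] * \<alpha>1)" by simp
  then have "?lin * \<alpha>1 \<in> C1.LA"
    using C1.LA_add[OF C1.LA_smult[OF \<alpha>1(1), of \<mu>] C1.LA_smult[OF X\<alpha>1, of \<nu>]] by (simp only:)
  then obtain \<beta>2 where \<beta>2: "\<beta>2 \<in> C2.LA" "?lin * \<alpha>1 = pcompose \<beta>2 ?lin"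
    using C1.pull_span[OF dlin, of "?lin * \<alpha>1"] A1l unfolding C2.LA_def unfolding A2_def by blast
  have "pcompose ([:0, 1:] * \<alpha>2) ?lin = pcompose \<beta>2 ?lin"
    using \<alpha>2 \<beta>2 by (simp only: pcompose_mult) (simp add: pcompose_pCons)
  then have "[:0, 1:] * \<alpha>2 = \<beta>2" by (rule inj)
  then have X\<alpha>2: "[:0, 1:] * \<alpha>2 \<in> C2.LA" using \<beta>2(1) by (simp only:)
  have \<alpha>20: "\<alpha>2 \<noteq> 0" using \<alpha>2 \<alpha>10 by auto
  obtain a where a: "a \<in> A2" "a \<noteq> 0" "[:0, 1:] * a \<in> A2"
    using C2.constant_denominator[OF A2K \<alpha>2(1) X\<alpha>2 \<alpha>20] by blast
  define q where "q = pcompose ?lin q1"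
  have dq: "degree q > 0" using lin(1) q1(5) by (simp add: q_def degree_pcompose)
  have A2A: "pcompose P q \<in> A" if "P \<in> A2" for P
    using that by (simp add: q_def A2_def A1_def pcompose_assoc)
  show ?thesis
  proof (rule that[of "pcompose a q" "pcompose ([:0, 1:] * a) q" q])
    show "pcompose a q \<noteq> 0" using pcompose_eq_0[OF _ dq] a(2) by blast
    show "q * pcompose a q = pcompose ([:0, 1:] * a) q" by (simp only: pcompose_mult) (simp add: pcompose_pCons)
    fix f assume f: "f \<in> A"
    obtain P1 where P1: "f = pcompose P1 q1" using Aq1[OF f] by blast
    then have "P1 \<in> A1" using f by (simp add: A1_def)
    then obtain P where "P \<in> poly_over K" "P1 = pcompose P ?lin" using lin(2) by blast
    then show "\<exists>P\<in>poly_over K. f = pcompose P q" using P1 by (intro bexI[of _ P]) (simp_all add: q_def pcompose_assoc)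
  qed (use A2A a dq in auto)
qed

section \<open>Kernels of locally nilpotent derivations are generated by one element at a time\<close>

lemma pcompose_in_subring:
  fixes p q :: "'a::comm_ring_1 poly"
  assumes S: "is_subring S" and p: "\<And>i. [:coeff p i:] \<in> S" and q: "q \<in> S"
  shows "pcompose p q \<in> S"
  using p
proof (induction p)
  case (pCons a p)
  have "[:coeff p i:] \<in> S" for i using pCons.prems[of "Suc i"] by simp
  then have "pcompose p q \<in> S" by (rule pCons.IH)
  moreover have "[:a:] \<in> S" using pCons.prems[of 0] by simp
  ultimately show ?case using S q by (simp add: pcompose_pCons subring_add subring_mult)
qed (use S in \<open>simp add: subring_0\<close>)

text \<open>An algebraic relation between the values of two polynomials at a transcendental element is a
  relation between the polynomials themselves, and derivations extend uniquely to algebraic elements.\<close>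

lemma derivation_algebraic_evaluation:
  fixes K :: "'l::field set" and dd :: "'l poly \<Rightarrow> 'l poly"
  assumes dd: "is_derivation dd" and char: "\<And>n. of_nat (Suc n) \<noteq> (0::'l)"
    and K: "is_subfield K" "K \<subseteq> L" and L: "is_subfield L" "\<not> alg_over L t"
    and f: "f \<in> poly_over L" and g: "g \<in> poly_over L"
    and const: "\<And>c. c \<in> K \<Longrightarrow> dd [:c:] = 0" "dd g = 0"
    and alg: "alg_over (adjoin K {poly g t}) (poly f t)"
  shows "dd f = 0"
proof -
  note L' = subfield_subring[OF L(1)] and K' = subfield_subring[OF K(1)]
  let ?C = "(\<lambda>p. poly p (poly g t)) ` poly_over K"
  have C: "is_subring ?C" by (rule subring_eval_image[OF K'])
  have "adjoin K {poly g t} \<subseteq> is_subfield hull ?C"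
    using eval_image_base[OF K', of "poly g t"] eval_image_gen[OF K', of "poly g t"] hull_subset[of ?C is_subfield]
    by (intro adjoin_least subfield_hull) auto
  then have "alg_over ?C (poly f t)" using alg_over_hull[OF C] alg_over_mono[OF _ alg] by blast
  then obtain p where p: "p \<in> poly_over ?C" "p \<noteq> 0" "poly p (poly f t) = 0" unfolding alg_over_def by blast
  have "\<forall>i. \<exists>q. q \<in> poly_over K \<and> coeff p i = poly q (poly g t)" using coeff_poly_over[OF p(1)] by auto
  then obtain q where q: "\<And>i. q i \<in> poly_over K" "\<And>i. coeff p i = poly (q i) (poly g t)"
    by (metis choice)
  let ?n = "degree p"
  define R where "R = (\<Sum>i\<le>?n. pcompose (q i) g * f ^ i)"
  have qg: "pcompose (q i) g \<in> poly_over L" for i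
    using pcompose_poly_over[OF L' _ g] q(1) poly_over_mono[OF K(2)] by blast
  then have RL: "R \<in> poly_over L"
    unfolding R_def by (intro subring_sum subring_mult subring_power subring_poly_over L' f)
  have "poly R t = poly p (poly f t)"
    by (simp add: R_def poly_sum poly_pcompose poly_power q(2) poly_altdef[of p])
  then have R0: "R = 0" using RL p(3) L(2) alg_overI by fastforce
  define Q where "Q = (\<Sum>i\<le>?n. Polynomial.monom (pcompose (q i) g) i)"
  have cQ: "coeff Q i = (if i \<le> ?n then pcompose (q i) g else 0)" for i
    by (simp add: Q_def coeff_sum sum.delta)
  have "poly Q f = 0" using R0 by (simp add: Q_def R_def poly_sum poly_monom)
  moreover have "coeff Q ?n \<noteq> 0"
  proof
    assume "coeff Q ?n = 0"
    then have "poly (pcompose (q ?n) g) t = 0" by (simp add: cQ)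
    then show False using p(2) q(2)[of ?n] by (simp add: poly_pcompose)
  qed
  moreover define Z where "Z = {p. dd p = 0}"
  have Z: "is_subring Z"
    by (simp add: is_subring_def Z_def derivation_1[OF dd] derivation_diff[OF dd] derivation_mult[OF dd])
  have QZ: "coeff Q i \<in> Z" for i
  proof (cases "i \<le> ?n")
    case True
    have "pcompose (q i) g \<in> Z"
      using coeff_poly_over[OF q(1)] const by (intro pcompose_in_subring[OF Z]) (auto simp: Z_def)
    then show ?thesis using True by (simp add: cQ)
  qed (simp add: cQ subring_0[OF Z])
  let ?e = "frac_emb :: 'l poly \<Rightarrow> _"
  have eZ: "is_subring (?e ` Z)" by (rule hom_on_image_subring[OF Z hom_on_mono[OF _ hom_frac_emb]]) simp
  have "alg_over (?e ` Z) (?e f)"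
  proof (rule alg_overI)
    show "map_poly ?e Q \<in> poly_over (?e ` Z)" using QZ by (simp add: poly_over_def)
    show "map_poly ?e Q \<noteq> 0"
      using \<open>coeff Q ?n \<noteq> 0\<close> by (metis coeff_0 coeff_map_poly_frac_emb frac_emb_eq_0)
    show "poly (map_poly ?e Q) (?e f) = 0" using \<open>poly Q f = 0\<close> by (simp add: poly_map_poly_frac_emb)
  qed
  moreover have "of_nat (Suc n) \<noteq> (0 :: 'l poly fract)" for n
  proof -
    have "of_nat (Suc n) \<noteq> (0 :: 'l poly)" using char[of n] by (metis of_nat_poly pCons_eq_0_iff)
    then show ?thesis by (metis frac_emb_of_nat frac_emb_eq_0)
  qed
  moreover have "fder dd c = 0" if "c \<in> ?e ` Z" for c
    using that by (auto simp: fder_emb[OF dd] Z_def)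
  ultimately have "fder dd (?e f) = 0"
    using derivation_algebraic[OF fder_derivation[OF dd] _ eZ] by blast
  then show ?thesis by (simp add: fder_emb[OF dd])
qed

lemma jacobian_derivation:
  fixes \<delta> :: "'l::field \<Rightarrow> 'l"
  assumes "is_derivation \<delta>"
  shows "is_derivation (\<lambda>p. pderiv g * map_poly \<delta> p - map_poly \<delta> g * pderiv p)"
  using map_poly_derivation[OF assms] pderiv_derivation[where 'l='l]
  by (simp add: is_derivation_def algebra_simps)

text \<open>Multiplying an element that is algebraic over \<open>C\<close> by the leading coefficient of a relation makes
  it integral, and integral elements of the fraction field are almost integral.\<close>

lemma algebraic_almost_integral:
  fixes S :: "'a::field set"
  assumes S: "is_subring S" and C: "C \<subseteq> S" "is_subring C" and m: "alg_over C m"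
    and y: "y \<in> S" "y \<noteq> 0" "y * m \<in> S"
  obtains c \<gamma> where "c \<in> C" "c \<noteq> 0" "\<gamma> \<in> S" "\<gamma> \<noteq> 0" "\<And>k. \<gamma> * (c * m) ^ k \<in> S"
proof -
  obtain p where p: "p \<in> poly_over C" "p \<noteq> 0" "poly p m = 0" using m unfolding alg_over_def by blast
  define n where "n = degree p"
  define c where "c = coeff p n"
  define w where "w = c * m"
  have c: "c \<in> C" "c \<noteq> 0" using coeff_poly_over[OF p(1)] p(2) by (auto simp: c_def n_def)
  have pS: "coeff p i \<in> S" for i using coeff_poly_over[OF p(1)] C by blast
  have cS: "c \<in> S" using c C by blast
  have "n > 0"
  proof (rule ccontr)
    assume "\<not> n > 0"
    then obtain b where "p = [:b:]" using degree_eq_zeroE[of p] by (auto simp: n_def)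
    then show False using p(2,3) by simp
  qed
  have wn: "w ^ n = - (\<Sum>i<n. (coeff p i * c ^ (n - Suc i)) * w ^ i)"
  proof -
    have "0 = c ^ (n - 1) * (\<Sum>i\<le>n. coeff p i * m ^ i)" using p(3) by (simp add: poly_altdef n_def)
    also have "\<dots> = c ^ (n - 1) * (c * m ^ n) + c ^ (n - 1) * (\<Sum>i<n. coeff p i * m ^ i)"
      by (simp add: lessThan_Suc_atMost[symmetric] c_def algebra_simps)
    also have "c ^ (n - 1) * (c * m ^ n) = w ^ n"
      using power_minus_mult[OF \<open>n > 0\<close>, of c] by (simp add: w_def power_mult_distrib flip: mult.assoc)
    also have "c ^ (n - 1) * (\<Sum>i<n. coeff p i * m ^ i) = (\<Sum>i<n. (coeff p i * c ^ (n - Suc i)) * w ^ i)"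
      unfolding sum_distrib_left
    proof (rule sum.cong[OF refl])
      fix i assume i: "i \<in> {..<n}"
      then have "n - 1 = (n - Suc i) + i" by auto
      then show "c ^ (n - 1) * (coeff p i * m ^ i) = coeff p i * c ^ (n - Suc i) * w ^ i"
        by (simp add: w_def power_add power_mult_distrib mult_ac)
    qed
    finally show ?thesis by (simp add: eq_neg_iff_add_eq_0)
  qed
  have yw: "y * w \<in> S" using subring_mult[OF S cS y(3)] by (simp add: w_def mult_ac)
  have "y ^ n * w ^ k \<in> S" for k
  proof (induction k rule: less_induct)
    case (less k)
    show ?case
    proof (cases "k \<le> n")
      case True
      then have "y ^ n = y ^ (n - k) * y ^ k" by (simp flip: power_add)
      then have "y ^ n * w ^ k = y ^ (n - k) * (y * w) ^ k" by (simp add: power_mult_distrib mult_ac)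
      then show ?thesis using S y(1) yw by (simp add: subring_mult subring_power)
    next
      case False
      then have "w ^ k = w ^ n * w ^ (k - n)" by (simp flip: power_add)
      also have "y ^ n * \<dots> = - (\<Sum>i<n. (coeff p i * c ^ (n - Suc i)) * (y ^ n * w ^ (i + (k - n))))"
        by (simp add: wn sum_distrib_left sum_distrib_right power_add mult_ac sum_negf)
      also have "\<dots> \<in> S"
      proof (rule subring_uminus[OF S subring_sum[OF S]])
        fix i assume "i \<in> {..<n}"
        then have "i + (k - n) < k" using False by auto
        then show "coeff p i * c ^ (n - Suc i) * (y ^ n * w ^ (i + (k - n))) \<in> S"
          using less.IH pS cS by (simp add: subring_mult[OF S] subring_power[OF S])
      qed
      finally show ?thesis .
    qed
  qed
  then show ?thesis
    using that[of c "y ^ n"] c S y by (simp add: w_def subring_power)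
qed

text \<open>With a local slice \<open>t\<close> of \<open>D\<close>, every element of \<open>B\<close> is a polynomial in \<open>t\<close> over the field \<open>L\<close> of constants of
  \<open>D\<close>, and \<open>K_sub \<Delta> \<subseteq> L\<close>. The elements of \<open>M\<close> in \<open>L[t]\<close> form an algebra of transcendence degree one over
  \<open>K_sub \<Delta>\<close>, which is the common field of constants of the derivations in \<open>\<Delta>\<close>; so they are polynomials over it
  in one element \<open>u = q(t)\<close> of \<open>M\<close>. Any element of \<open>M\<close> becomes integral after multiplication by an element of this
  algebra, hence lies in \<open>L[t]\<close>, hence is in \<open>K_sub \<Delta> (u)\<close>.\<close>

theorem kernel_tower_step:
  fixes \<Delta> :: "('b::idom \<Rightarrow> 'b) set"
  assumes \<Delta>: "\<Delta> \<subseteq> LND" and char: "\<And>n. of_nat (Suc n) \<noteq> (0::'b)"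
    and M: "is_subfield M" "K_sub \<Delta> \<subseteq> M" and D: "D \<in> \<Delta>" "D a \<noteq> 0" "frac_emb a \<in> M"
    and dep: "\<And>m. m \<in> M \<Longrightarrow> alg_over (adjoin (K_sub \<Delta>) {frac_emb a}) m"
  obtains u where "M = adjoin (K_sub \<Delta>) {u}" "\<not> alg_over (K_sub \<Delta>) u"
proof -
  let ?K = "K_sub \<Delta>"
  have charF: "of_nat (Suc n) \<noteq> (0::'b fract)" for n using char[of n] by (metis frac_emb_of_nat frac_emb_eq_0)
  have DL: "D \<in> LND" using D \<Delta> by blast
  note Dd = LND_derivation[OF DL]
  define L where "L = {z. fder D z = 0}"
  have K: "is_subfield ?K" by (rule K_sub_subfield[OF \<Delta>])
  have KL: "?K \<subseteq> L" using D K_sub_eq[OF \<Delta>] by (auto simp: L_def)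
  have L: "is_subfield L"
    using subfield_constants[of "{fder D}"] fder_derivation[OF Dd] by (simp add: L_def)
  obtain r where r: "D r \<noteq> 0" "D (D r) = 0" using LND_local_slice[of D, OF DL D(2)] .
  define t where "t = frac_emb r"
  have t: "\<not> alg_over L t" unfolding L_def t_def by (rule slice_transcendental[OF Dd charF r(1)])
  note L' = subfield_subring[OF L] and K' = subfield_subring[OF K] and M' = subfield_subring[OF M(1)]
  define S where "S = (\<lambda>p. poly p t) ` poly_over L"
  have S: "is_subring S" unfolding S_def by (rule subring_eval_image[OF L'])
  have ES: "frac_emb x \<in> S" for x
    using slice_polynomial[OF DL char r, of x] unfolding S_def L_def t_def by blast
  define A where "A = {P \<in> poly_over L. poly P t \<in> M}"
  have evA: "\<exists>P\<in>A. x = poly P t" if "x \<in> S" "x \<in> M" for x using that unfolding S_def A_def by auto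
  obtain Pa where Pa: "Pa \<in> A" "frac_emb a = poly Pa t" using evA[OF ES D(3)] by blast
  have Pa_deg: "degree Pa > 0"
  proof (rule ccontr)
    assume "\<not> degree Pa > 0"
    then obtain b where b: "Pa = [:b:]" using degree_eq_zeroE[of Pa] by auto
    then have "frac_emb a \<in> L" using Pa coeff_poly_over[of Pa L 0] by (simp add: A_def)
    then show False using D(2) by (simp add: L_def fder_emb[OF Dd])
  qed
  have aK: "frac_emb a \<notin> ?K"
  proof
    assume "frac_emb a \<in> ?K"
    then have "fder D (frac_emb a) = 0" using D(1) unfolding K_sub_eq[OF \<Delta>] by blast
    then show False using D(2) by (simp add: fder_emb[OF Dd])
  qed
  interpret curve_algebra "fder ` \<Delta>" A
  proof
    fix \<delta> assume "\<delta> \<in> fder ` \<Delta>"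
    then show "is_derivation \<delta>" using fder_derivation LND_derivation \<Delta> by blast
  next
    show "of_nat (Suc n) \<noteq> (0::'b fract)" for n by (rule charF)
    show "is_subring A"
      using subring_poly_over[OF L'] M' by (auto simp: is_subring_def A_def)
    show "\<exists>a\<in>A. 0 < degree a" using Pa Pa_deg by blast
    fix c assume "\<forall>\<delta>\<in>fder ` \<Delta>. \<delta> c = 0"
    then have "c \<in> ?K" by (simp add: K_sub_eq[OF \<Delta>])
    then show "[:c:] \<in> A" using KL M(2) poly_over_const[OF L'] by (auto simp: A_def)
  next
    fix \<delta> f g assume \<delta>: "\<delta> \<in> fder ` \<Delta>" and f: "f \<in> A" and g: "g \<in> A"
    have \<delta>d: "is_derivation \<delta>" using \<delta> fder_derivation LND_derivation \<Delta> by blast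
    have \<delta>K: "\<delta> c = 0" if "c \<in> ?K" for c using that \<delta> by (auto simp: K_sub_eq[OF \<Delta>])
    have \<delta>0: "map_poly \<delta> [:c:] = 0" if "c \<in> ?K" for c
      by (rule poly_eqI) (simp add: coeff_map_poly derivation_0[OF \<delta>d] \<delta>K[OF that] coeff_pCons split: nat.splits)
    have fM: "poly f t \<in> M" "f \<in> poly_over L" and gM: "poly g t \<in> M" "g \<in> poly_over L" using f g by (auto simp: A_def)
    let ?dd = "\<lambda>p. pderiv g * map_poly \<delta> p - map_poly \<delta> g * pderiv p"
    show "map_poly \<delta> f * pderiv g = map_poly \<delta> g * pderiv f"
    proof (cases "alg_over ?K (poly g t)")
      case True
      then have gK: "poly g t \<in> ?K" by (rule K_sub_alg_closed[OF \<Delta> charF])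
      have "g - [:poly g t:] \<in> poly_over L"
        using gK KL gM(2) by (intro subring_diff[OF subring_poly_over[OF L']] poly_over_const[OF L']) auto
      then have "g - [:poly g t:] = 0" using t alg_overI[of "g - [:poly g t:]" L t] by force
      then have g: "g = [:poly g t:]" by simp
      have "map_poly \<delta> [:poly g t:] = 0" by (rule \<delta>0[OF gK])
      moreover have "pderiv [:poly g t:] = 0" by simp
      ultimately have "map_poly \<delta> g = 0" "pderiv g = 0" unfolding g[symmetric] by blast+
      then show ?thesis by (simp only: mult_zero_left mult_zero_right)
    next
      case False
      have "poly f t \<in> alg_cl ?K {frac_emb a}" "poly g t \<in> alg_cl ?K {frac_emb a}"
        using dep fM gM by (simp_all add: alg_cl_def)
      moreover have "frac_emb a \<in> alg_cl ?K {poly g t}"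
        using alg_over_exchange_single[OF K dep[OF gM(1)] False] by (simp add: alg_cl_def)
      ultimately have "poly f t \<in> alg_cl ?K {poly g t}" using alg_cl_least[of "{frac_emb a}" ?K "{poly g t}"] by blast
      then have "alg_over (adjoin ?K {poly g t}) (poly f t)" by (simp add: alg_cl_def)
      then have "?dd f = 0"
        by (rule derivation_algebraic_evaluation[OF jacobian_derivation[OF \<delta>d] charF K KL L t fM(2) gM(2), rotated 2])
          (simp_all add: \<delta>0 mult.commute)
      then show ?thesis by (simp add: mult.commute)
    qed
  qed
  have Keq: "curve_algebra.K (fder ` \<Delta>) = ?K" unfolding K_def K_sub_eq[OF \<Delta>] by simp
  obtain q \<alpha> \<beta> where q: "\<alpha> \<in> A" "\<beta> \<in> A" "\<alpha> \<noteq> 0" "q * \<alpha> = \<beta>" "degree q > 0"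
    "\<And>f. f \<in> A \<Longrightarrow> \<exists>P\<in>poly_over ?K. f = pcompose P q"
    using rational unfolding Keq by metis
  define u where "u = poly q t"
  have "poly \<alpha> t \<noteq> 0" using q(1,3) t alg_overI unfolding A_def by blast
  then have "u = poly \<beta> t / poly \<alpha> t" by (simp add: u_def q(4)[symmetric])
  then have uM: "u \<in> M" using q(1,2) subfield_divide[OF M(1)] by (simp add: A_def)
  have SM: "x \<in> adjoin ?K {u}" if x: "x \<in> S" "x \<in> M" for x
  proof -
    obtain P where P: "P \<in> A" "x = poly P t" using evA[OF x] by blast
    obtain P' where P': "P' \<in> poly_over ?K" "P = pcompose P' q" using q(6)[OF P(1)] by blast
    have "x = poly P' u" using P P' by (simp add: poly_pcompose u_def)
    then show ?thesis
      using P'(1) poly_over_mono[OF adjoin_base, of ?K "{u}"] adjoin_gen[of "{u}" ?K]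
      by (auto intro!: poly_poly_over[OF subfield_subring[OF adjoin_subfield]])
  qed
  have "M \<subseteq> adjoin ?K {u}"
  proof
    fix m assume m: "m \<in> M"
    let ?C = "(\<lambda>p. poly p (frac_emb a)) ` poly_over ?K"
    have C: "is_subring ?C" by (rule subring_eval_image[OF K'])
    have CM: "?C \<subseteq> M" using poly_over_mono[OF M(2)] poly_poly_over[OF M' _ D(3)] by blast
    have "L \<subseteq> S" unfolding S_def by (rule eval_image_base[OF L'])
    then have CS: "?C \<subseteq> S" using poly_over_mono[of ?K S] KL poly_poly_over[OF S _ ES] by blast
    have "adjoin ?K {frac_emb a} \<subseteq> is_subfield hull ?C"
      using eval_image_base[OF K', of "frac_emb a"] eval_image_gen[OF K', of "frac_emb a"] hull_subset[of ?C is_subfield]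
      by (intro adjoin_least subfield_hull) auto
    then have mC: "alg_over ?C m" using alg_over_hull[OF C] alg_over_mono[OF _ dep[OF m]] by blast
    obtain x y where xy: "y \<noteq> 0" "m = frac_emb x / frac_emb y" by (rule fract_cases)
    then have y: "frac_emb y \<in> S" "frac_emb y \<noteq> 0" "frac_emb y * m \<in> S" using ES by simp_all
    obtain c \<gamma> where c: "c \<in> ?C" "c \<noteq> 0" and \<gamma>: "\<gamma> \<in> S" "\<gamma> \<noteq> 0" "\<And>k. \<gamma> * (c * m) ^ k \<in> S"
      by (rule algebraic_almost_integral[OF S CS C mC y], rule that, assumption+)
    have "c * m \<in> S" using \<gamma> unfolding S_def by (rule eval_image_almost_integral[OF L t])
    moreover have "c * m \<in> M" using c CM m subring_mult[OF M'] by blast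
    ultimately have "c * m \<in> adjoin ?K {u}" by (rule SM)
    moreover have "c \<in> adjoin ?K {u}" using c CS CM SM by blast
    ultimately have "(c * m) / c \<in> adjoin ?K {u}" by (rule subfield_divide[OF adjoin_subfield])
    then show "m \<in> adjoin ?K {u}" using c by simp
  qed
  moreover have "adjoin ?K {u} \<subseteq> M" using uM M by (intro adjoin_least) auto
  ultimately have Mu: "M = adjoin ?K {u}" by blast
  moreover have "\<not> alg_over ?K u"
  proof
    assume "alg_over ?K u"
    then have "u \<in> ?K" by (rule K_sub_alg_closed[OF \<Delta> charF])
    then have "adjoin ?K {u} \<subseteq> ?K" using K by (intro adjoin_least) auto
    then show False using Mu D(3) aK by blast
  qed
  ultimately show ?thesis by (rule that)
qed

section \<open>Rational points of purely transcendental extensions\<close>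

text \<open>Every finitely generated \<open>k\<close>-subalgebra of \<open>E\<close> has a \<open>k\<close>-rational point.\<close>

definition has_points :: "'a::field set \<Rightarrow> 'a set \<Rightarrow> bool" where
  "has_points k E \<longleftrightarrow> (\<forall>G. finite G \<longrightarrow> G \<subseteq> E \<longrightarrow> (\<exists>\<sigma>. hom_on (is_subring hull (k \<union> G)) \<sigma> \<and>
     (\<forall>c\<in>k. \<sigma> c = c) \<and> \<sigma> ` (is_subring hull (k \<union> G)) \<subseteq> k))"

lemma has_points_self: "is_subfield k \<Longrightarrow> has_points k k"
  unfolding has_points_def
proof (intro allI impI exI[of _ id] conjI)
  fix G assume k: "is_subfield k" and "G \<subseteq> k"
  then have "is_subring hull (k \<union> G) \<subseteq> k" by (intro hull_minimal subfield_subring) auto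
  then show "id ` (is_subring hull (k \<union> G)) \<subseteq> k" by simp
qed (simp_all add: hom_on_def)

text \<open>Finitely many rational functions of \<open>u\<close> over \<open>E\<close> can be evaluated at all but finitely many
  elements of \<open>k\<close>.\<close>

lemma specialise_variable:
  fixes E :: "'a::field set"
  assumes E: "is_subfield E" and u: "\<not> alg_over E u" and k: "k \<subseteq> E" "infinite k"
    and G: "finite G" "G \<subseteq> adjoin E {u}"
  obtains R \<sigma> where "is_subring R" "E \<subseteq> R" "G \<subseteq> R" "hom_on R \<sigma>" "\<And>c. c \<in> E \<Longrightarrow> \<sigma> c = c" "\<sigma> ` R \<subseteq> E"
proof -
  note E' = subfield_subring[OF E]
  note PE = subring_poly_over[OF E']
  obtain q where q: "q \<in> poly_over E" "poly q u \<noteq> 0" "\<forall>g\<in>G. \<exists>p\<in>poly_over E. poly q u * g = poly p u"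
    using adjoin_common_denominator[OF E G] by blast
  have "q \<noteq> 0" using q(2) by auto
  then have "finite {c. poly q c = 0}" by (rule poly_roots_finite)
  then obtain c where c: "c \<in> k" "poly q c \<noteq> 0" using k(2) by (metis (mono_tags, lifting) finite_subset mem_Collect_eq subsetI)
  have cE: "c \<in> E" using c k by blast
  define W where "W x p s \<longleftrightarrow> p \<in> poly_over E \<and> s \<in> poly_over E \<and> poly s c \<noteq> 0 \<and> x * poly s u = poly p u" for x p s
  define R where "R = {x. \<exists>p s. W x p s}"
  define \<sigma> where "\<sigma> x = (SOME y. \<exists>p s. W x p s \<and> y = poly p c / poly s c)" for x
  have \<sigma>: "\<sigma> x = poly p c / poly s c" if x: "W x p s" for x p s
  proof -
    have "\<exists>p' s'. W x p' s' \<and> \<sigma> x = poly p' c / poly s' c"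
      unfolding \<sigma>_def by (rule someI_ex) (use x in blast)
    then obtain p' s' where p': "W x p' s'" "\<sigma> x = poly p' c / poly s' c" by blast
    have "p * s' - p' * s \<in> poly_over E"
      using x p' unfolding W_def by (intro subring_diff[OF PE] subring_mult[OF PE]) auto
    moreover have "poly p u = x * poly s u" "poly p' u = x * poly s' u" using x p' by (simp_all add: W_def)
    then have "poly (p * s' - p' * s) u = 0" by simp
    ultimately have "p * s' - p' * s = 0" using u alg_overI by blast
    then have "poly (p * s' - p' * s) c = 0" by simp
    then show ?thesis using x p' by (simp add: W_def frac_eq_eq)
  qed
  have W1: "W x [:x:] 1" if "x \<in> E" for x
    using that by (simp add: W_def poly_over_const[OF E'] subring_1[OF PE])
  have Wd: "W (x - y) (p * s' - p' * s) (s * s')" and Wa: "W (x + y) (p * s' + p' * s) (s * s')"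
    and Wm: "W (x * y) (p * p') (s * s')" if "W x p s" "W y p' s'" for x y p p' s s'
  proof -
    have [simp]: "poly p u = x * poly s u" "poly p' u = y * poly s' u" using that by (simp_all add: W_def)
    show "W (x - y) (p * s' - p' * s) (s * s')" "W (x + y) (p * s' + p' * s) (s * s')" "W (x * y) (p * p') (s * s')"
      using that PE unfolding W_def by (simp_all add: subring_diff subring_mult subring_add algebra_simps)
  qed
  show ?thesis
  proof (rule that[of R \<sigma>])
    show "is_subring R" unfolding is_subring_def R_def
      using W1[OF subring_1[OF E']] Wd Wm by (intro conjI ballI) blast+
    show "E \<subseteq> R" using W1 unfolding R_def by blast
    show "G \<subseteq> R"
    proof
      fix g assume "g \<in> G"
      then obtain p where "p \<in> poly_over E" "poly q u * g = poly p u" using q by blast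
      then have "W g p q" using q c by (simp add: W_def mult.commute)
      then show "g \<in> R" unfolding R_def by blast
    qed
    show \<sigma>1: "\<sigma> x = x" if "x \<in> E" for x using \<sigma>[OF W1[OF that]] by simp
    show "hom_on R \<sigma>" unfolding hom_on_def
    proof (intro conjI ballI)
      show "\<sigma> 1 = 1" using \<sigma>1 subring_1[OF E'] by blast
      fix x y assume "x \<in> R" "y \<in> R"
      then obtain p s p' s' where w: "W x p s" "W y p' s'" unfolding R_def by blast
      have nz: "poly s c \<noteq> 0" "poly s' c \<noteq> 0" using w by (simp_all add: W_def)
      show "\<sigma> (x + y) = \<sigma> x + \<sigma> y" "\<sigma> (x * y) = \<sigma> x * \<sigma> y"
        using nz by (simp_all add: \<sigma>[OF w(1)] \<sigma>[OF w(2)] \<sigma>[OF Wa[OF w]] \<sigma>[OF Wm[OF w]] add_frac_eq)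
    qed
    show "\<sigma> ` R \<subseteq> E"
    proof
      fix y assume "y \<in> \<sigma> ` R"
      then obtain x p s where x: "W x p s" "y = \<sigma> x" unfolding R_def by blast
      then show "y \<in> E"
        using cE by (simp add: \<sigma>[OF x(1)] W_def subfield_divide[OF E] poly_poly_over[OF E'])
    qed
  qed
qed

lemma has_points_adjoin:
  fixes E :: "'a::field set"
  assumes E: "is_subfield E" and u: "\<not> alg_over E u" and k: "k \<subseteq> E" "infinite k" and pts: "has_points k E"
  shows "has_points k (adjoin E {u})"
  unfolding has_points_def
proof (intro allI impI)
  fix G assume G: "finite G" "G \<subseteq> adjoin E {u}"
  obtain R \<sigma> where R: "is_subring R" "E \<subseteq> R" "G \<subseteq> R" "hom_on R \<sigma>" "\<And>c. c \<in> E \<Longrightarrow> \<sigma> c = c" "\<sigma> ` R \<subseteq> E"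
    by (rule specialise_variable[OF E u k G], rule that, assumption+)
  let ?H = "is_subring hull (k \<union> G)"
  have HR: "?H \<subseteq> R" using R k by (intro hull_minimal) auto
  have h: "hom_on ?H \<sigma>" by (rule hom_on_mono[OF HR R(4)])
  have \<sigma>k: "\<sigma> c = c" if "c \<in> k" for c using that R(5) k by blast
  have im: "\<sigma> ` ?H = is_subring hull (k \<union> \<sigma> ` G)" by (rule hom_image_hull[OF refl h \<sigma>k])
  have "finite (\<sigma> ` G)" "\<sigma> ` G \<subseteq> E" using G R(3,6) by auto
  then obtain \<tau> where \<tau>: "hom_on (is_subring hull (k \<union> \<sigma> ` G)) \<tau>" "\<forall>c\<in>k. \<tau> c = c"
      "\<tau> ` (is_subring hull (k \<union> \<sigma> ` G)) \<subseteq> k"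
    using pts unfolding has_points_def by blast
  have "hom_on ?H (\<tau> \<circ> \<sigma>)"
    using h \<tau>(1) unfolding im[symmetric] by (simp add: hom_on_def)
  moreover have "(\<tau> \<circ> \<sigma>) ` ?H \<subseteq> k" using \<tau>(3) unfolding im[symmetric] by (simp add: image_comp)
  ultimately show "\<exists>\<sigma>. hom_on ?H \<sigma> \<and> (\<forall>c\<in>k. \<sigma> c = c) \<and> \<sigma> ` ?H \<subseteq> k"
    using \<sigma>k \<tau>(2) by (intro exI[of _ "\<tau> \<circ> \<sigma>"]) simp
qed

section \<open>Exponentials of locally nilpotent derivations\<close>

text \<open>The image of \<open>x\<close> under \<open>exp (T D)\<close>, with the coefficients mapped by \<open>\<psi>\<close>.\<close>

definition exp_poly :: "('b::idom \<Rightarrow> 'b) \<Rightarrow> ('b \<Rightarrow> 'c::field) \<Rightarrow> 'b \<Rightarrow> 'c poly" where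
  "exp_poly D \<psi> x = (\<Sum>j | (D ^^ j) x \<noteq> 0. Polynomial.monom (\<psi> ((D ^^ j) x) / of_nat (fact j)) j)"

lemma is_ring_hom_hom_on: "is_ring_hom f \<longleftrightarrow> hom_on UNIV f"
  by (auto simp: is_ring_hom_def hom_on_def)

lemma LND_finite:
  assumes D: "D \<in> LND" shows "finite {j. (D ^^ j) x \<noteq> 0}"
proof -
  obtain n where "(D ^^ n) x = 0" using LND_nilpotent[OF D] by blast
  then have "{j. (D ^^ j) x \<noteq> 0} \<subseteq> {..<n}"
    using derivation_funpow_ge[OF LND_derivation[OF D]] by (auto simp: not_le[symmetric])
  then show ?thesis by (rule finite_subset) simp
qed

lemma coeff_exp_poly:
  assumes D: "D \<in> LND" and \<psi>: "hom_on UNIV \<psi>"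
  shows "coeff (exp_poly D \<psi> x) i = \<psi> ((D ^^ i) x) / of_nat (fact i)"
  using LND_finite[OF D, of x] hom_on_0[OF subring_UNIV \<psi>]
  by (simp add: exp_poly_def coeff_sum coeff_monom sum.delta)

text \<open>The Leibniz rule says that the divided powers \<open>D\<^sup>j / j!\<close> multiply like the coefficients of polynomials.\<close>

lemma exp_poly_hom:
  fixes \<psi> :: "'b::idom \<Rightarrow> 'c::field"
  assumes D: "D \<in> LND" and \<psi>: "hom_on UNIV \<psi>" and char: "\<And>n. of_nat (Suc n) \<noteq> (0::'c)"
  shows "hom_on UNIV (exp_poly D \<psi>)"
proof -
  note Dd = LND_derivation[OF D]
  note cf = coeff_exp_poly[OF D \<psi>]
  have fact0: "of_nat (fact n) \<noteq> (0::'c)" for n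
  proof -
    obtain k where "fact n = Suc k" using fact_gt_zero[where 'a=nat, of n] gr0_implies_Suc by blast
    then show ?thesis using char[of k] by metis
  qed
  have \<psi>n: "\<psi> (of_nat n) = of_nat n" for n
    using hom_on_0[OF subring_UNIV \<psi>] hom_on_1[OF \<psi>] hom_on_add[OF \<psi>] by (induction n) auto
  show ?thesis unfolding hom_on_def
  proof (intro conjI ballI)
    show "exp_poly D \<psi> 1 = 1"
    proof (rule poly_eqI)
      fix i show "coeff (exp_poly D \<psi> 1) i = coeff 1 i"
      proof (cases i)
        case (Suc j)
        have "(D ^^ i) 1 = 0" unfolding Suc funpow_Suc_right
          using derivation_1[OF Dd] derivation_funpow_0[OF Dd] by simp
        then show ?thesis using Suc hom_on_0[OF subring_UNIV \<psi>] by (simp add: cf)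
      qed (simp add: cf hom_on_1[OF \<psi>])
    qed
    fix x y :: 'b
    show "exp_poly D \<psi> (x + y) = exp_poly D \<psi> x + exp_poly D \<psi> y"
      by (rule poly_eqI) (simp add: cf derivation_funpow_add[OF Dd] hom_on_add[OF \<psi>] add_divide_distrib)
    show "exp_poly D \<psi> (x * y) = exp_poly D \<psi> x * exp_poly D \<psi> y"
    proof (rule poly_eqI)
      fix n
      have "coeff (exp_poly D \<psi> (x * y)) n =
          (\<Sum>i\<le>n. of_nat (n choose i) * (\<psi> ((D ^^ i) x) * \<psi> ((D ^^ (n - i)) y))) / of_nat (fact n)"
        unfolding cf leibniz[OF Dd]
        by (subst hom_on_sum[OF subring_UNIV \<psi>]) (simp_all add: hom_on_mult[OF \<psi>] \<psi>n)
      also have "\<dots> = (\<Sum>i\<le>n. \<psi> ((D ^^ i) x) / of_nat (fact i) * (\<psi> ((D ^^ (n - i)) y) / of_nat (fact (n - i))))"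
        unfolding sum_divide_distrib
      proof (rule sum.cong[OF refl])
        fix i assume "i \<in> {..n}"
        then have "fact i * fact (n - i) * (n choose i) = (fact n :: nat)" by (intro binomial_fact_lemma) simp
        then have "of_nat (fact i) * of_nat (fact (n - i)) * of_nat (n choose i) = (of_nat (fact n) :: 'c)"
          by (metis of_nat_mult)
        then have b: "of_nat (n choose i) / of_nat (fact n) = 1 / (of_nat (fact i) * of_nat (fact (n - i)) :: 'c)"
          using fact0[of n] fact0[of i] fact0[of "n - i"] by (simp add: frac_eq_eq mult.commute)
        have "of_nat (n choose i) * (\<psi> ((D ^^ i) x) * \<psi> ((D ^^ (n - i)) y)) / of_nat (fact n) =
            of_nat (n choose i) / of_nat (fact n) * (\<psi> ((D ^^ i) x) * \<psi> ((D ^^ (n - i)) y))" by simp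
        then show "of_nat (n choose i) * (\<psi> ((D ^^ i) x) * \<psi> ((D ^^ (n - i)) y)) / of_nat (fact n) =
            \<psi> ((D ^^ i) x) / of_nat (fact i) * (\<psi> ((D ^^ (n - i)) y) / of_nat (fact (n - i)))"
          unfolding b by simp
      qed
      finally show "coeff (exp_poly D \<psi> (x * y)) n = coeff (exp_poly D \<psi> x * exp_poly D \<psi> y) n"
        by (simp add: coeff_mult cf)
    qed
  qed
qed

lemma exp_poly_const:
  assumes D: "D \<in> LND" and \<psi>: "hom_on UNIV \<psi>" and x: "D x = 0"
  shows "exp_poly D \<psi> x = [:\<psi> x:]"
proof (rule poly_eqI)
  fix i show "coeff (exp_poly D \<psi> x) i = coeff [:\<psi> x:] i"
  proof (cases i)
    case (Suc j)
    have "(D ^^ i) x = 0" unfolding Suc funpow_Suc_right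
      using x derivation_funpow_0[OF LND_derivation[OF D]] by simp
    then show ?thesis using Suc hom_on_0[OF subring_UNIV \<psi>] by (simp add: coeff_exp_poly[OF D \<psi>])
  qed (simp add: coeff_exp_poly[OF D \<psi>])
qed

section \<open>Polynomials in several variables\<close>

lemma mpol_eval_superset:
  assumes "finite M" "Poly_Mapping.keys p \<subseteq> M"
  shows "mpol_eval x p = (\<Sum>m\<in>M. Poly_Mapping.lookup p m *
        (\<Prod>i\<in>Poly_Mapping.keys m. x i ^ Poly_Mapping.lookup m i))"
  unfolding mpol_eval_def by (rule sum.mono_neutral_left[OF assms]) (simp add: in_keys_iff)

lemma mpol_eval_add: "mpol_eval x (p + q) = mpol_eval x p + mpol_eval x q"
proof -
  let ?M = "Poly_Mapping.keys p \<union> Poly_Mapping.keys q"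
  have "Poly_Mapping.keys (p + q) \<subseteq> ?M" by (rule Poly_Mapping.keys_add)
  then show ?thesis
    by (simp add: mpol_eval_superset[of ?M] lookup_add distrib_right sum.distrib)
qed

lemma monomial_eval_add:
  fixes x :: "nat \<Rightarrow> 'a::comm_ring_1"
  shows "(\<Prod>i\<in>Poly_Mapping.keys (m + m'). x i ^ Poly_Mapping.lookup (m + m') i) =
    (\<Prod>i\<in>Poly_Mapping.keys m. x i ^ Poly_Mapping.lookup m i) * (\<Prod>i\<in>Poly_Mapping.keys m'. x i ^ Poly_Mapping.lookup m' i)"
proof -
  let ?I = "Poly_Mapping.keys m \<union> Poly_Mapping.keys m'"
  have *: "(\<Prod>i\<in>Poly_Mapping.keys k. x i ^ Poly_Mapping.lookup k i) = (\<Prod>i\<in>?I. x i ^ Poly_Mapping.lookup k i)"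
    if "Poly_Mapping.keys k \<subseteq> ?I" for k
    by (rule prod.mono_neutral_left) (use that in \<open>auto simp: in_keys_iff\<close>)
  have "Poly_Mapping.keys (m + m') \<subseteq> ?I" by (rule Poly_Mapping.keys_add)
  then have "(\<Prod>i\<in>Poly_Mapping.keys (m + m'). x i ^ Poly_Mapping.lookup (m + m') i) =
      (\<Prod>i\<in>?I. x i ^ Poly_Mapping.lookup (m + m') i)" by (rule *)
  also have "\<dots> = (\<Prod>i\<in>?I. x i ^ Poly_Mapping.lookup m i) * (\<Prod>i\<in>?I. x i ^ Poly_Mapping.lookup m' i)"
    by (simp add: lookup_add power_add prod.distrib)
  finally show ?thesis by (simp only: *[of m, OF Un_upper1] *[of m', OF Un_upper2])
qed

lemma mpol_eval_single:
  "mpol_eval x (Poly_Mapping.single m c) = c * (\<Prod>i\<in>Poly_Mapping.keys m. x i ^ Poly_Mapping.lookup m i)"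
  by (simp add: mpol_eval_def)

lemma mpol_eval_0: "mpol_eval x 0 = 0"
  by (simp add: mpol_eval_def)

lemma mpol_expand:
  fixes p :: "'a::comm_ring_1 mpol"
  shows "p = (\<Sum>m\<in>Poly_Mapping.keys p. Poly_Mapping.single m (Poly_Mapping.lookup p m))"
  by (rule poly_mapping_eqI) (simp add: lookup_sum lookup_single when_def in_keys_iff)

lemma mpol_induct [case_names zero single]:
  fixes p :: "'a::comm_ring_1 mpol"
  assumes "P 0" "\<And>m c p. P p \<Longrightarrow> P (Poly_Mapping.single m c + p)"
  shows "P p"
proof -
  have "finite S \<Longrightarrow> P (\<Sum>m\<in>S. Poly_Mapping.single m (Poly_Mapping.lookup p m))" for S
    by (induction S rule: finite_induct) (use assms in auto)
  then show ?thesis using mpol_expand[of p] by (metis finite_keys)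
qed

lemma mpol_eval_mult: "mpol_eval x (p * q) = mpol_eval x p * mpol_eval x q"
proof (induction p rule: mpol_induct)
  case (single m c p)
  have "mpol_eval x (Poly_Mapping.single m c * q) = mpol_eval x (Poly_Mapping.single m c) * mpol_eval x q"
    by (induction q rule: mpol_induct)
      (simp_all add: mpol_eval_0 distrib_left mpol_eval_add Poly_Mapping.mult_single mpol_eval_single monomial_eval_add mult_ac)
  then show ?case using single by (simp add: distrib_right mpol_eval_add)
qed (simp add: mpol_eval_0)

lemma mpol_ring_single:
  "is_subring K \<Longrightarrow> c \<in> K \<Longrightarrow> Poly_Mapping.keys m \<subseteq> {..<n} \<Longrightarrow> Poly_Mapping.single m c \<in> mpol_ring K n"
  by (auto simp: mpol_ring_def lookup_single when_def subring_0)

lemma mpol_ring_0: "is_subring K \<Longrightarrow> 0 \<in> mpol_ring K n"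
  by (simp add: mpol_ring_def subring_0)

lemma mpol_ring_add:
  assumes "is_subring K" "p \<in> mpol_ring K n" "q \<in> mpol_ring K n"
  shows "p + q \<in> mpol_ring K n"
  using assms Poly_Mapping.keys_add[of p q] by (fastforce simp: mpol_ring_def lookup_add subring_add)

lemma mpol_ring_sum:
  assumes "is_subring K" shows "(\<And>i. i \<in> I \<Longrightarrow> f i \<in> mpol_ring K n) \<Longrightarrow> sum f I \<in> mpol_ring K n"
  by (induction I rule: infinite_finite_induct) (simp_all add: mpol_ring_0 mpol_ring_add assms)

lemma mpol_ring_subring:
  assumes K: "is_subring K" shows "is_subring (mpol_ring K n)"
  unfolding is_subring_def
proof (intro conjI ballI)
  show "1 \<in> mpol_ring K n"
    using mpol_ring_single[OF K subring_1[OF K], of 0 n] by (simp add: Poly_Mapping.single_one)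
  fix p q assume p: "p \<in> mpol_ring K n" and q: "q \<in> mpol_ring K n"
  have "- q \<in> mpol_ring K n" using q by (simp add: mpol_ring_def subring_uminus[OF K])
  then have "p + - q \<in> mpol_ring K n" by (rule mpol_ring_add[OF K p])
  then show "p - q \<in> mpol_ring K n" by simp
  have "p * q = (\<Sum>m\<in>Poly_Mapping.keys p. Poly_Mapping.single m (Poly_Mapping.lookup p m)) *
      (\<Sum>m\<in>Poly_Mapping.keys q. Poly_Mapping.single m (Poly_Mapping.lookup q m))"
    by (simp only: mpol_expand[symmetric])
  also have "\<dots> = (\<Sum>m\<in>Poly_Mapping.keys p. \<Sum>m'\<in>Poly_Mapping.keys q.
      Poly_Mapping.single (m + m') (Poly_Mapping.lookup p m * Poly_Mapping.lookup q m'))"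
    by (simp add: sum_product Poly_Mapping.mult_single)
  also have "\<dots> \<in> mpol_ring K n"
  proof (intro mpol_ring_sum[OF K] mpol_ring_single[OF K])
    fix m m' assume m: "m \<in> Poly_Mapping.keys p" "m' \<in> Poly_Mapping.keys q"
    show "Poly_Mapping.lookup p m * Poly_Mapping.lookup q m' \<in> K"
      using p q by (simp add: mpol_ring_def subring_mult[OF K])
    have "Poly_Mapping.keys (m + m') \<subseteq> Poly_Mapping.keys m \<union> Poly_Mapping.keys m'" by (rule Poly_Mapping.keys_add)
    also have "\<dots> \<subseteq> {..<n}" using p q m unfolding mpol_ring_def by blast
    finally show "Poly_Mapping.keys (m + m') \<subseteq> {..<n}" .
  qed
  finally show "p * q \<in> mpol_ring K n" .
qed

lemma mpol_eval_sum: "mpol_eval x (sum f I) = (\<Sum>i\<in>I. mpol_eval x (f i))"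
  by (induction I rule: infinite_finite_induct) (simp_all add: mpol_eval_0 mpol_eval_add)

lemma mpol_eval_const: "mpol_eval x (mpol_const c) = c"
  by (simp add: mpol_const_def mpol_eval_single)

lemma mpol_const_ring: "is_subring K \<Longrightarrow> c \<in> K \<Longrightarrow> mpol_const c \<in> mpol_ring K n"
  by (simp add: mpol_const_def mpol_ring_single)

lemma mpol_eval_in_subring:
  assumes S: "is_subring S" and K: "K \<subseteq> S" "x ` {..<n} \<subseteq> S" and p: "p \<in> mpol_ring K n"
  shows "mpol_eval x p \<in> S"
  unfolding mpol_eval_def
proof (intro subring_sum[OF S] subring_mult[OF S] subring_prod[OF S] subring_power[OF S])
  fix m i assume "m \<in> Poly_Mapping.keys p" "i \<in> Poly_Mapping.keys m"
  then show "x i \<in> S" using p K(2) unfolding mpol_ring_def by blast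
qed (use p K in \<open>auto simp: mpol_ring_def\<close>)

lemma mpol_eval_image:
  assumes K: "is_subring K"
  shows "is_subring (mpol_eval x ` mpol_ring K n)" "K \<subseteq> mpol_eval x ` mpol_ring K n"
    "x ` {..<n} \<subseteq> mpol_eval x ` mpol_ring K n"
proof -
  note R = mpol_ring_subring[OF K, of n]
  have "hom_on (mpol_ring K n) (mpol_eval x)"
    using mpol_eval_const[of x 1] by (simp add: hom_on_def mpol_eval_add mpol_eval_mult mpol_const_def Poly_Mapping.single_one)
  then show "is_subring (mpol_eval x ` mpol_ring K n)" by (rule hom_on_image_subring[OF R])
  show "K \<subseteq> mpol_eval x ` mpol_ring K n"
    using mpol_eval_const mpol_const_ring[OF K] by (metis image_eqI subsetI)
  show "x ` {..<n} \<subseteq> mpol_eval x ` mpol_ring K n"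
  proof (rule image_subsetI)
    fix i assume i: "i \<in> {..<n}"
    let ?s = "Poly_Mapping.single (Poly_Mapping.single i 1) (1 :: 'a)"
    have "?s \<in> mpol_ring K n" using i by (intro mpol_ring_single[OF K] subring_1[OF K]) simp
    moreover have "mpol_eval x ?s = x i" by (simp add: mpol_eval_single)
    ultimately show "x i \<in> mpol_eval x ` mpol_ring K n" by (metis image_eqI)
  qed
qed

definition drop_var :: "nat \<Rightarrow> (nat \<Rightarrow>\<^sub>0 nat) \<Rightarrow> nat \<Rightarrow>\<^sub>0 nat" where
  "drop_var n m = m - Poly_Mapping.single n (Poly_Mapping.lookup m n)"

lemma drop_var_add: "drop_var n m + Poly_Mapping.single n (Poly_Mapping.lookup m n) = m"
  by (rule poly_mapping_eqI) (simp add: drop_var_def lookup_add lookup_minus lookup_single when_def)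

lemma keys_drop_var: "Poly_Mapping.keys m \<subseteq> {..<Suc n} \<Longrightarrow> Poly_Mapping.keys (drop_var n m) \<subseteq> {..<n}"
proof
  fix i assume m: "Poly_Mapping.keys m \<subseteq> {..<Suc n}" and i: "i \<in> Poly_Mapping.keys (drop_var n m)"
  have "Poly_Mapping.lookup (drop_var n m) i = (if i = n then 0 else Poly_Mapping.lookup m i)"
    by (simp add: drop_var_def lookup_minus lookup_single when_def)
  then have "i \<noteq> n" "i \<in> Poly_Mapping.keys m" using i by (auto simp: in_keys_iff split: if_splits)
  then show "i \<in> {..<n}" using m by auto
qed

text \<open>Collect a relation by powers of the last variable, which is transcendental over the field of the previous
  ones: its coefficients are relations in fewer variables.\<close>

lemma alg_indep_tower:
  fixes u :: "nat \<Rightarrow> 'a::field" and E :: "nat \<Rightarrow> 'a set"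
  assumes k: "is_subfield k"
  shows "(\<And>i. i < n \<Longrightarrow> is_subfield (E i)) \<Longrightarrow> (\<And>i. i < n \<Longrightarrow> k \<subseteq> E i) \<Longrightarrow> (\<And>i. i < n \<Longrightarrow> u ` {..<i} \<subseteq> E i) \<Longrightarrow>
    (\<And>i. i < n \<Longrightarrow> \<not> alg_over (E i) (u i)) \<Longrightarrow> alg_indep k n u"
proof (induction n)
  case 0
  show ?case unfolding alg_indep_def
  proof (intro ballI impI)
    fix p assume p: "p \<in> mpol_ring k 0" "mpol_eval u p = 0"
    have "m = 0" if "m \<in> Poly_Mapping.keys p" for m
    proof -
      have "Poly_Mapping.keys m = {}" using p(1) that unfolding mpol_ring_def by blast
      then show ?thesis by (simp only: keys_eq_empty)
    qed
    then have sub: "Poly_Mapping.keys p \<subseteq> {0}" by blast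
    then have "Poly_Mapping.lookup p 0 = 0" using p(2) by (simp add: mpol_eval_superset[of "{0}"])
    then have "0 \<notin> Poly_Mapping.keys p" by (simp add: in_keys_iff)
    then have "Poly_Mapping.keys p = {}" using sub by blast
    then show "p = 0" by (simp only: keys_eq_empty)
  qed
next
  case (Suc n)
  note k' = subfield_subring[OF k]
  have En: "is_subring (E n)" "k \<subseteq> E n" "u ` {..<n} \<subseteq> E n" using Suc.prems(1-3)[of n] subfield_subring by simp_all
  have IH: "alg_indep k n u" by (rule Suc.IH) (simp_all add: Suc.prems(1,2,4) Suc.prems(3)[OF less_SucI])
  show ?case unfolding alg_indep_def
  proof (intro ballI impI)
    fix p assume p: "p \<in> mpol_ring k (Suc n)" "mpol_eval u p = 0"
    define mon where "mon m = (\<Prod>i\<in>Poly_Mapping.keys m. u i ^ Poly_Mapping.lookup m i)" for m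
    let ?c = "Poly_Mapping.lookup p" and ?d = "\<lambda>m. Poly_Mapping.lookup m n" and ?M = "Poly_Mapping.keys p"
    have mon: "mon m = mon (drop_var n m) * u n ^ ?d m" for m
    proof -
      have "mon (drop_var n m + Poly_Mapping.single n (?d m)) = mon (drop_var n m) * mon (Poly_Mapping.single n (?d m))"
        unfolding mon_def by (rule monomial_eval_add)
      also have "mon (Poly_Mapping.single n (?d m)) = u n ^ ?d m" by (simp add: mon_def)
      finally show ?thesis by (simp only: drop_var_add)
    qed
    define Q where "Q = (\<Sum>m\<in>?M. Polynomial.monom (?c m * mon (drop_var n m)) (?d m))"
    define P where "P j = (\<Sum>m\<in>{m\<in>?M. ?d m = j}. Poly_Mapping.single (drop_var n m) (?c m))" for j
    have PR: "P j \<in> mpol_ring k n" for j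
      unfolding P_def using p(1) by (intro mpol_ring_sum[OF k'] mpol_ring_single[OF k'] keys_drop_var) (auto simp: mpol_ring_def)
    have cQ: "coeff Q j = mpol_eval u (P j)" for j
    proof -
      have "coeff Q j = (\<Sum>m\<in>?M. if ?d m = j then ?c m * mon (drop_var n m) else 0)"
        by (simp add: Q_def coeff_sum coeff_monom)
      also have "\<dots> = (\<Sum>m\<in>{m\<in>?M. ?d m = j}. ?c m * mon (drop_var n m))"
        by (simp add: sum.inter_filter)
      finally show ?thesis by (simp add: P_def mpol_eval_sum mpol_eval_single mon_def)
    qed
    have "Q \<in> poly_over (E n)"
      using mpol_eval_in_subring[OF En] PR by (simp add: poly_over_def cQ)
    moreover have "poly Q (u n) = 0"
    proof -
      have "poly Q (u n) = (\<Sum>m\<in>?M. ?c m * mon m)"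
        by (simp add: Q_def poly_sum poly_monom mon[symmetric] mult.assoc)
      then show ?thesis using p(2) by (simp add: mpol_eval_def mon_def)
    qed
    ultimately have "Q = 0" using Suc.prems(4)[of n] alg_overI by blast
    then have P0: "P j = 0" for j using IH PR cQ[of j] by (simp add: alg_indep_def)
    show "p = 0"
    proof (rule ccontr)
      assume "p \<noteq> 0"
      then obtain m0 where m0: "m0 \<in> ?M" by (metis all_not_in_conv keys_eq_empty)
      define I where "I = {m\<in>?M. ?d m = ?d m0}"
      have I: "finite I" "m0 \<in> I" using m0 by (simp_all add: I_def)
      have "Poly_Mapping.lookup (P (?d m0)) (drop_var n m0) =
          (\<Sum>m\<in>I. if drop_var n m = drop_var n m0 then ?c m else 0)"
        by (simp add: P_def lookup_sum lookup_single when_def I_def)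
      also have "\<dots> = (\<Sum>m\<in>I. if m = m0 then ?c m else 0)"
      proof (rule sum.cong[OF refl])
        fix m assume "m \<in> I"
        then have "?d m = ?d m0" by (simp add: I_def)
        then have "m = m0" if "drop_var n m = drop_var n m0" using that by (metis drop_var_add)
        then show "(if drop_var n m = drop_var n m0 then ?c m else 0) = (if m = m0 then ?c m else 0)" by auto
      qed
      also have "\<dots> = ?c m0" using I by simp
      finally show False using P0 m0 by (simp add: in_keys_iff)
    qed
  qed
qed

text \<open>Evaluation at independent elements is injective, so a homomorphism into its image lifts.\<close>

lemma mpol_lift:
  fixes \<psi> :: "'b::comm_ring_1 \<Rightarrow> 'a::field"
  assumes k: "is_subring k" and u: "alg_indep k n u" and \<psi>: "is_ring_hom \<psi>" "inj \<psi>"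
    and im: "range \<psi> \<subseteq> mpol_eval u ` mpol_ring k n"
  obtains \<Psi> where "is_ring_hom \<Psi>" "inj \<Psi>" "range \<Psi> \<subseteq> mpol_ring k n"
    "\<And>x. \<psi> x \<in> k \<Longrightarrow> \<Psi> x = mpol_const (\<psi> x)"
proof -
  note R = mpol_ring_subring[OF k, of n]
  have inj: "p = q" if "p \<in> mpol_ring k n" "q \<in> mpol_ring k n" "mpol_eval u p = mpol_eval u q" for p q
  proof -
    have "p - q \<in> mpol_ring k n" using that by (intro subring_diff[OF R])
    moreover have "mpol_eval u (p - q) = 0"
      using mpol_eval_add[of u "p - q" q] that(3) by simp
    ultimately have "p - q = 0" using u unfolding alg_indep_def by blast
    then show ?thesis by simp
  qed
  have "\<forall>x. \<exists>p. p \<in> mpol_ring k n \<and> mpol_eval u p = \<psi> x"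
  proof
    fix x show "\<exists>p. p \<in> mpol_ring k n \<and> mpol_eval u p = \<psi> x" using im by (metis image_iff rangeI subsetD)
  qed
  then obtain \<Psi> where \<Psi>: "\<And>x. \<Psi> x \<in> mpol_ring k n" "\<And>x. mpol_eval u (\<Psi> x) = \<psi> x" by metis
  have c: "\<Psi> x = mpol_const (\<psi> x)" if "\<psi> x \<in> k" for x
    by (rule inj) (simp_all add: \<Psi> mpol_eval_const mpol_const_ring[OF k that])
  show ?thesis
  proof (rule that[of \<Psi>])
    show "is_ring_hom \<Psi>" unfolding is_ring_hom_def
    proof (intro conjI allI)
      show "\<Psi> 1 = 1" using c[of 1] \<psi>(1) subring_1[OF k] by (simp add: is_ring_hom_def mpol_const_def Poly_Mapping.single_one)
      show "\<Psi> (x + y) = \<Psi> x + \<Psi> y" "\<Psi> (x * y) = \<Psi> x * \<Psi> y" for x y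
        using \<psi>(1) by (auto intro!: inj simp: \<Psi> mpol_eval_add mpol_eval_mult is_ring_hom_def subring_add[OF R] subring_mult[OF R])
    qed
    show "inj \<Psi>" by (rule injI) (metis \<Psi>(2) injD[OF \<psi>(2)])
  qed (use \<Psi> c in auto)
qed

section \<open>Embedding into a polynomial ring\<close>

lemma hom_on_poly:
  fixes \<psi> :: "'b::comm_ring_1 \<Rightarrow> 'c::comm_ring_1"
  assumes \<psi>: "hom_on UNIV \<psi>"
  shows "\<psi> (poly p x) = poly (map_poly \<psi> p) (\<psi> x)"
proof (induction p)
  case (pCons a p)
  have "map_poly \<psi> (pCons a p) = pCons (\<psi> a) (map_poly \<psi> p)"
    by (rule poly_eqI) (simp add: coeff_map_poly hom_on_0[OF subring_UNIV \<psi>] coeff_pCons split: nat.splits)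
  then show ?case using pCons by (simp add: hom_on_add[OF \<psi>] hom_on_mult[OF \<psi>])
qed (simp add: hom_on_0[OF subring_UNIV \<psi>])

text \<open>The homomorphism is \<open>P \<circ> exp (u\<^sub>0 D\<^sub>0) \<circ> \<dots> \<circ> exp (u\<^sub>m D\<^sub>m)\<close>, \<open>m = n - 1\<close>, for a rational point \<open>P\<close> of \<open>B\<close>. Since
  \<open>D\<^sub>j\<close> kills \<open>a\<^sub>i\<close> for \<open>j > i\<close>, the image of \<open>a\<^sub>i\<close> is a polynomial in \<open>u\<^sub>i\<close> over \<open>E\<^sub>i\<close>. It has positive degree if \<open>P\<close> does
  not vanish at \<open>e\<^sub>i\<close>, the last nonzero iterate of \<open>D\<^sub>i\<close> at \<open>a\<^sub>i\<close>. The images of the \<open>a\<^sub>i\<close> are then algebraically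
  independent, so no nonzero element of \<open>B\<close>, all of which are algebraic over the \<open>a\<^sub>i\<close>, is sent to zero.\<close>

lemma exp_point_embedding:
  fixes \<phi> :: "'k::field \<Rightarrow> 'b::idom" and E :: "nat \<Rightarrow> 'b fract set"
  assumes char: "\<And>n. of_nat (Suc n) \<noteq> (0::'b fract)"
    and \<phi>: "is_ring_hom \<phi>" and S: "finite S" "is_subring hull (range \<phi> \<union> S) = UNIV"
    and k: "is_subfield k" "infinite k" "\<And>c. frac_emb (\<phi> c) \<in> k"
    and E: "E 0 = k" "\<And>i. i < n \<Longrightarrow> E (Suc i) = adjoin (E i) {u i}" "E n = UNIV"
    and u: "\<And>i. i < n \<Longrightarrow> \<not> alg_over (E i) (u i)"
    and D: "\<And>i. i < n \<Longrightarrow> D i \<in> LND" "\<And>i c. i < n \<Longrightarrow> D i (\<phi> c) = 0"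
    and a: "\<And>i. i < n \<Longrightarrow> D i (a i) \<noteq> 0" "\<And>i j. i < j \<Longrightarrow> j < n \<Longrightarrow> D j (a i) = 0"
    and alg: "\<And>x. alg_over (adjoin (range (\<lambda>c. frac_emb (\<phi> c))) (frac_emb ` a ` {..<n})) (frac_emb x)"
  obtains \<psi> where "alg_indep k n u" "is_ring_hom \<psi>" "inj \<psi>" "range \<psi> \<subseteq> mpol_eval u ` mpol_ring k n"
    "\<And>c. \<psi> (\<phi> c) = frac_emb (\<phi> c)"
proof -
  note k' = subfield_subring[OF k(1)]
  have Ef: "is_subfield (E i)" if "i \<le> n" for i
    using that E(1,2) k(1) adjoin_subfield by (cases i) (auto simp: Suc_le_eq)
  have Emono: "E i \<subseteq> E j" if "i \<le> j" "j \<le> n" for i j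
    using that
  proof (induction j rule: dec_induct)
    case (step j)
    then have "E i \<subseteq> E j" by simp
    also have "\<dots> \<subseteq> E (Suc j)" using E(2)[of j] adjoin_base step by auto
    finally show ?case .
  qed simp
  have kE: "k \<subseteq> E i" if "i \<le> n" for i using Emono[of 0 i] E(1) that by simp
  have uE: "u i \<in> E (Suc i)" if "i < n" for i using E(2)[OF that] adjoin_gen by blast
  have indep: "alg_indep k n u"
  proof (rule alg_indep_tower[OF k(1)])
    fix i assume i: "i < n"
    show "is_subfield (E i)" "k \<subseteq> E i" "\<not> alg_over (E i) (u i)" using i Ef kE u by simp_all
    show "u ` {..<i} \<subseteq> E i"
    proof (rule image_subsetI)
      fix j assume "j \<in> {..<i}"
      then show "u j \<in> E i" using uE[of j] Emono[of "Suc j" i] i by auto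
    qed
  qed
  have pts: "has_points k (E i)" if "i \<le> n" for i
    using that
  proof (induction i)
    case 0 show ?case using has_points_self[OF k(1)] E(1) by simp
  next
    case (Suc i)
    then show ?case using has_points_adjoin[OF Ef u kE k(2), of i] E(2)[of i] by simp
  qed
  have "\<forall>i\<in>{..<n}. \<exists>d. (D i ^^ d) (a i) \<noteq> 0 \<and> (D i ^^ Suc d) (a i) = 0"
  proof
    fix i assume i: "i \<in> {..<n}"
    then have "a i \<noteq> 0" using a(1)[of i] derivation_0[OF LND_derivation[OF D(1)]] by auto
    then show "\<exists>d. (D i ^^ d) (a i) \<noteq> 0 \<and> (D i ^^ Suc d) (a i) = 0"
      using LND_last[OF D(1)] i by (metis lessThan_iff)
  qed
  then obtain d where d: "\<And>i. i < n \<Longrightarrow> (D i ^^ d i) (a i) \<noteq> 0" "\<And>i. i < n \<Longrightarrow> (D i ^^ Suc (d i)) (a i) = 0"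
    unfolding Ball_def by (metis lessThan_iff)
  define e where "e i = (D i ^^ d i) (a i)" for i
  have d0: "d i > 0" if "i < n" for i
  proof (rule ccontr)
    assume "\<not> d i > 0"
    then show False using d(2)[OF that] a(1)[OF that] by simp
  qed
  \<comment> \<open>the inverses force the point to avoid the zeros of all \<open>e i\<close>\<close>
  define G where "G = frac_emb ` S \<union> (\<lambda>i. inverse (frac_emb (e i))) ` {..<n}"
  have "finite G" using S by (simp add: G_def)
  then obtain \<sigma> where \<sigma>: "hom_on (is_subring hull (k \<union> G)) \<sigma>" "\<forall>c\<in>k. \<sigma> c = c"
      "\<sigma> ` (is_subring hull (k \<union> G)) \<subseteq> k"
    using pts[of n] E(3) unfolding has_points_def by auto
  define H where "H = is_subring hull (k \<union> G)"
  have H: "is_subring H" "k \<union> G \<subseteq> H" unfolding H_def by (rule subring_hull, rule hull_subset)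
  note \<sigma> = \<sigma>[folded H_def]
  have "UNIV \<subseteq> {x. frac_emb x \<in> H}"
    unfolding S(2)[symmetric]
  proof (rule hull_minimal)
    show "is_subring {x. frac_emb x \<in> H}" using H(1) by (simp add: is_subring_def)
    show "range \<phi> \<union> S \<subseteq> {x. frac_emb x \<in> H}" using H(2) k(3) by (auto simp: G_def)
  qed
  then have xH: "frac_emb x \<in> H" for x by blast
  define P where "P x = \<sigma> (frac_emb x)" for x
  have P: "hom_on UNIV P" using hom_on_add[OF \<sigma>(1)] hom_on_mult[OF \<sigma>(1)] hom_on_1[OF \<sigma>(1)] xH
    by (simp add: hom_on_def P_def)
  have Pk: "P x \<in> k" for x using \<sigma>(3) xH by (auto simp: P_def)
  have Pe: "P (e i) \<noteq> 0" if i: "i < n" for i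
  proof
    assume "P (e i) = 0"
    moreover have "inverse (frac_emb (e i)) \<in> H" using H(2) i by (auto simp: G_def)
    then have "\<sigma> (frac_emb (e i) * inverse (frac_emb (e i))) = P (e i) * \<sigma> (inverse (frac_emb (e i)))"
      using hom_on_mult[OF \<sigma>(1) xH] by (simp add: P_def)
    moreover have "frac_emb (e i) \<noteq> 0" using d(1)[OF i] by (simp add: e_def)
    ultimately show False using hom_on_1[OF \<sigma>(1)] by simp
  qed
  define \<psi> where "\<psi> = rec_nat P (\<lambda>i f x. poly (exp_poly (D i) f x) (u i))"
  have \<psi>0: "\<psi> 0 = P" and \<psi>S: "\<psi> (Suc i) x = poly (exp_poly (D i) (\<psi> i) x) (u i)" for i x
    by (simp_all add: \<psi>_def)
  have \<psi>: "hom_on UNIV (\<psi> i)" if "i \<le> n" for i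
    using that
  proof (induction i)
    case (Suc i)
    then have "hom_on UNIV (exp_poly (D i) (\<psi> i))" using exp_poly_hom[OF D(1) _ char] by simp
    then show ?case by (simp add: hom_on_def \<psi>S)
  qed (simp add: \<psi>0 P)
  have \<psi>c: "\<psi> (Suc i) x = \<psi> i x" if "i < n" "D i x = 0" for i x
    using exp_poly_const[OF D(1) \<psi>, of i i x] that by (simp add: \<psi>S)
  have \<psi>\<phi>: "\<psi> i (\<phi> c) = frac_emb (\<phi> c)" if "i \<le> n" for i c
    using that
  proof (induction i)
    case 0 show ?case using \<sigma>(2) k(3) by (simp add: \<psi>0 P_def)
  qed (simp add: \<psi>c D(2))
  have coeffs: "exp_poly (D i) (\<psi> i) x \<in> poly_over W"
    if i: "i < n" and W: "is_subring W" "k \<subseteq> W" "\<And>x. \<psi> i x \<in> W" for i x W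
  proof -
    have "inverse (of_nat (fact j)) \<in> W" for j
      using W(2) subfield_inverse[OF k(1) subring_of_nat[OF k']] by blast
    then have "\<psi> i z * inverse (of_nat (fact j)) \<in> W" for j z using W(3) by (intro subring_mult[OF W(1)])
    then show ?thesis using i \<psi>[of i] by (simp add: poly_over_def coeff_exp_poly[OF D(1)] divide_inverse)
  qed
  have \<psi>E: "\<psi> i x \<in> E i" if "i \<le> n" for i x
    using that
  proof (induction i arbitrary: x)
    case (Suc i)
    have W: "is_subring (E (Suc i))" "E i \<subseteq> E (Suc i)" using Suc.prems subfield_subring[OF Ef] Emono[of i "Suc i"] by simp_all
    have "exp_poly (D i) (\<psi> i) x \<in> poly_over (E (Suc i))"
      using Suc W kE[of "Suc i"] by (intro coeffs) auto
    then show ?case using uE[of i] Suc.prems by (simp add: \<psi>S poly_poly_over[OF W(1)])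
  qed (simp add: \<psi>0 E(1) Pk)
  define U where "U = mpol_eval u ` mpol_ring k n"
  have U: "is_subring U" "k \<subseteq> U" "u ` {..<n} \<subseteq> U" unfolding U_def by (rule mpol_eval_image[OF k'])+
  have \<psi>U: "\<psi> i x \<in> U" if "i \<le> n" for i x
    using that
  proof (induction i arbitrary: x)
    case (Suc i)
    have "exp_poly (D i) (\<psi> i) x \<in> poly_over U" using Suc U by (intro coeffs) auto
    then show ?case using U(3) Suc.prems by (auto simp: \<psi>S intro!: poly_poly_over[OF U(1)])
  qed (use U(2) Pk in \<open>auto simp: \<psi>0\<close>)
  have expE: "exp_poly (D i) (\<psi> i) x \<in> poly_over (E i)" if "i < n" for i x
    using that \<psi>E kE subfield_subring[OF Ef] by (intro coeffs) auto
  \<comment> \<open>the constant term of the exponential is the previous homomorphism, and \<open>u i\<close> is transcendental over its values\<close>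
  have nz: "\<psi> i x \<noteq> 0" if "i \<le> n" "P x \<noteq> 0" for i x
    using that
  proof (induction i)
    case (Suc i)
    show ?case
    proof
      assume "\<psi> (Suc i) x = 0"
      then have "exp_poly (D i) (\<psi> i) x = 0"
        using u[of i] expE[of i x] alg_overI Suc.prems unfolding \<psi>S by (metis Suc_le_eq)
      then have "coeff (exp_poly (D i) (\<psi> i) x) 0 = 0" by simp
      moreover have "coeff (exp_poly (D i) (\<psi> i) x) 0 = \<psi> i x"
        using coeff_exp_poly[OF D(1) \<psi>, of i i x 0] Suc.prems by simp
      ultimately show False using Suc by simp
    qed
  qed (simp add: \<psi>0)
  have trans: "\<not> alg_over (E i) (\<psi> (Suc i) (a i))" if i: "i < n" for i
  proof
    let ?p = "exp_poly (D i) (\<psi> i) (a i)"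
    assume "alg_over (E i) (\<psi> (Suc i) (a i))"
    then obtain q where q: "q \<in> poly_over (E i)" "q \<noteq> 0" "poly q (poly ?p (u i)) = 0"
      unfolding alg_over_def \<psi>S by blast
    have "pcompose q ?p \<in> poly_over (E i)"
      using i by (intro pcompose_poly_over[OF subfield_subring[OF Ef] q(1) expE]) auto
    moreover have "poly (pcompose q ?p) (u i) = 0" using q(3) by (simp add: poly_pcompose)
    ultimately have "pcompose q ?p = 0" using u[OF i] alg_overI by blast
    moreover have "of_nat (fact (d i)) \<noteq> (0 :: 'b fract)"
    proof -
      obtain m where "fact (d i) = Suc m" using fact_gt_zero[where 'a=nat, of "d i"] gr0_implies_Suc by blast
      then show ?thesis using char[of m] by metis
    qed
    then have "coeff ?p (d i) \<noteq> 0"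
      using coeff_exp_poly[OF D(1) \<psi>, of i i "a i" "d i"] i nz[of i "e i"] Pe[OF i] by (simp add: e_def)
    then have "d i \<le> degree ?p" by (rule le_degree)
    then have "degree ?p > 0" using d0[OF i] by simp
    ultimately show False using q(2) pcompose_eq_0 by blast
  qed
  have an: "\<psi> j (a i) = \<psi> (Suc i) (a i)" if "Suc i \<le> j" "j \<le> n" for i j
    using that
  proof (induction j rule: dec_induct)
    case (step j)
    then show ?case using \<psi>c[of j "a i"] a(2)[of i j] by simp
  qed simp
  define C where "C i = is_subring hull (range \<phi> \<union> a ` {..<i})" for i
  have C: "is_subring (C i)" for i unfolding C_def by (rule subring_hull)
  note \<psi>n = \<psi>[OF order_refl]
  \<comment> \<open>injectivity on the algebra generated by the first elements of the triangular system\<close>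
  have inj: "\<psi> n x \<in> E i \<and> (\<psi> n x = 0 \<longrightarrow> x = 0)" if "i \<le> n" "x \<in> C i" for i x
    using that
  proof (induction i arbitrary: x)
    case 0
    have "is_subring (range \<phi>)"
      using hom_on_image_subring[OF subring_UNIV] \<phi> is_ring_hom_hom_on by blast
    then have "C 0 \<subseteq> range \<phi>" unfolding C_def by (intro hull_minimal) auto
    then obtain c where "x = \<phi> c" using 0 by blast
    then show ?case using \<psi>\<phi>[of n c] k(3) E(1) by simp
  next
    case (Suc i)
    have i: "i < n" using Suc.prems by simp
    have "C (Suc i) \<subseteq> (\<lambda>p. poly p (a i)) ` poly_over (C i)"
      unfolding C_def[of "Suc i"]
    proof (rule hull_minimal)
      show "is_subring ((\<lambda>p. poly p (a i)) ` poly_over (C i))" by (rule subring_eval_image[OF C])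
      have "range \<phi> \<union> a ` {..<i} \<subseteq> C i" unfolding C_def by (rule hull_subset)
      then show "range \<phi> \<union> a ` {..<Suc i} \<subseteq> (\<lambda>p. poly p (a i)) ` poly_over (C i)"
        using eval_image_base[OF C, of i "a i"] eval_image_gen[OF C, of "a i" i]
        by (simp add: lessThan_Suc) blast
    qed
    then obtain p where p: "p \<in> poly_over (C i)" "x = poly p (a i)" using Suc.prems(2) by blast
    let ?q = "map_poly (\<psi> n) p" and ?b = "\<psi> (Suc i) (a i)"
    have cq: "coeff ?q j = \<psi> n (coeff p j)" for j
      by (simp add: coeff_map_poly hom_on_0[OF subring_UNIV \<psi>n])
    have IH: "\<psi> n (coeff p j) \<in> E i" "\<psi> n (coeff p j) = 0 \<Longrightarrow> coeff p j = 0" for j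
      using Suc.IH[of "coeff p j"] coeff_poly_over[OF p(1)] i by auto
    have q: "?q \<in> poly_over (E i)" using IH by (simp add: poly_over_def cq)
    have xq: "\<psi> n x = poly ?q ?b"
      using an[of i n] i by (simp add: p(2) hom_on_poly[OF \<psi>n])
    have "?q \<in> poly_over (E (Suc i))" using q poly_over_mono[OF Emono[of i "Suc i"]] i by auto
    then have "\<psi> n x \<in> E (Suc i)"
      using \<psi>E[of "Suc i"] i by (simp add: xq poly_poly_over[OF subfield_subring[OF Ef]])
    moreover have "x = 0" if "\<psi> n x = 0"
    proof -
      have "?q = 0" using trans[OF i] q that alg_overI unfolding xq by blast
      then have "coeff p j = 0" for j using IH(2)[of j] cq[of j] by simp
      then have "p = 0" by (intro poly_eqI) simp
      then show ?thesis using p by simp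
    qed
    ultimately show ?case by blast
  qed
  have ker: "x = 0" if x: "\<psi> n x = 0" for x
  proof (rule ccontr)
    assume "x \<noteq> 0"
    let ?C = "frac_emb ` C n"
    have C': "is_subring ?C" by (rule hom_on_image_subring[OF C hom_on_mono[OF subset_UNIV hom_frac_emb]])
    have "range \<phi> \<union> a ` {..<n} \<subseteq> C n" unfolding C_def by (rule hull_subset)
    then have "range (\<lambda>c. frac_emb (\<phi> c)) \<subseteq> ?C" "frac_emb ` a ` {..<n} \<subseteq> ?C" by blast+
    then have "adjoin (range (\<lambda>c. frac_emb (\<phi> c))) (frac_emb ` a ` {..<n}) \<subseteq> is_subfield hull ?C"
      using hull_subset[of ?C is_subfield] by (intro adjoin_least subfield_hull) (blast dest: subset_trans)+
    then have "alg_over ?C (frac_emb x)" using alg_over_hull[OF C' alg_over_mono[OF _ alg]] by blast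
    moreover have "frac_emb x \<noteq> 0" using \<open>x \<noteq> 0\<close> by simp
    ultimately obtain p where p: "p \<in> poly_over ?C" "poly p (frac_emb x) = 0" "coeff p 0 \<noteq> 0"
      by (rule alg_over_nonzero_const)
    have "coeff p i \<in> range frac_emb" for i using coeff_poly_over[OF p(1), of i] by blast
    then obtain q where q: "p = map_poly frac_emb q" by (rule map_poly_frac_emb_lift)
    have "poly q x = 0" using p(2) by (simp add: q poly_map_poly_frac_emb)
    then have "poly (map_poly (\<psi> n) q) 0 = 0"
      using hom_on_poly[OF \<psi>n, of q x] hom_on_0[OF subring_UNIV \<psi>n] x by simp
    then have "\<psi> n (coeff q 0) = 0"
      by (simp add: poly_0_coeff_0 coeff_map_poly hom_on_0[OF subring_UNIV \<psi>n])
    moreover have "coeff q 0 \<in> C n" using coeff_poly_over[OF p(1), of 0] by (auto simp: q)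
    ultimately have "coeff q 0 = 0" using inj[of n] by blast
    then show False using p(3) by (simp add: q)
  qed
  show ?thesis
  proof (rule that[of "\<psi> n"])
    show "is_ring_hom (\<psi> n)" using \<psi>n is_ring_hom_hom_on by blast
    show "inj (\<psi> n)"
    proof (rule injI)
      fix x y assume "\<psi> n x = \<psi> n y"
      then have "\<psi> n (x - y) = 0" using hom_on_diff[OF subring_UNIV \<psi>n] by simp
      then show "x = y" using ker by fastforce
    qed
    show "range (\<psi> n) \<subseteq> mpol_eval u ` mpol_ring k n" using \<psi>U[of n] unfolding U_def by blast
  qed (simp_all add: indep \<psi>\<phi>)
qed

section \<open>Chains of kernels\<close>

lemma poset_ht_attained:
  assumes "poset_ht V = enat n" "V \<noteq> {}"
  obtains x where "\<And>i. i \<le> n \<Longrightarrow> x i \<in> V" "\<And>i. i < n \<Longrightarrow> x i < x (Suc i)"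
proof -
  let ?N = "{n. \<exists>x :: nat \<Rightarrow> 'a. (\<forall>i\<le>n. x i \<in> V) \<and> (\<forall>i<n. x i < x (Suc i))}"
  obtain v where "v \<in> V" using assms(2) by blast
  then have "0 \<in> ?N" by auto
  then have ne: "enat ` ?N \<noteq> {}" by blast
  have S: "Sup (enat ` ?N) = enat n" using assms(1) by (simp only: poset_ht_def)
  then have fin: "finite (enat ` ?N)" using ne unfolding Sup_enat_def by (metis enat.distinct(1))
  have "Sup (enat ` ?N) \<in> enat ` ?N"
    using Max_in[OF fin ne] ne fin unfolding Sup_enat_def by (simp only: if_False if_True)
  then have "n \<in> ?N" unfolding S by blast
  then show ?thesis using that by blast
qed

lemma alg_indep_list_append:
  assumes "alg_indep_list K zs" "z \<notin> alg_cl K (set zs)"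
  shows "alg_indep_list K (zs @ [z])"
  using assms by (auto simp: alg_indep_list_def nth_append less_Suc_eq)

text \<open>The algebraically closed subfields are the flats of the matroid of algebraic independence.\<close>

definition flat :: "'a::field set \<Rightarrow> 'a set \<Rightarrow> bool" where
  "flat k E \<longleftrightarrow> is_subfield E \<and> k \<subseteq> E \<and> (\<forall>x. alg_over E x \<longrightarrow> x \<in> E)"

lemma alg_indep_list_chain:
  assumes E: "\<And>i. i < n \<Longrightarrow> flat k (E i)"
    and mono: "\<And>i j. i \<le> j \<Longrightarrow> j < n \<Longrightarrow> E i \<subseteq> E j"
    and y: "\<And>i. Suc i < n \<Longrightarrow> y i \<in> E (Suc i)" "\<And>i. i < n \<Longrightarrow> y i \<notin> E i"
  shows "alg_indep_list k (map y [0..<n])"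
  unfolding alg_indep_list_def
proof (intro allI impI notI)
  fix i assume "i < length (map y [0..<n])"
  then have i: "i < n" by simp
  assume "map y [0..<n] ! i \<in> alg_cl k (set (take i (map y [0..<n])))"
  then have "alg_over (adjoin k (y ` {0..<i})) (y i)" using i by (simp add: alg_cl_def take_map)
  moreover have "adjoin k (y ` {0..<i}) \<subseteq> E i"
  proof (rule adjoin_least)
    show "y ` {0..<i} \<subseteq> E i"
    proof (rule image_subsetI)
      fix j assume "j \<in> {0..<i}"
      then show "y j \<in> E i" using y(1)[of j] mono[of "Suc j" i] i by auto
    qed
  qed (use E[OF i] in \<open>simp_all add: flat_def\<close>)
  ultimately have "alg_over (E i) (y i)" by (metis alg_over_mono)
  then show False using E[OF i] y(2)[OF i] by (simp add: flat_def)
qed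

locale affine_char_0 =
  fixes \<phi> :: "'k::field_char_0 \<Rightarrow> 'b::idom" and S :: "'b set"
  assumes hom: "is_ring_hom \<phi>" and fin: "finite S" and gen: "is_subring hull (range \<phi> \<union> S) = UNIV"
begin

abbreviation (input) "\<iota> \<equiv> \<lambda>c. frac_emb (\<phi> c)"

lemma \<iota>_hom: "is_ring_hom \<iota>"
  using hom by (simp add: is_ring_hom_def)

lemma char: "of_nat (Suc n) \<noteq> (0::'b)"
proof
  have "\<phi> (of_nat m) = of_nat m" for m
  proof (induction m)
    case 0 show ?case using ring_hom_0[OF \<iota>_hom] by simp
  qed (use hom in \<open>simp add: is_ring_hom_def\<close>)
  moreover assume "of_nat (Suc n) = (0::'b)"
  ultimately have "\<iota> (of_nat (Suc n)) = 0" by (simp only: frac_emb_eq_0)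
  then show False using ring_hom_eq_0[OF \<iota>_hom] by (metis of_nat_eq_0_iff nat.distinct(2))
qed

lemma char_fract: "of_nat (Suc n) \<noteq> (0::'b fract)"
  using char[of n] by (metis frac_emb_of_nat frac_emb_eq_0)

lemma infinite_range: "infinite (range \<phi>)" "infinite (range \<iota>)"
proof -
  show "infinite (range \<iota>)" using ring_hom_inj[OF \<iota>_hom] finite_imageD infinite_UNIV_char_0 by blast
  then show "infinite (range \<phi>)" by (metis finite_imageI image_image)
qed

lemma adjoin_gen_UNIV: "adjoin (range \<iota>) (frac_emb ` S) = UNIV"
proof -
  let ?A = "adjoin (range \<iota>) (frac_emb ` S)"
  have A: "is_subfield ?A" by (rule adjoin_subfield)
  have "UNIV \<subseteq> {x. frac_emb x \<in> ?A}"
    unfolding gen[symmetric]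
  proof (rule hull_minimal)
    show "is_subring {x. frac_emb x \<in> ?A}" using subfield_subring[OF A] by (simp add: is_subring_def)
    show "range \<phi> \<union> S \<subseteq> {x. frac_emb x \<in> ?A}"
      using adjoin_base[of "range \<iota>" "frac_emb ` S"] adjoin_gen[of "frac_emb ` S" "range \<iota>"] by blast
  qed
  then have e: "frac_emb x \<in> ?A" for x by blast
  have "z \<in> ?A" for z
  proof -
    obtain a b where "b \<noteq> 0" "z = frac_emb a / frac_emb b" by (rule fract_cases)
    then show ?thesis using subfield_divide[OF A e e] by simp
  qed
  then show ?thesis by blast
qed

lemma alg_indep_list_bounds:
  assumes "alg_indep_list (range \<iota>) zs"
  shows "enat (length zs) \<le> krull_dim TYPE('b)" "length zs \<le> card (frac_emb ` S)"
proof -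
  have "affine_domain \<phi>" unfolding affine_domain_def using hom fin gen by blast
  then show "enat (length zs) \<le> krull_dim TYPE('b)"
    using krull_dim_lower_bound infinite_range(1) assms by blast
  have "alg_cl (range \<iota>) (frac_emb ` S) = UNIV"
    using alg_cl_adjoin[of "range \<iota>" "frac_emb ` S"] adjoin_gen_UNIV by blast
  then show "length zs \<le> card (frac_emb ` S)" using steinitz assms fin by blast
qed

lemma kernel_const: "D \<in> LND \<Longrightarrow> D (\<phi> c) = 0"
proof (cases "c = 0")
  case True
  assume D: "D \<in> LND"
  have "\<phi> 0 = 0" using ring_hom_0[OF \<iota>_hom] by simp
  then show ?thesis using True derivation_0[OF LND_derivation[OF D]] by simp
next
  case False
  assume D: "D \<in> LND"
  have "\<phi> c * \<phi> (inverse c) = 1" using hom False by (metis is_ring_hom_def right_inverse)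
  then show ?thesis by (rule LND_unit[OF D char])
qed

abbreviation "k' \<equiv> alg_closure_in \<iota>"

lemma k'_eq: "k' = {x. alg_over (range \<iota>) x}"
  by (rule alg_closure_in_eq[OF \<iota>_hom])

lemma range_k': "range \<iota> \<subseteq> k'"
  using alg_over_elem[OF subfield_subring[OF ring_hom_range_subfield[OF \<iota>_hom]]] by (auto simp: k'_eq)

lemma k'_subfield: "is_subfield k'"
  unfolding k'_eq by (rule alg_closure_subfield[OF ring_hom_range_subfield[OF \<iota>_hom]])

lemma flat_k': "flat (range \<iota>) k'"
  unfolding flat_def using k'_subfield range_k' alg_over_trans[OF ring_hom_range_subfield[OF \<iota>_hom]]
  by (auto simp: k'_eq)

lemma k'_le_flat: "flat (range \<iota>) E \<Longrightarrow> k' \<subseteq> E"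
  unfolding flat_def k'_eq using alg_over_mono by blast

lemma flat_alg_cl: "is_subfield E \<Longrightarrow> range \<iota> \<subseteq> E \<Longrightarrow> flat (range \<iota>) (alg_cl E T)"
  unfolding flat_def
proof (intro conjI allI impI)
  assume E: "is_subfield E" "range \<iota> \<subseteq> E"
  show "is_subfield (alg_cl E T)" by (rule alg_cl_subfield)
  show "range \<iota> \<subseteq> alg_cl E T" using E adjoin_base alg_cl_adjoin by blast
  fix x assume "alg_over (alg_cl E T) x"
  then show "x \<in> alg_cl E T" using alg_over_trans[OF adjoin_subfield] by (simp add: alg_cl_def)
qed

lemma flat_UNIV: "flat (range \<iota>) UNIV"
  by (simp add: flat_def subfield_UNIV)

lemma flat_K_sub:
  assumes "\<Delta> \<subseteq> LND" shows "flat (range \<iota>) (K_sub \<Delta>)"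
  unfolding flat_def
proof (intro conjI allI impI)
  show "is_subfield (K_sub \<Delta>)" by (rule K_sub_subfield[OF assms])
  show "range \<iota> \<subseteq> K_sub \<Delta>"
    using assms kernel_const by (auto simp: K_sub_eq[OF assms] fder_emb[OF LND_derivation])
  show "x \<in> K_sub \<Delta>" if "alg_over (K_sub \<Delta>) x" for x using K_sub_alg_closed[OF assms char_fract that] .
qed

text \<open>Elements chosen in the successive differences of a chain of algebraically closed fields are algebraically
  independent.\<close>

lemma flat_chain_bounds:
  assumes E: "\<And>i. i \<le> n \<Longrightarrow> flat (range \<iota>) (E i)" and strict: "\<And>i. i < n \<Longrightarrow> E i \<subset> E (Suc i)"
  shows "enat n \<le> krull_dim TYPE('b)" "n \<le> card (frac_emb ` S)"
proof -
  have mono: "E i \<subseteq> E j" if "i \<le> j" "j \<le> n" for i j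
    using that
  proof (induction j rule: dec_induct)
    case (step j)
    then show ?case using strict[of j] by auto
  qed simp
  have "\<forall>i. \<exists>y. i < n \<longrightarrow> y \<in> E (Suc i) \<and> y \<notin> E i" using strict by blast
  then obtain y where y: "\<And>i. i < n \<Longrightarrow> y i \<in> E (Suc i)" "\<And>i. i < n \<Longrightarrow> y i \<notin> E i" by metis
  have "alg_indep_list (range \<iota>) (map y [0..<n])"
    by (rule alg_indep_list_chain[of n _ E]) (use E mono y in auto)
  from alg_indep_list_bounds[OF this]
  show "enat n \<le> krull_dim TYPE('b)" "n \<le> card (frac_emb ` S)" by simp_all
qed

lemma height_K_le: "poset_ht (K_poset :: 'b fract set set) \<le> krull_dim TYPE('b)"
    "poset_ht (K_poset :: 'b fract set set) \<le> enat (card (frac_emb ` S))"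
proof -
  have *: "enat n \<le> krull_dim TYPE('b) \<and> enat n \<le> enat (card (frac_emb ` S))"
    if x: "\<forall>i\<le>n. x i \<in> (K_poset :: 'b fract set set)" "\<forall>i<n. x i < x (Suc i)" for n x
  proof -
    have fl: "flat (range \<iota>) (x i)" if i: "i \<le> n" for i
    proof -
      obtain \<Delta> where "\<Delta> \<subseteq> LND" "x i = K_sub \<Delta>" using x(1) i unfolding K_poset_def by blast
      then show ?thesis using flat_K_sub by simp
    qed
    have strict: "x i \<subset> x (Suc i)" if "i < n" for i using x(2) that by blast
    show ?thesis using flat_chain_bounds[of n x, OF fl strict] by simp
  qed
  show "poset_ht (K_poset :: 'b fract set set) \<le> krull_dim TYPE('b)"
    unfolding poset_ht_def by (rule SUP_least) (use * in blast)
  show "poset_ht (K_poset :: 'b fract set set) \<le> enat (card (frac_emb ` S))"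
    unfolding poset_ht_def by (rule SUP_least) (use * in blast)
qed

lemma K_sub_antimono: "\<Delta> \<subseteq> \<Delta>' \<Longrightarrow> K_sub \<Delta>' \<subseteq> K_sub \<Delta>"
  unfolding K_sub_def by blast

definition annihilator :: "'b set \<Rightarrow> ('b \<Rightarrow> 'b) set" where
  "annihilator A = {D \<in> LND. A \<subseteq> der_ker D}"

lemma annihilator_LND: "annihilator A \<subseteq> LND"
  by (auto simp: annihilator_def)

lemma A_sub_annihilator: "A \<in> A_poset \<Longrightarrow> A_sub (annihilator A) = A"
  unfolding A_poset_def A_sub_def annihilator_def by blast

text \<open>The ring of constants is recovered from its field as the intersection with \<open>B\<close>, provided that a member of
  the poset is described by all the derivations that kill it.\<close>

lemma A_chain_K_chain:
  assumes "A \<in> A_poset" "A' \<in> A_poset" "A \<subset> A'"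
  shows "K_sub (annihilator A) \<subset> K_sub (annihilator A')"
proof -
  have "annihilator A' \<subseteq> annihilator A" using assms(3) by (auto simp: annihilator_def)
  then have "K_sub (annihilator A) \<subseteq> K_sub (annihilator A')" by (rule K_sub_antimono)
  moreover obtain x where "x \<in> A'" "x \<notin> A" using assms(3) by blast
  then have "frac_emb x \<in> K_sub (annihilator A')" "frac_emb x \<notin> K_sub (annihilator A)"
    using A_sub_eq[OF annihilator_LND] A_sub_annihilator assms(1,2) by metis+
  ultimately show ?thesis by blast
qed

lemma height_A_le: "poset_ht (A_poset :: 'b set set) \<le> poset_ht (K_poset :: 'b fract set set)"
  unfolding poset_ht_def[of A_poset]
proof (rule SUP_least)
  fix n assume "n \<in> {n. \<exists>x :: nat \<Rightarrow> 'b set. (\<forall>i\<le>n. x i \<in> A_poset) \<and> (\<forall>i<n. x i < x (Suc i))}"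
  then obtain x :: "nat \<Rightarrow> 'b set" where x: "\<And>i. i \<le> n \<Longrightarrow> x i \<in> A_poset" "\<And>i. i < n \<Longrightarrow> x i < x (Suc i)" by blast
  show "enat n \<le> poset_ht (K_poset :: 'b fract set set)"
  proof (rule poset_ht_ge)
    show "K_sub (annihilator (x i)) \<in> K_poset" for i using annihilator_LND unfolding K_poset_def by blast
    show "K_sub (annihilator (x i)) < K_sub (annihilator (x (Suc i)))" if "i < n" for i
      using that x by (intro A_chain_K_chain) auto
  qed
qed

text \<open>A chain whose length is the dimension cannot be refined.\<close>

lemma maximal_chain_bottom:
  assumes dim: "krull_dim TYPE('b) = enat n"
    and E: "\<And>i. i \<le> n \<Longrightarrow> flat (range \<iota>) (E i)" "\<And>i. i < n \<Longrightarrow> E i \<subset> E (Suc i)"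
  shows "E 0 = k'"
proof (rule ccontr)
  assume ne: "E 0 \<noteq> k'"
  have "enat (Suc n) \<le> krull_dim TYPE('b)"
  proof (rule flat_chain_bounds(1)[of "Suc n" "case_nat k' E"])
    show "flat (range \<iota>) (case_nat k' E i)" if "i \<le> Suc n" for i
      using that E(1) flat_k' by (cases i) auto
    show "case_nat k' E i \<subset> case_nat k' E (Suc i)" if "i < Suc n" for i
      using that E(2) ne k'_le_flat[OF E(1)[of 0]] by (cases i) auto
  qed
  then show False using dim by simp
qed

lemma maximal_chain_top:
  assumes dim: "krull_dim TYPE('b) = enat n"
    and E: "\<And>i. i \<le> n \<Longrightarrow> flat (range \<iota>) (E i)" "\<And>i. i < n \<Longrightarrow> E i \<subset> E (Suc i)"
  shows "E n = UNIV"
proof (rule ccontr)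
  assume ne: "E n \<noteq> UNIV"
  have "enat (Suc n) \<le> krull_dim TYPE('b)"
  proof (rule flat_chain_bounds(1)[of "Suc n" "\<lambda>i. if i \<le> n then E i else UNIV"])
    show "(if i \<le> n then E i else UNIV) \<subset> (if Suc i \<le> n then E (Suc i) else UNIV)" if "i < Suc n" for i
      using that E(2)[of i] ne by (cases "i = n") auto
  qed (use E(1) flat_UNIV in auto)
  then show False using dim by simp
qed

text \<open>Otherwise the algebraic closure of \<open>E\<^sub>i(b)\<close> could be inserted into the chain.\<close>

lemma maximal_chain_step:
  assumes dim: "krull_dim TYPE('b) = enat n"
    and E: "\<And>i. i \<le> n \<Longrightarrow> flat (range \<iota>) (E i)" "\<And>i. i < n \<Longrightarrow> E i \<subset> E (Suc i)"
    and i: "i < n" and b: "b \<in> E (Suc i)" "b \<notin> E i" and m: "m \<in> E (Suc i)"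
  shows "alg_over (adjoin (E i) {b}) m"
proof (rule ccontr)
  assume "\<not> alg_over (adjoin (E i) {b}) m"
  then have mc: "m \<notin> alg_cl (E i) {b}" by (simp add: alg_cl_def)
  have Ei: "flat (range \<iota>) (E i)" "flat (range \<iota>) (E (Suc i))" using E(1) i by simp_all
  have "adjoin (E i) {b} \<subseteq> E (Suc i)" using Ei(2) E(2)[OF i] b by (intro adjoin_least) (auto simp: flat_def)
  then have up: "alg_cl (E i) {b} \<subset> E (Suc i)"
    using Ei(2) alg_over_mono mc m unfolding alg_cl_def flat_def by blast
  have low: "E i \<subset> alg_cl (E i) {b}"
    using adjoin_base[of "E i" "{b}"] adjoin_gen[of "{b}" "E i"] alg_cl_adjoin[of "E i" "{b}"] b(2) by blast
  \<comment> \<open>the refined chain, one step longer\<close>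
  define E' where "E' j = (if j \<le> i then E j else if j = Suc i then alg_cl (E i) {b} else E (j - 1))" for j
  have "enat (Suc n) \<le> krull_dim TYPE('b)"
  proof (rule flat_chain_bounds(1))
    show "flat (range \<iota>) (E' j)" if "j \<le> Suc n" for j
      using that i E(1) flat_alg_cl[of "E i" "{b}"] Ei(1) by (auto simp: E'_def flat_def[of _ "E i"])
    show "E' j \<subset> E' (Suc j)" if j: "j < Suc n" for j
    proof -
      consider "j < i" | "j = i" | "j = Suc i" | l where "j = Suc l" "i < l"
        by (metis Suc_lessI less_Suc_eq not_less_eq Suc_less_eq2)
      then show ?thesis
      proof cases
        case 4
        then show ?thesis using E(2)[of l] j by (simp add: E'_def)
      qed (use E(2)[of j] i low up in \<open>simp_all add: E'_def\<close>)
    qed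
  qed
  then show False using dim by simp
qed

lemma FML_eq: "(FML :: 'b fract set) = K_sub LND"
  by (simp add: FML_def K_sub_def)

lemma FML_maximal_height:
  assumes "poset_ht (K_poset :: 'b fract set set) = krull_dim TYPE('b)"
  obtains n where "krull_dim TYPE('b) = enat n" "(FML :: 'b fract set) = k'"
proof -
  have "krull_dim TYPE('b) \<le> enat (card (frac_emb ` S))" using height_K_le(2) assms by simp
  then obtain n where n: "krull_dim TYPE('b) = enat n" using enat_ile by blast
  have "K_sub {} \<in> (K_poset :: 'b fract set set)" unfolding K_poset_def by blast
  then have ne: "(K_poset :: 'b fract set set) \<noteq> {}" by blast
  obtain x :: "nat \<Rightarrow> 'b fract set" where x: "\<And>i. i \<le> n \<Longrightarrow> x i \<in> K_poset" "\<And>i. i < n \<Longrightarrow> x i < x (Suc i)"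
    using poset_ht_attained[OF trans[OF assms n] ne] by blast
  have K: "\<exists>\<Delta>\<subseteq>LND. x i = K_sub \<Delta>" if "i \<le> n" for i using x(1)[OF that] unfolding K_poset_def by blast
  have fl: "flat (range \<iota>) (x i)" if "i \<le> n" for i using K[OF that] flat_K_sub by auto
  have "x 0 = k'" by (rule maximal_chain_bottom[of n x, OF n fl x(2)])
  moreover obtain \<Delta> where "\<Delta> \<subseteq> LND" "x 0 = K_sub \<Delta>" using K[of 0] by auto
  moreover have "K_sub LND \<subseteq> K_sub \<Delta>" by (rule K_sub_antimono) fact
  moreover have "k' \<subseteq> K_sub LND" by (rule k'_le_flat[OF flat_K_sub[OF subset_refl]])
  ultimately have "K_sub LND = k'" by simp
  then show ?thesis by (intro that[OF n]) (simp add: FML_eq)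
qed

text \<open>The fields of a chain of rings of length \<open>n\<close> start at \<open>k'\<close> and end at the whole fraction field, and each is
  obtained from the previous one by adjoining one element. For \<open>i < n\<close> an element of the next ring and a derivation \<open>D i\<close>
  that kills the \<open>i\<close>-th ring but not this element form the triangular system for the embedding.\<close>

lemma embedding_maximal_height:
  assumes ht: "poset_ht (A_poset :: 'b set set) = enat n" and dim: "krull_dim TYPE('b) = enat n"
  shows "purely_transcendental k' (UNIV :: 'b fract set) n \<and>
     (\<exists>\<psi> :: 'b \<Rightarrow> 'b fract mpol. is_ring_hom \<psi> \<and> inj \<psi> \<and> range \<psi> \<subseteq> mpol_ring k' n \<and>
        (\<forall>c. \<psi> (\<phi> c) = mpol_const (\<iota> c)))"
proof -
  have "A_sub {} \<in> (A_poset :: 'b set set)" unfolding A_poset_def by blast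
  then have ne: "(A_poset :: 'b set set) \<noteq> {}" by blast
  obtain x :: "nat \<Rightarrow> 'b set" where x: "\<And>i. i \<le> n \<Longrightarrow> x i \<in> A_poset" "\<And>i. i < n \<Longrightarrow> x i < x (Suc i)"
    using poset_ht_attained[OF ht ne] by blast
  define \<Gamma> where "\<Gamma> i = annihilator (x i)" for i
  have \<Gamma>: "\<Gamma> i \<subseteq> LND" for i unfolding \<Gamma>_def by (rule annihilator_LND)
  have x\<Gamma>: "A_sub (\<Gamma> i) = x i" if "i \<le> n" for i unfolding \<Gamma>_def by (rule A_sub_annihilator[OF x(1)[OF that]])
  define E where "E i = K_sub (\<Gamma> i)" for i
  have fl: "flat (range \<iota>) (E i)" for i unfolding E_def by (rule flat_K_sub[OF \<Gamma>])
  have strict: "E i \<subset> E (Suc i)" if "i < n" for i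
    using that x unfolding E_def \<Gamma>_def by (intro A_chain_K_chain) auto
  have E0: "E 0 = k'" by (rule maximal_chain_bottom[of n E, OF dim fl strict])
  have En: "E n = UNIV" by (rule maximal_chain_top[of n E, OF dim fl strict])
  have xE: "z \<in> x i \<longleftrightarrow> frac_emb z \<in> E i" if "i \<le> n" for z i
    unfolding E_def using A_sub_eq[OF \<Gamma>, of z i] x\<Gamma>[OF that] by simp
  have xmono: "x i \<subseteq> x j" if "i \<le> j" "j \<le> n" for i j
    using that
  proof (induction j rule: dec_induct)
    case (step j)
    then show ?case using x(2)[of j] by auto
  qed simp
  have "\<forall>i. \<exists>a D. i < n \<longrightarrow> a \<in> x (Suc i) \<and> a \<notin> x i \<and> D \<in> \<Gamma> i \<and> D a \<noteq> 0"
  proof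
    fix i
    show "\<exists>a D. i < n \<longrightarrow> a \<in> x (Suc i) \<and> a \<notin> x i \<and> D \<in> \<Gamma> i \<and> D a \<noteq> 0"
    proof (cases "i < n")
      case True
      then obtain a where a: "a \<in> x (Suc i)" "a \<notin> x i" using x(2)[of i] by blast
      then have "a \<notin> A_sub (\<Gamma> i)" using x\<Gamma>[of i] True by simp
      then show ?thesis using a unfolding A_sub_def der_ker_def by blast
    qed blast
  qed
  then obtain a D where aD: "\<And>i. i < n \<Longrightarrow> a i \<in> x (Suc i)" "\<And>i. i < n \<Longrightarrow> a i \<notin> x i"
      "\<And>i. i < n \<Longrightarrow> D i \<in> \<Gamma> i" "\<And>i. i < n \<Longrightarrow> D i (a i) \<noteq> 0"
    by metis
  have aE: "frac_emb (a i) \<in> E (Suc i)" "frac_emb (a i) \<notin> E i" if "i < n" for i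
    using xE[of "Suc i" "a i"] xE[of i "a i"] aD(1,2)[OF that] that by simp_all
  have tri: "D j (a i) = 0" if "i < j" "j < n" for i j
  proof -
    have "a i \<in> x j" using aD(1)[of i] xmono[of "Suc i" j] that by auto
    then show ?thesis using aD(3)[OF that(2)] by (auto simp: \<Gamma>_def annihilator_def der_ker_def)
  qed
  have "\<forall>i. \<exists>u. i < n \<longrightarrow> E (Suc i) = adjoin (E i) {u} \<and> \<not> alg_over (E i) u"
  proof (intro allI)
    fix i
    show "\<exists>u. i < n \<longrightarrow> E (Suc i) = adjoin (E i) {u} \<and> \<not> alg_over (E i) u"
    proof (cases "i < n")
      case i: True
      have "is_subfield (E (Suc i))" "K_sub (\<Gamma> i) \<subseteq> E (Suc i)"
        using fl strict[OF i] by (auto simp: flat_def E_def)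
      moreover have "alg_over (adjoin (K_sub (\<Gamma> i)) {frac_emb (a i)}) m" if "m \<in> E (Suc i)" for m
        using maximal_chain_step[of n E i, OF dim fl strict i aE[OF i] that] by (simp add: E_def)
      ultimately obtain u where "E (Suc i) = adjoin (K_sub (\<Gamma> i)) {u}" "\<not> alg_over (K_sub (\<Gamma> i)) u"
        using kernel_tower_step[OF \<Gamma> char _ _ aD(3)[OF i] aD(4)[OF i] aE(1)[OF i]] by blast
      then show ?thesis unfolding E_def by blast
    qed blast
  qed
  then obtain u where u: "\<And>i. i < n \<Longrightarrow> E (Suc i) = adjoin (E i) {u i}" "\<And>i. i < n \<Longrightarrow> \<not> alg_over (E i) (u i)"
    by metis
  have indep: "alg_indep_list (range \<iota>) (map (\<lambda>i. frac_emb (a i)) [0..<n])"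
  proof (rule alg_indep_list_chain[OF fl])
    show "E i \<subseteq> E j" if "i \<le> j" "j < n" for i j
      using that
    proof (induction j rule: dec_induct)
      case (step j)
      then show ?case using strict[of j] by auto
    qed simp
  qed (use aE in auto)
  have alg: "alg_over (adjoin (range \<iota>) (frac_emb ` a ` {..<n})) (frac_emb z)" for z
  proof (rule ccontr)
    let ?zs = "map (\<lambda>i. frac_emb (a i)) [0..<n]"
    have zs: "set ?zs = frac_emb ` a ` {..<n}" by (auto simp: image_image)
    assume "\<not> alg_over (adjoin (range \<iota>) (frac_emb ` a ` {..<n})) (frac_emb z)"
    then have "frac_emb z \<notin> alg_cl (range \<iota>) (set ?zs)" unfolding zs alg_cl_def by blast
    then have "enat (length (?zs @ [frac_emb z])) \<le> krull_dim TYPE('b)"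
      by (rule alg_indep_list_bounds(1)[OF alg_indep_list_append[OF indep]])
    then show False using dim by simp
  qed
  have inf: "infinite k'" using infinite_range(2) range_k' finite_subset by blast
  have \<iota>k': "frac_emb (\<phi> c) \<in> k'" for c using range_k' by blast
  have DL: "D i \<in> LND" "D i (\<phi> c) = 0" if "i < n" for i c
    using aD(3)[OF that] \<Gamma>[of i] kernel_const by blast+
  have "\<exists>\<psi>. alg_indep k' n u \<and> is_ring_hom \<psi> \<and> inj \<psi> \<and> range \<psi> \<subseteq> mpol_eval u ` mpol_ring k' n \<and>
      (\<forall>c. \<psi> (\<phi> c) = \<iota> c)"
    by (rule exp_point_embedding[where E = E and n = n and u = u and D = D and a = a,
        OF char_fract hom fin gen k'_subfield inf \<iota>k' E0 u(1) En u(2) DL aD(4) tri alg])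
      (assumption | blast)+
  then obtain \<psi> where \<psi>: "alg_indep k' n u" "is_ring_hom \<psi>" "inj \<psi>" "range \<psi> \<subseteq> mpol_eval u ` mpol_ring k' n"
      "\<And>c. \<psi> (\<phi> c) = \<iota> c" by blast
  obtain \<Psi> where \<Psi>: "is_ring_hom \<Psi>" "inj \<Psi>" "range \<Psi> \<subseteq> mpol_ring k' n"
      "\<And>x. \<psi> x \<in> k' \<Longrightarrow> \<Psi> x = mpol_const (\<psi> x)"
    by (rule mpol_lift[OF subfield_subring[OF k'_subfield] \<psi>(1-4)], rule that, assumption+)
  have "E i \<subseteq> adjoin k' (u ` {..<n})" if "i \<le> n" for i
    using that
  proof (induction i)
    case 0 show ?case unfolding E0 by (rule adjoin_base)
  next
    case (Suc i)
    have "u i \<in> adjoin k' (u ` {..<n})" using adjoin_gen[of "u ` {..<n}" k'] Suc.prems by auto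
    moreover have "E i \<subseteq> adjoin k' (u ` {..<n})" using Suc by simp
    ultimately have "adjoin (E i) {u i} \<subseteq> adjoin k' (u ` {..<n})" by (intro adjoin_least adjoin_subfield) auto
    then show ?case using u(1)[of i] Suc.prems by simp
  qed
  then have "adjoin k' (u ` {..<n}) = UNIV" using En by blast
  then have "purely_transcendental k' (UNIV :: 'b fract set) n"
    unfolding purely_transcendental_def adjoin_def using \<psi>(1) by blast
  moreover have "\<Psi> (\<phi> c) = mpol_const (\<iota> c)" for c using \<Psi>(4)[of "\<phi> c"] \<psi>(5) \<iota>k' by simp
  ultimately show ?thesis using \<Psi>(1-3) by blast
qed

end

theorem theorem4p11:
  fixes \<phi> :: "'k::field_char_0 \<Rightarrow> 'b::idom"
  assumes "affine_domain \<phi>"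
  shows "let \<iota> = (\<lambda>c. frac_emb (\<phi> c));
             k' = alg_closure_in \<iota>;
             dimB = krull_dim TYPE('b);
             htA = poset_ht (A_poset :: 'b set set);
             htK = poset_ht (K_poset :: 'b fract set set)
     in is_finite_ext \<iota> k' \<and>
        (htA \<le> htK \<and> htK \<le> dimB) \<and>
        (htK = dimB \<longrightarrow> (FML :: 'b fract set) = k') \<and>
        (htA = dimB \<longrightarrow>
           (FML :: 'b fract set) = k' \<and>
           (\<exists>n. dimB = enat n \<and>
              purely_transcendental k' (UNIV :: 'b fract set) n \<and>
              (\<exists>\<psi> :: 'b \<Rightarrow> 'b fract mpol.
                 is_ring_hom \<psi> \<and> inj \<psi> \<and> range \<psi> \<subseteq> mpol_ring k' n \<and>
                 (\<forall>c. \<psi> (\<phi> c) = mpol_const (\<iota> c)))))"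
proof -
  obtain S where "is_ring_hom \<phi>" "finite S" "is_subring hull (range \<phi> \<union> S) = UNIV"
    using assms unfolding affine_domain_def by blast
  then interpret affine_char_0 \<phi> S by unfold_locales
  have "is_finite_ext \<iota> k'"
    by (rule finite_alg_closure[OF \<iota>_hom finite_imageI[OF fin] adjoin_gen_UNIV])
  moreover have "(FML :: 'b fract set) = k' \<and> (\<exists>n. krull_dim TYPE('b) = enat n \<and>
      purely_transcendental k' (UNIV :: 'b fract set) n \<and>
      (\<exists>\<psi> :: 'b \<Rightarrow> 'b fract mpol. is_ring_hom \<psi> \<and> inj \<psi> \<and> range \<psi> \<subseteq> mpol_ring k' n \<and>
         (\<forall>c. \<psi> (\<phi> c) = mpol_const (\<iota> c))))"
    if ht: "poset_ht (A_poset :: 'b set set) = krull_dim TYPE('b)"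
  proof -
    have "poset_ht (K_poset :: 'b fract set set) = krull_dim TYPE('b)"
      using height_A_le height_K_le(1) ht by simp
    then obtain n where n: "krull_dim TYPE('b) = enat n" "(FML :: 'b fract set) = k'"
      by (rule FML_maximal_height)
    then show ?thesis using embedding_maximal_height[of n] ht by auto
  qed
  moreover have "(FML :: 'b fract set) = k'" if "poset_ht (K_poset :: 'b fract set set) = krull_dim TYPE('b)"
    by (rule FML_maximal_height[OF that])
  ultimately show ?thesis
    unfolding Let_def using height_A_le height_K_le(1) by blast
qed

end
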